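(* (a) There exist a complex Banach space $X$ and an operator $A\in L(X)$ which is bounded below and whose range is not complemented (so that $A$ is upper generalized Drazin-Riesz invertible and upper generalized Drazin-meromorphic invertible) such that $A$ admits neither a generalized Saphar-Riesz decomposition nor a generalized Saphar-meromorphic decomposition, and $A$ is neither left generalized Drazin-Riesz invertible nor left generalized Drazin-meromorphic invertible. (b) There exist a complex Banach space $X$ and an operator $A\in L(X)$ which is surjective and whose null-space is not complemented (so that $A$ is lower generalized Drazin-Riesz invertible and lower generalized Drazin-meromorphic invertible) such that $A$ admits neither a generalized Saphar-Riesz decomposition nor a generalized Saphar-meromorphic decomposition, and $A$ is neither right generalized Drazin-Riesz invertible nor right generalized Drazin-meromorphic invertible.
   Context: $L(X)$ is the algebra of bounded linear operators on $X$; $\mathcal N(A)$, $\mathcal R(A)$ denote null-space and range. The notions below are used for operators on any complex Banach space, in particular on closed invariant subspaces (possibly $\{0\}$). A subspace is complemented if it is closed and has a closed algebraic complement. $(M,N)\in Red(A)$ means: $M,N$ are closed $A$-invariant subspaces with $X=M\oplus N$; $A_M$, $A_N$ are the restrictions of $A$ to $M$, $N$. $A$ is Riesz if $\dim\mathcal N(A-\lambda I)<\infty$ and $\mathrm{codim}\,\mathcal R(A-\lambda I)<\infty$ for every nonzero $\lambda\in\mathbb C$. $A$ is meromorphic if every nonzero point of its spectrum is a pole of its resolvent. $A$ is Kato if $\mathcal R(A)$ is closed and $\mathcal N(A)\subset\mathcal R(A^n)$ for every $n\in\mathbb N$; $A$ is Saphar if it is Kato and $\mathcal N(A)$, $\mathcal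 R(A)$ are complemented. $A$ admits a generalized Saphar-Riesz (resp. Saphar-meromorphic) decomposition if there is $(M,N)\in Red(A)$ with $A_M$ Saphar and $A_N$ Riesz (resp. meromorphic). $A$ is upper (resp. lower) generalized Drazin-Riesz invertible if there is $(M,N)\in Red(A)$ with $A_M$ bounded below (resp. surjective) and $A_N$ Riesz; $A$ is upper (resp. lower) generalized Drazin-meromorphic invertible if there is $(M,N)\in Red(A)$ with $A_M$ bounded below (resp. surjective) and $A_N$ meromorphic. $A$ is left generalized Drazin-Riesz (resp. left generalized Drazin-meromorphic) invertible if there is $B\in L(X)$ with $ABA=BA^2$, $B^2A=B$ and $A-ABA$ Riesz (resp. meromorphic). $A$ is right generalized Drazin-Riesz (resp. right generalized Drazin-meromorphic) invertible if there is $B\in L(X)$ with $ABA=A^2B$, $AB^2=B$ and $A-ABA$ Riesz (resp. meromorphic). *)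

theory Defs
  imports "HOL-Analysis.Analysis" "HOL-Library.Function_Algebras"
begin

text \<open>
  A complex normed space is a linear subspace \<open>vecs X\<close> of an ambient complex vector space (given
  by an additive type together with a scalar multiplication \<open>scl X\<close>), with a norm \<open>nrm X\<close> of
  which only the values on \<open>vecs X\<close> matter. Operators are functions on the ambient type of which
  only the behaviour on \<open>vecs X\<close> matters. Then the restriction of an operator to an invariant
  subspace \<open>M\<close> is the same function, regarded as an operator on the space \<open>restr X M\<close>.
\<close>

record 'a cnspace =
  vecs :: "'a set"
  scl :: "complex \<Rightarrow> 'a \<Rightarrow> 'a"
  nrm :: "'a \<Rightarrow> real"

definition restr :: "'a cnspace \<Rightarrow> 'a set \<Rightarrow> 'a cnspace" where
  "restr X M = X\<lparr>vecs := M\<rparr>"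

text \<open>The library's \<open>Metric_space\<close> asks for nonnegativity and symmetry on the whole type,
  hence the value 0 outside \<open>vecs X\<close>.\<close>

definition ndist :: "'a::ab_group_add cnspace \<Rightarrow> 'a \<Rightarrow> 'a \<Rightarrow> real" where
  "ndist X x y = (if x \<in> vecs X \<and> y \<in> vecs X then nrm X (x - y) else 0)"

definition cbanach :: "'a::ab_group_add cnspace \<Rightarrow> bool" where
  "cbanach X \<longleftrightarrow>
     vector_space (scl X) \<and> module.subspace (scl X) (vecs X) \<and>
     (\<forall>x\<in>vecs X. 0 \<le> nrm X x \<and> (nrm X x = 0 \<longleftrightarrow> x = 0)) \<and>
     (\<forall>c. \<forall>x\<in>vecs X. nrm X (scl X c x) = cmod c * nrm X x) \<and>
     (\<forall>x\<in>vecs X. \<forall>y\<in>vecs X. nrm X (x + y) \<le> nrm X x + nrm X y) \<and>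
     Metric_space.mcomplete (vecs X) (ndist X)"

subsection \<open>Subspaces\<close>

definition closed_in_space :: "'a::ab_group_add cnspace \<Rightarrow> 'a set \<Rightarrow> bool" where
  "closed_in_space X S \<longleftrightarrow> closedin (Metric_space.mtopology (vecs X) (ndist X)) S"

definition closed_subspace :: "'a::ab_group_add cnspace \<Rightarrow> 'a set \<Rightarrow> bool" where
  "closed_subspace X S \<longleftrightarrow> module.subspace (scl X) S \<and> closed_in_space X S"

definition direct_sum :: "'a::ab_group_add cnspace \<Rightarrow> 'a set \<Rightarrow> 'a set \<Rightarrow> bool" where
  "direct_sum X M N \<longleftrightarrow> vecs X = {m + n | m n. m \<in> M \<and> n \<in> N} \<and> M \<inter> N = {0}"

definition complemented :: "'a::ab_group_add cnspace \<Rightarrow> 'a set \<Rightarrow> bool" where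
  "complemented X S \<longleftrightarrow>
     closed_subspace X S \<and> (\<exists>T. closed_subspace X T \<and> direct_sum X S T)"

definition finite_dim :: "'a::ab_group_add cnspace \<Rightarrow> 'a set \<Rightarrow> bool" where
  "finite_dim X S \<longleftrightarrow> (\<exists>F. finite F \<and> S = module.span (scl X) F)"

text \<open>The classes of the elements of \<open>F\<close> span the quotient of \<open>vecs X\<close> by \<open>S\<close>.\<close>

definition finite_codim :: "'a::ab_group_add cnspace \<Rightarrow> 'a set \<Rightarrow> bool" where
  "finite_codim X S \<longleftrightarrow>
     (\<exists>F. finite F \<and> F \<subseteq> vecs X \<and> vecs X = module.span (scl X) (S \<union> F))"

subsection \<open>Operators\<close>

definition bounded_op :: "'a::ab_group_add cnspace \<Rightarrow> ('a \<Rightarrow> 'a) \<Rightarrow> bool" where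
  "bounded_op X A \<longleftrightarrow>
     A ` vecs X \<subseteq> vecs X \<and>
     (\<forall>x\<in>vecs X. \<forall>y\<in>vecs X. A (x + y) = A x + A y) \<and>
     (\<forall>c. \<forall>x\<in>vecs X. A (scl X c x) = scl X c (A x)) \<and>
     (\<exists>K. \<forall>x\<in>vecs X. nrm X (A x) \<le> K * nrm X x)"

definition op_norm :: "'a::ab_group_add cnspace \<Rightarrow> ('a \<Rightarrow> 'a) \<Rightarrow> real" where
  "op_norm X A = (SUP x\<in>{x \<in> vecs X. nrm X x \<le> 1}. nrm X (A x))"

definition null_space :: "'a::ab_group_add cnspace \<Rightarrow> ('a \<Rightarrow> 'a) \<Rightarrow> 'a set" where
  "null_space X A = {x \<in> vecs X. A x = 0}"

definition range_space :: "'a cnspace \<Rightarrow> ('a \<Rightarrow> 'a) \<Rightarrow> 'a set" where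
  "range_space X A = A ` vecs X"

definition bounded_below :: "'a cnspace \<Rightarrow> ('a \<Rightarrow> 'a) \<Rightarrow> bool" where
  "bounded_below X A \<longleftrightarrow> (\<exists>c>0. \<forall>x\<in>vecs X. c * nrm X x \<le> nrm X (A x))"

definition surjective :: "'a cnspace \<Rightarrow> ('a \<Rightarrow> 'a) \<Rightarrow> bool" where
  "surjective X A \<longleftrightarrow> range_space X A = vecs X"

definition minus_scalar :: "'a::ab_group_add cnspace \<Rightarrow> ('a \<Rightarrow> 'a) \<Rightarrow> complex \<Rightarrow> 'a \<Rightarrow> 'a" where
  "minus_scalar X A z = (\<lambda>x. A x - scl X z x)"

definition invertible_op :: "'a::ab_group_add cnspace \<Rightarrow> ('a \<Rightarrow> 'a) \<Rightarrow> bool" where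
  "invertible_op X A \<longleftrightarrow> (\<exists>B. bounded_op X B \<and> (\<forall>x\<in>vecs X. A (B x) = x \<and> B (A x) = x))"

definition spectrum :: "'a::ab_group_add cnspace \<Rightarrow> ('a \<Rightarrow> 'a) \<Rightarrow> complex set" where
  "spectrum X A = {z. \<not> invertible_op X (minus_scalar X A z)}"

definition resolvent :: "'a::ab_group_add cnspace \<Rightarrow> ('a \<Rightarrow> 'a) \<Rightarrow> complex \<Rightarrow> 'a \<Rightarrow> 'a" where
  "resolvent X A z = the_inv_into (vecs X) (minus_scalar X A z)"

text \<open>On a punctured disc around \<open>\<mu>\<close> the resolvent is defined and has there a Laurent expansion
  \<open>\<Sum>k. (z - \<mu>)^(k - p) C\<^sub>k\<close>, convergent in operator norm, with bounded coefficients,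
  \<open>p \<ge> 1\<close> and \<open>C\<^sub>0 \<noteq> 0\<close>.\<close>

definition resolvent_pole :: "'a::ab_group_add cnspace \<Rightarrow> ('a \<Rightarrow> 'a) \<Rightarrow> complex \<Rightarrow> bool" where
  "resolvent_pole X A \<mu> \<longleftrightarrow>
     (\<exists>(p::nat) (C :: nat \<Rightarrow> 'a \<Rightarrow> 'a) r.
        p \<ge> 1 \<and> r > 0 \<and> (\<forall>k. bounded_op X (C k)) \<and> (\<exists>x\<in>vecs X. C 0 x \<noteq> 0) \<and>
        (\<forall>z. 0 < cmod (z - \<mu>) \<and> cmod (z - \<mu>) < r \<longrightarrow>
           z \<notin> spectrum X A \<and>
           (\<lambda>m. op_norm X (\<lambda>x. resolvent X A z x -
                (\<Sum>k<m. scl X ((z - \<mu>) powi (int k - int p)) (C k x)))) \<longlonglongrightarrow> 0))"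

definition Riesz :: "'a::ab_group_add cnspace \<Rightarrow> ('a \<Rightarrow> 'a) \<Rightarrow> bool" where
  "Riesz X A \<longleftrightarrow>
     (\<forall>z. z \<noteq> 0 \<longrightarrow>
        finite_dim X (null_space X (minus_scalar X A z)) \<and>
        finite_codim X (range_space X (minus_scalar X A z)))"

definition meromorphic_op :: "'a::ab_group_add cnspace \<Rightarrow> ('a \<Rightarrow> 'a) \<Rightarrow> bool" where
  "meromorphic_op X A \<longleftrightarrow> (\<forall>\<mu>\<in>spectrum X A. \<mu> \<noteq> 0 \<longrightarrow> resolvent_pole X A \<mu>)"

definition Kato :: "'a::ab_group_add cnspace \<Rightarrow> ('a \<Rightarrow> 'a) \<Rightarrow> bool" where
  "Kato X A \<longleftrightarrow>
     closed_in_space X (range_space X A) \<and>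
     (\<forall>n. null_space X A \<subseteq> range_space X (A ^^ n))"

definition Saphar :: "'a::ab_group_add cnspace \<Rightarrow> ('a \<Rightarrow> 'a) \<Rightarrow> bool" where
  "Saphar X A \<longleftrightarrow>
     Kato X A \<and> complemented X (null_space X A) \<and> complemented X (range_space X A)"

subsection \<open>Decompositions and generalized Drazin inverses\<close>

definition Red :: "'a::ab_group_add cnspace \<Rightarrow> ('a \<Rightarrow> 'a) \<Rightarrow> ('a set \<times> 'a set) set" where
  "Red X A = {(M, N). closed_subspace X M \<and> closed_subspace X N \<and>
                A ` M \<subseteq> M \<and> A ` N \<subseteq> N \<and> direct_sum X M N}"

text \<open>The parameter \<open>P\<close> below stands for \<open>Riesz\<close> or \<open>meromorphic_op\<close>.\<close>

type_synonym 'a op_class = "'a cnspace \<Rightarrow> ('a \<Rightarrow> 'a) \<Rightarrow> bool"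

definition generalized_Saphar_decomposition ::
  "'a::ab_group_add op_class \<Rightarrow> 'a cnspace \<Rightarrow> ('a \<Rightarrow> 'a) \<Rightarrow> bool" where
  "generalized_Saphar_decomposition P X A \<longleftrightarrow>
     (\<exists>(M, N)\<in>Red X A. Saphar (restr X M) A \<and> P (restr X N) A)"

definition upper_gD_invertible ::
  "'a::ab_group_add op_class \<Rightarrow> 'a cnspace \<Rightarrow> ('a \<Rightarrow> 'a) \<Rightarrow> bool" where
  "upper_gD_invertible P X A \<longleftrightarrow>
     (\<exists>(M, N)\<in>Red X A. bounded_below (restr X M) A \<and> P (restr X N) A)"

definition lower_gD_invertible ::
  "'a::ab_group_add op_class \<Rightarrow> 'a cnspace \<Rightarrow> ('a \<Rightarrow> 'a) \<Rightarrow> bool" where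
  "lower_gD_invertible P X A \<longleftrightarrow>
     (\<exists>(M, N)\<in>Red X A. surjective (restr X M) A \<and> P (restr X N) A)"

definition left_gD_invertible ::
  "'a::ab_group_add op_class \<Rightarrow> 'a cnspace \<Rightarrow> ('a \<Rightarrow> 'a) \<Rightarrow> bool" where
  "left_gD_invertible P X A \<longleftrightarrow>
     (\<exists>B. bounded_op X B \<and>
        (\<forall>x\<in>vecs X. A (B (A x)) = B (A (A x))) \<and>
        (\<forall>x\<in>vecs X. B (B (A x)) = B x) \<and>
        P X (\<lambda>x. A x - A (B (A x))))"

definition right_gD_invertible ::
  "'a::ab_group_add op_class \<Rightarrow> 'a cnspace \<Rightarrow> ('a \<Rightarrow> 'a) \<Rightarrow> bool" where
  "right_gD_invertible P X A \<longleftrightarrow>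
     (\<exists>B. bounded_op X B \<and>
        (\<forall>x\<in>vecs X. A (B (A x)) = A (A (B x))) \<and>
        (\<forall>x\<in>vecs X. A (B (B x)) = B x) \<and>
        P X (\<lambda>x. A x - A (B (A x))))"

end

theory Submission
  imports Defs
begin

text \<open>
  Both parts follow one pattern. If \<open>A\<close> is bounded below but its range is not complemented, then no
  reducing decomposition \<open>(M, N)\<close> with \<open>A\<close> Riesz or meromorphic on \<open>N\<close> can have the range of \<open>A\<close> on \<open>M\<close>
  complemented in \<open>M\<close>; and if \<open>A\<close> is surjective but its null space is not complemented, none can
  have the null space on \<open>M\<close> complemented in \<open>M\<close>. This excludes generalized Saphar decompositions. It
  also excludes left and right generalized Drazin inverses \<open>B\<close>, because \<open>B A\<close>, respectively \<open>A B\<close>, is an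
  idempotent commuting with \<open>A\<close> whose range and kernel form such a decomposition, with \<open>A\<close> left,
  respectively right, invertible on the range.

  The Riesz and the meromorphic property are treated through a common consequence: arbitrarily close to
  0 there are \<open>z \<noteq> 0\<close> for which \<open>A - z\<close> has finite nullity and finite codimension on \<open>N\<close>
  (\<open>fredholm_near_zero\<close>). If \<open>A\<close> is bounded below on \<open>N\<close>, a compactness argument moves finite
  codimension of the range from \<open>A - z\<close> to \<open>A\<close> (\<open>finite_codim_range_perturb\<close>); dually, finite nullity
  passes from \<open>A - z\<close> to \<open>A\<close> if \<open>A\<close> is surjective on \<open>N\<close> (\<open>finite_dim_kernel_perturb\<close>). A complement in
  \<open>M\<close> and a complement of finite dimension or codimension in \<open>N\<close> then add up to a complement in the
  whole space (\<open>complemented_range_of_Red\<close>, \<open>complemented_null_space_of_Red\<close>).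

  It remains to find operators \<open>X \<rightarrow> X\<close> of the two kinds. Both come from the theorem of Phillips that the
  null sequences are not complemented in the space of bounded sequences, in Whitley's form
  \<open>no_projection_onto_null_sequences\<close>. Let \<open>E\<close> be the set of even numbers and \<open>\<sigma>\<close> a permutation of
  the natural numbers such that \<open>\<sigma>\<close> maps \<open>E\<close> into \<open>E\<close> and \<open>D = \<sigma>\<^bsup>-1\<^esup>(E) - E\<close> is infinite. On the bounded
  sequences that tend to 0 along \<open>E\<close>, the operator \<open>x \<mapsto> x \<circ> \<sigma>\<close> is isometric, and its range consists
  of those sequences that tend to 0 along \<open>D\<close> as well. On the quotient of the bounded sequences by
  \<open>c\<^sub>0(E)\<close>, the operator \<open>x \<mapsto> x \<circ> \<sigma>\<^bsup>-1\<^esup>\<close> is surjective, and its kernel is a copy of \<open>c\<^sub>0(D)\<close>.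
  A projection onto this range or kernel, restricted to sequences carried by \<open>D\<close>, would contradict
  Phillips' theorem.
\<close>

section \<open>Normed spaces on a carrier\<close>

text \<open>Completeness is kept apart because a quotient is shown to be complete by means of its own norm.\<close>

locale normed_sp = vector_space "scl X" for X :: "'a::ab_group_add cnspace" +
  assumes subspace_vecs: "subspace (vecs X)"
    and nrm_nonneg: "x \<in> vecs X \<Longrightarrow> 0 \<le> nrm X x"
    and nrm_eq_0: "x \<in> vecs X \<Longrightarrow> nrm X x = 0 \<longleftrightarrow> x = 0"
    and nrm_scl: "x \<in> vecs X \<Longrightarrow> nrm X (scl X c x) = cmod c * nrm X x"
    and nrm_triangle: "x \<in> vecs X \<Longrightarrow> y \<in> vecs X \<Longrightarrow> nrm X (x + y) \<le> nrm X x + nrm X y"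
begin

lemmas vecs_0 [simp] = subspace_0[OF subspace_vecs]
  and vecs_add = subspace_add[OF subspace_vecs]
  and vecs_diff = subspace_diff[OF subspace_vecs]
  and vecs_scl = subspace_scale[OF subspace_vecs]
  and vecs_neg = subspace_neg[OF subspace_vecs]
  and vecs_sum = subspace_sum[OF subspace_vecs]

lemmas vecs_intros = vecs_0 vecs_add vecs_diff vecs_scl vecs_neg vecs_sum

lemma nrm_0 [simp]: "nrm X 0 = 0"
  using nrm_eq_0[of 0] by simp

lemma nrm_minus: "x \<in> vecs X \<Longrightarrow> nrm X (- x) = nrm X x"
  using nrm_scl[of x "-1"] by simp

lemma nrm_diff_commute: "x \<in> vecs X \<Longrightarrow> y \<in> vecs X \<Longrightarrow> nrm X (x - y) = nrm X (y - x)"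
  using nrm_minus[of "x - y"] by (simp add: vecs_diff)

lemma nrm_diff_le: "x \<in> vecs X \<Longrightarrow> y \<in> vecs X \<Longrightarrow> nrm X (x - y) \<le> nrm X x + nrm X y"
  using nrm_triangle[of x "- y"] by (simp add: nrm_minus vecs_neg)

lemma nrm_triangle_via:
  assumes "x \<in> vecs X" "y \<in> vecs X" "z \<in> vecs X"
  shows "nrm X (x - z) \<le> nrm X (x - y) + nrm X (y - z)"
  using nrm_triangle[of "x - y" "y - z"] assms by (simp add: vecs_diff)

lemma nrm_sum_le:
  assumes "\<And>i. i \<in> I \<Longrightarrow> f i \<in> vecs X"
  shows "nrm X (sum f I) \<le> (\<Sum>i\<in>I. nrm X (f i))"
  using assms
proof (induction I rule: infinite_finite_induct)
  case (insert i I)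
  have "nrm X (f i + sum f I) \<le> nrm X (f i) + nrm X (sum f I)"
    using insert by (intro nrm_triangle vecs_sum) auto
  with insert show ?case by auto
qed auto

sublocale met: Metric_space "vecs X" "ndist X"
proof
  show "0 \<le> ndist X x y" for x y
    by (auto simp: ndist_def nrm_nonneg vecs_diff)
  show "ndist X x y = ndist X y x" for x y
    by (auto simp: ndist_def nrm_diff_commute)
  show "ndist X x y = 0 \<longleftrightarrow> x = y" if "x \<in> vecs X" "y \<in> vecs X" for x y
    using that nrm_eq_0[of "x - y"] by (auto simp: ndist_def vecs_diff)
  show "ndist X x z \<le> ndist X x y + ndist X y z"
    if "x \<in> vecs X" "y \<in> vecs X" "z \<in> vecs X" for x y z
    using nrm_triangle_via that by (simp add: ndist_def)
qed

definition conv :: "(nat \<Rightarrow> 'a) \<Rightarrow> 'a \<Rightarrow> bool" where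
  "conv x l \<longleftrightarrow> (\<lambda>n. nrm X (x n - l)) \<longlonglongrightarrow> 0"

lemma limitin_iff_conv:
  assumes "range x \<subseteq> vecs X"
  shows "limitin met.mtopology x l sequentially \<longleftrightarrow> l \<in> vecs X \<and> conv x l"
proof -
  have x: "x n \<in> vecs X" for n using assms by auto
  show ?thesis
    unfolding met.limit_metric_sequentially conv_def LIMSEQ_iff
    using x by (auto simp: ndist_def nrm_nonneg vecs_diff)
qed

lemma closed_in_space_iff:
  "closed_in_space X S \<longleftrightarrow>
     S \<subseteq> vecs X \<and> (\<forall>x l. (\<forall>n. x n \<in> S) \<longrightarrow> l \<in> vecs X \<longrightarrow> conv x l \<longrightarrow> l \<in> S)"
proof (cases "S \<subseteq> vecs X")
  case True
  have "range x \<subseteq> S \<and> limitin met.mtopology x l sequentially \<longleftrightarrow>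
      (\<forall>n. x n \<in> S) \<and> l \<in> vecs X \<and> conv x l" for x l
    using limitin_iff_conv[of x l] True by blast
  with True show ?thesis
    unfolding closed_in_space_def met.metric_closedin_iff_sequentially_closed by auto
next
  case False
  then show ?thesis
    unfolding closed_in_space_def met.metric_closedin_iff_sequentially_closed by auto
qed

lemma closed_subspace_iff:
  "closed_subspace X S \<longleftrightarrow> subspace S \<and>
     S \<subseteq> vecs X \<and> (\<forall>x l. (\<forall>n. x n \<in> S) \<longrightarrow> l \<in> vecs X \<longrightarrow> conv x l \<longrightarrow> l \<in> S)"
  unfolding closed_subspace_def closed_in_space_iff by auto

lemma closed_subspaceD:
  assumes "closed_subspace X S"
  shows "subspace S" "S \<subseteq> vecs X"
    "\<And>x l. (\<And>n. x n \<in> S) \<Longrightarrow> l \<in> vecs X \<Longrightarrow> conv x l \<Longrightarrow> l \<in> S"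
  using assms unfolding closed_subspace_iff by auto

lemma closed_subspaceI:
  assumes "subspace S" "S \<subseteq> vecs X"
    "\<And>x l. (\<And>n. x n \<in> S) \<Longrightarrow> l \<in> vecs X \<Longrightarrow> conv x l \<Longrightarrow> l \<in> S"
  shows "closed_subspace X S"
  using assms unfolding closed_subspace_iff by auto

lemma conv_const [simp]: "conv (\<lambda>n. l) l"
  by (simp add: conv_def)

lemma conv_le:
  assumes "\<And>n. x n \<in> vecs X" "l \<in> vecs X" "f \<longlonglongrightarrow> 0"
    and "\<And>n. nrm X (x n - l) \<le> f n"
  shows "conv x l"
  unfolding conv_def
  by (rule tendsto_sandwich[OF _ _ tendsto_const assms(3)])
    (use assms in \<open>auto simp: nrm_nonneg vecs_diff\<close>)

lemma conv_add:
  assumes "\<And>n. x n \<in> vecs X" "\<And>n. y n \<in> vecs X" "k \<in> vecs X" "l \<in> vecs X"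
    and "conv x k" "conv y l"
  shows "conv (\<lambda>n. x n + y n) (k + l)"
proof (rule conv_le)
  show "(\<lambda>n. nrm X (x n - k) + nrm X (y n - l)) \<longlonglongrightarrow> 0"
    using tendsto_add[of _ 0 _ _ 0] assms(5,6) by (auto simp: conv_def)
  show "nrm X (x n + y n - (k + l)) \<le> nrm X (x n - k) + nrm X (y n - l)" for n
    using nrm_triangle[of "x n - k" "y n - l"] assms by (simp add: vecs_diff algebra_simps)
qed (use assms in \<open>auto intro: vecs_intros\<close>)

lemma conv_scl:
  assumes "\<And>n. x n \<in> vecs X" "k \<in> vecs X" "conv x k"
  shows "conv (\<lambda>n. scl X c (x n)) (scl X c k)"
proof (rule conv_le)
  show "(\<lambda>n. cmod c * nrm X (x n - k)) \<longlonglongrightarrow> 0"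
    using tendsto_mult_right_zero assms(3) by (auto simp: conv_def)
  show "nrm X (scl X c (x n) - scl X c k) \<le> cmod c * nrm X (x n - k)" for n
    using nrm_scl[of "x n - k" c] assms by (simp add: vecs_diff scale_right_diff_distrib)
qed (use assms in \<open>auto intro: vecs_intros\<close>)

lemma conv_diff:
  assumes "\<And>n. x n \<in> vecs X" "\<And>n. y n \<in> vecs X" "k \<in> vecs X" "l \<in> vecs X"
    and "conv x k" "conv y l"
  shows "conv (\<lambda>n. x n - y n) (k - l)"
proof -
  have "conv (\<lambda>n. scl X (-1) (y n)) (scl X (-1) l)"
    using assms by (intro conv_scl) auto
  then show ?thesis
    using conv_add[OF assms(1) _ assms(3) _ assms(5), of "\<lambda>n. - y n" "- l"] assms
    by (simp add: vecs_neg)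
qed

lemma conv_unique:
  assumes "\<And>n. x n \<in> vecs X" "k \<in> vecs X" "l \<in> vecs X" "conv x k" "conv x l"
  shows "k = l"
proof -
  have "(\<lambda>n. nrm X (x n - k) + nrm X (x n - l)) \<longlonglongrightarrow> 0 + 0"
    using assms(4,5) unfolding conv_def by (rule tendsto_add)
  moreover have "nrm X (k - l) \<le> nrm X (x n - k) + nrm X (x n - l)" for n
    using nrm_triangle_via[of k "x n" l] nrm_diff_commute[of k "x n"] assms by simp
  ultimately have "nrm X (k - l) \<le> 0 + 0"
    by (intro tendsto_lowerbound) auto
  then show ?thesis
    using nrm_nonneg[of "k - l"] nrm_eq_0[of "k - l"] assms by (auto intro: vecs_intros)
qed

lemma conv_subseq: "conv x l \<Longrightarrow> strict_mono r \<Longrightarrow> conv (x \<circ> r) l"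
  unfolding conv_def o_def using LIMSEQ_subseq_LIMSEQ by (fastforce simp: o_def)

lemma conv_bound:
  assumes "\<And>n. x n \<in> vecs X" "l \<in> vecs X" "conv x l" "\<And>n. nrm X (x n) \<le> b"
  shows "nrm X l \<le> b"
proof (rule tendsto_lowerbound)
  show "(\<lambda>n. b + nrm X (x n - l)) \<longlonglongrightarrow> b"
    using tendsto_add[OF tendsto_const[of b]] assms(3) by (fastforce simp: conv_def)
  show "\<forall>\<^sub>F n in sequentially. nrm X l \<le> b + nrm X (x n - l)"
  proof (rule always_eventually, rule allI)
    fix n
    show "nrm X l \<le> b + nrm X (x n - l)"
      using nrm_diff_le[OF assms(1) vecs_diff[OF assms(1,2)], of n n] assms(4)[of n] by simp
  qed
qed auto

definition cauchy :: "(nat \<Rightarrow> 'a) \<Rightarrow> bool" where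
  "cauchy x \<longleftrightarrow> (\<forall>e>0. \<exists>N. \<forall>m\<ge>N. \<forall>n\<ge>N. nrm X (x m - x n) < e)"

lemma MCauchy_iff:
  assumes "\<And>n. x n \<in> vecs X"
  shows "met.MCauchy x \<longleftrightarrow> cauchy x"
  unfolding met.MCauchy_def cauchy_def using assms by (auto simp: ndist_def)

lemma mcomplete_iff:
  "met.mcomplete \<longleftrightarrow>
     (\<forall>x. (\<forall>n. x n \<in> vecs X) \<longrightarrow> cauchy x \<longrightarrow> (\<exists>l\<in>vecs X. conv x l))"
proof -
  have "(\<exists>l. limitin met.mtopology x l sequentially) \<longleftrightarrow> (\<exists>l\<in>vecs X. conv x l)"
    if "\<forall>n. x n \<in> vecs X" for x
    using limitin_iff_conv[of x] that by auto
  moreover have "met.MCauchy x \<longleftrightarrow> (\<forall>n. x n \<in> vecs X) \<and> cauchy x" for x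
    using MCauchy_iff[of x] met.MCauchy_def[of x] by auto
  ultimately show ?thesis
    unfolding met.mcomplete_def by metis
qed

lemma conv_imp_cauchy:
  assumes "\<And>n. x n \<in> vecs X" "l \<in> vecs X" "conv x l"
  shows "cauchy x"
  unfolding cauchy_def
proof (intro allI impI)
  fix e :: real assume "e > 0"
  then obtain N where N: "\<And>n. n \<ge> N \<Longrightarrow> norm (nrm X (x n - l) - 0) < e / 2"
    using assms(3) unfolding conv_def LIMSEQ_iff by (meson half_gt_zero)
  have "nrm X (x m - x n) < e" if "m \<ge> N" "n \<ge> N" for m n
    using nrm_triangle_via[of "x m" l "x n"] nrm_diff_commute[of l "x n"]
      N[OF that(1)] N[OF that(2)] assms(1,2) by (auto simp: abs_if split: if_splits)
  then show "\<exists>N. \<forall>m\<ge>N. \<forall>n\<ge>N. nrm X (x m - x n) < e" by blast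
qed

lemma cauchy_le:
  assumes "cauchy x" "\<And>m n. nrm X (y m - y n) \<le> C * nrm X (x m - x n)" "C > 0"
  shows "cauchy y"
  unfolding cauchy_def
proof (intro allI impI)
  fix e :: real assume "e > 0"
  then have "e / C > 0" using \<open>C > 0\<close> by simp
  then obtain N where N: "\<And>m n. m \<ge> N \<Longrightarrow> n \<ge> N \<Longrightarrow> nrm X (x m - x n) < e / C"
    using assms(1) unfolding cauchy_def by blast
  have "nrm X (y m - y n) < e" if "m \<ge> N" "n \<ge> N" for m n
    using N[OF that] assms(2)[of m n] \<open>C > 0\<close>
    by (simp add: field_simps)
  then show "\<exists>N. \<forall>m\<ge>N. \<forall>n\<ge>N. nrm X (y m - y n) < e" by blast
qed

text \<open>A Cauchy sequence has a subsequence with increments below \<open>(1/2)^n\<close>, and converges as soon as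
  this subsequence does; hence completeness need only be tested on geometrically dominated series.\<close>

lemma mcompleteI_series:
  assumes ser: "\<And>x. (\<And>n. x n \<in> vecs X) \<Longrightarrow> (\<And>n. nrm X (x n) \<le> (1/2)^n)
     \<Longrightarrow> \<exists>l\<in>vecs X. conv (\<lambda>n. \<Sum>i<n. x i) l"
  shows "met.mcomplete"
  unfolding met.mcomplete_def
proof (intro allI impI)
  fix x assume x: "met.MCauchy x"
  then have xV: "x n \<in> vecs X" for n by (auto simp: met.MCauchy_def)
  with x have c: "cauchy x" using MCauchy_iff by blast
  have "\<exists>N. \<forall>m\<ge>N. \<forall>n\<ge>N. nrm X (x m - x n) < (1/2)^k" for k :: nat
    using c unfolding cauchy_def by simp
  then obtain N where N: "\<And>k m n. m \<ge> N k \<Longrightarrow> n \<ge> N k \<Longrightarrow> nrm X (x m - x n) < (1/2)^k"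
    by metis
  define r where "r = rec_nat (N 0) (\<lambda>k s. max (Suc s) (N (Suc k)))"
  have r: "r (Suc k) = max (Suc (r k)) (N (Suc k))" for k by (simp add: r_def)
  have rN: "r k \<ge> N k" for k by (cases k) (auto simp: r_def)
  have sm: "strict_mono r" unfolding strict_mono_Suc_iff r by (simp add: less_max_iff_disj)
  have "\<exists>l\<in>vecs X. conv (\<lambda>n. \<Sum>i<n. x (r (Suc i)) - x (r i)) l"
  proof (rule ser)
    show "nrm X (x (r (Suc n)) - x (r n)) \<le> (1/2)^n" for n
      using N[of n "r (Suc n)" "r n"] rN[of n] strict_mono_leD[OF sm, of n "Suc n"] by simp
  qed (auto intro: xV vecs_intros)
  then obtain l where l: "l \<in> vecs X" "conv (\<lambda>n. x (r n) - x (r 0)) l"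
    by (auto simp: sum_lessThan_telescope[of "\<lambda>n. x (r n)"])
  have "conv (\<lambda>n. (x (r n) - x (r 0)) + x (r 0)) (l + x (r 0))"
    by (rule conv_add) (use l xV in \<open>auto intro: vecs_intros\<close>)
  then have "limitin met.mtopology (x \<circ> r) (l + x (r 0)) sequentially"
    using l xV by (subst limitin_iff_conv) (auto intro: vecs_intros simp: o_def)
  then show "\<exists>l. limitin met.mtopology x l sequentially"
    using met.MCauchy_convergent_subsequence[OF x sm] by blast
qed

subsection \<open>Finite-dimensional extensions of closed subspaces\<close>

lemma dist_closed_subspace:
  assumes S: "closed_subspace X S" and f: "f \<in> vecs X" "f \<notin> S"
  obtains \<delta> where "\<delta> > 0" "\<And>s. s \<in> S \<Longrightarrow> \<delta> \<le> nrm X (f - s)"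
    "\<And>s c. s \<in> S \<Longrightarrow> \<delta> * cmod c \<le> nrm X (s + scl X c f)"
proof -
  note [simp] = closed_subspaceD(2)[OF S, THEN subsetD]
  have "\<exists>\<delta>>0. \<forall>s\<in>S. \<delta> \<le> nrm X (f - s)"
  proof (rule ccontr)
    assume "\<not> ?thesis"
    then have "\<exists>s\<in>S. nrm X (f - s) < inverse (Suc n)" for n
      by (meson not_le inverse_Suc)
    then obtain s where s: "\<And>n. s n \<in> S" "\<And>n. nrm X (f - s n) < inverse (Suc n)" by metis
    have "conv s f"
      by (rule conv_le[OF _ _ LIMSEQ_inverse_real_of_nat])
        (use s f nrm_diff_commute[of f] in \<open>auto simp: less_imp_le\<close>)
    with s f S show False using closed_subspaceD(3) by blast
  qed
  then obtain \<delta> where \<delta>: "\<delta> > 0" "\<And>s. s \<in> S \<Longrightarrow> \<delta> \<le> nrm X (f - s)" by blast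
  moreover have "\<delta> * cmod c \<le> nrm X (s + scl X c f)" if s: "s \<in> S" for s c
  proof (cases "c = 0")
    case False
    have eq: "s + scl X c f = scl X c (f - scl X (- inverse c) s)"
      using False by (simp add: scale_right_diff_distrib add.commute scale_right_distrib)
    have "\<delta> \<le> nrm X (f - scl X (- inverse c) s)"
      using \<delta>(2) subspace_scale[OF closed_subspaceD(1)[OF S] s] by blast
    then show ?thesis
      unfolding eq using f s
      by (subst nrm_scl) (auto intro!: vecs_intros mult_left_mono simp: mult.commute[of \<delta>])
  qed (use s in \<open>simp add: nrm_nonneg\<close>)
  ultimately show ?thesis using that by blast
qed

lemma span_insert_subspace:
  assumes "subspace S"
  shows "span (insert f S) = {s + scl X c f | s c. s \<in> S}"
proof -
  have S: "span S = S" using assms by (simp add: span_eq_iff)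
  have "(\<exists>k. x - scl X k f \<in> S) \<longleftrightarrow> (\<exists>s c. x = s + scl X c f \<and> s \<in> S)" for x
    by (metis add_diff_cancel diff_add_cancel)
  then show ?thesis
    unfolding span_insert S by auto
qed

lemma closed_subspace_insert:
  assumes S: "closed_subspace X S" and f: "f \<in> vecs X"
  shows "closed_subspace X (span (insert f S))"
proof (cases "f \<in> S")
  case True
  then show ?thesis
    using S by (simp add: insert_absorb closed_subspaceD(1) span_eq_iff[THEN iffD2])
next
  case False
  note SV = closed_subspaceD(2)[OF S, THEN subsetD]
  note sp = span_insert_subspace[OF closed_subspaceD(1)[OF S]]
  from dist_closed_subspace[OF S f False] obtain \<delta> where
    \<delta>: "\<delta> > 0" "\<And>s c. s \<in> S \<Longrightarrow> \<delta> * cmod c \<le> nrm X (s + scl X c f)" by metis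
  show ?thesis
  proof (rule closed_subspaceI)
    show "span (insert f S) \<subseteq> vecs X"
      unfolding sp using SV f by (auto intro: vecs_intros)
    fix x l assume x: "\<And>n. x n \<in> span (insert f S)" and l: "l \<in> vecs X" and c: "conv x l"
    from x have "\<exists>s c. s \<in> S \<and> x n = s + scl X c f" for n unfolding sp by blast
    then obtain s c where s: "\<And>n. s n \<in> S" and xs: "\<And>n. x n = s n + scl X (c n) f" by metis
    have xV: "x n \<in> vecs X" for n unfolding xs using s SV f by (auto intro: vecs_intros)
    have le: "\<delta> * cmod (c m - c n) \<le> nrm X (x m - x n)" for m n
      using \<delta>(2)[of "s m - s n" "c m - c n"] s subspace_diff[OF closed_subspaceD(1)[OF S]]
      unfolding xs by (simp add: algebra_simps)
    have "Cauchy c"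
    proof (rule metric_CauchyI)
      fix e :: real assume "e > 0"
      then have "\<delta> * e > 0" using \<delta> by simp
      then obtain N where "\<And>m n. m \<ge> N \<Longrightarrow> n \<ge> N \<Longrightarrow> nrm X (x m - x n) < \<delta> * e"
        using conv_imp_cauchy[OF xV l \<open>conv x l\<close>] unfolding cauchy_def by blast
      then show "\<exists>N. \<forall>m\<ge>N. \<forall>n\<ge>N. dist (c m) (c n) < e"
        unfolding dist_norm using le \<delta>(1) by (meson mult_less_cancel_left_pos order_le_less_trans)
    qed
    then obtain c0 where c0: "c \<longlonglongrightarrow> c0" by (meson Cauchy_convergent convergentD)
    have "conv (\<lambda>n. scl X (c n) f) (scl X c0 f)"
    proof (rule conv_le)
      show "(\<lambda>n. cmod (c n - c0) * nrm X f) \<longlonglongrightarrow> 0"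
        using c0 by (simp add: LIM_zero tendsto_mult_left_zero tendsto_norm_zero)
      show "nrm X (scl X (c n) f - scl X c0 f) \<le> cmod (c n - c0) * nrm X f" for n
        using f by (simp add: nrm_scl flip: scale_left_diff_distrib)
    qed (use f in \<open>auto intro: vecs_intros\<close>)
    then have "conv (\<lambda>n. x n - scl X (c n) f) (l - scl X c0 f)"
      using c xV l f by (intro conv_diff) (auto intro: vecs_intros)
    then have "conv s (l - scl X c0 f)" unfolding xs by simp
    then have "l - scl X c0 f \<in> S"
      using closed_subspaceD(3)[OF S, of s "l - scl X c0 f"] s l f by (auto intro: vecs_intros)
    then show "l \<in> span (insert f S)"
      unfolding span_insert using span_base by blast
  qed auto
qed

lemma closed_subspace_span_Un:
  assumes S: "closed_subspace X S" and "finite F" "F \<subseteq> vecs X"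
  shows "closed_subspace X (span (S \<union> F))"
  using assms(2,3)
proof (induction F)
  case empty
  then show ?case using S closed_subspaceD(1)[OF S] by (simp add: span_eq_iff[THEN iffD2])
next
  case (insert f F)
  have "span (S \<union> insert f F) = span (insert f (span (S \<union> F)))"
    by (simp add: span_insert span_span)
  then show ?case using insert closed_subspace_insert by simp
qed

lemma closed_subspace_zero: "closed_subspace X {0}"
proof (rule closed_subspaceI)
  fix x :: "nat \<Rightarrow> 'a" and l assume "\<And>n. x n \<in> {0}" "l \<in> vecs X" "conv x l"
  then show "l \<in> {0}"
    using conv_unique[of x 0 l] by (simp add: conv_def)
qed auto

lemma closed_subspace_vecs: "closed_subspace X (vecs X)"
  by (rule closed_subspaceI) (auto simp: subspace_vecs)

end

section \<open>Banach spaces, closed subspaces and bounded operators\<close>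

locale banach_sp = normed_sp +
  assumes complete: "met.mcomplete"

lemma cbanach_iff: "cbanach X \<longleftrightarrow> banach_sp X"
  unfolding cbanach_def banach_sp_def normed_sp_def normed_sp_axioms_def banach_sp_axioms_def
  by auto

lemma restr_simps [simp]:
  "vecs (restr X M) = M" "scl (restr X M) = scl X" "nrm (restr X M) = nrm X"
  by (simp_all add: restr_def)

lemma restr_vecs: "restr X (vecs X) = X"
  by (simp add: restr_def)

lemma minus_scalar_restr: "minus_scalar (restr X M) A z = minus_scalar X A z"
  by (simp add: minus_scalar_def)

context normed_sp
begin

lemma normed_sp_restr:
  assumes "subspace M" "M \<subseteq> vecs X"
  shows "normed_sp (restr X M)"
proof -
  have "vector_space (scl X)" by (rule vector_space_axioms)
  then show ?thesis
    unfolding normed_sp_def normed_sp_axioms_def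
    using assms nrm_nonneg nrm_eq_0 nrm_scl nrm_triangle by (auto simp: subset_iff)
qed

lemma conv_restr:
  assumes "subspace M" "M \<subseteq> vecs X"
  shows "normed_sp.conv (restr X M) x l \<longleftrightarrow> conv x l"
  using normed_sp.conv_def[OF normed_sp_restr[OF assms]] by (simp add: conv_def)

lemma closed_subspace_restr:
  assumes M: "closed_subspace X M"
  shows "closed_subspace (restr X M) S \<longleftrightarrow> closed_subspace X S \<and> S \<subseteq> M"
proof -
  have M': "subspace M" "M \<subseteq> vecs X" using closed_subspaceD[OF M] by auto
  show ?thesis
    unfolding normed_sp.closed_subspace_iff[OF normed_sp_restr[OF M']] closed_subspace_iff
      conv_restr[OF M'] restr_simps
    using M' closed_subspaceD(3)[OF M] by blast
qed

lemma direct_sum_restr: "direct_sum (restr X M) S T \<longleftrightarrow> M = {m + n | m n. m \<in> S \<and> n \<in> T} \<and> S \<inter> T = {0}"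
  by (simp add: direct_sum_def)

lemma complemented_restr:
  assumes M: "closed_subspace X M"
  shows "complemented (restr X M) S \<longleftrightarrow>
     closed_subspace X S \<and>
     (\<exists>T. closed_subspace X T \<and> M = {m + n | m n. m \<in> S \<and> n \<in> T} \<and> S \<inter> T = {0})"
    (is "_ \<longleftrightarrow> ?r")
proof
  assume "complemented (restr X M) S"
  then show ?r
    unfolding complemented_def closed_subspace_restr[OF M] direct_sum_restr by blast
next
  assume r: ?r
  then obtain T where T: "closed_subspace X T" "M = {m + n | m n. m \<in> S \<and> n \<in> T}"
    "S \<inter> T = {0}" and S: "closed_subspace X S" by blast
  have "0 \<in> S" "0 \<in> T" using T(3) by auto
  then have "S \<subseteq> M" "T \<subseteq> M"
    unfolding T(2) by (force intro: exI[of _ 0])+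
  with S T show "complemented (restr X M) S"
    unfolding complemented_def closed_subspace_restr[OF M] direct_sum_restr by blast
qed

lemma finite_codim_restr:
  "finite_codim (restr X M) S \<longleftrightarrow> (\<exists>F. finite F \<and> F \<subseteq> M \<and> M = span (S \<union> F))"
  by (simp add: finite_codim_def)

lemma bounded_op_restr:
  assumes "bounded_op X A" "M \<subseteq> vecs X" "A ` M \<subseteq> M"
  shows "bounded_op (restr X M) A"
  using assms unfolding bounded_op_def restr_simps by (meson subsetD)

lemma bounded_op_vecs: "bounded_op X A \<Longrightarrow> x \<in> vecs X \<Longrightarrow> A x \<in> vecs X"
  by (auto simp: bounded_op_def)

lemma bounded_op_add:
  "bounded_op X A \<Longrightarrow> x \<in> vecs X \<Longrightarrow> y \<in> vecs X \<Longrightarrow> A (x + y) = A x + A y"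
  by (simp add: bounded_op_def)

lemma bounded_op_scl:
  "bounded_op X A \<Longrightarrow> x \<in> vecs X \<Longrightarrow> A (scl X c x) = scl X c (A x)"
  by (simp add: bounded_op_def)

lemma bounded_op_0: "bounded_op X A \<Longrightarrow> A 0 = 0"
  using bounded_op_scl[of A 0 0] by simp

lemma bounded_op_diff:
  assumes "bounded_op X A" "x \<in> vecs X" "y \<in> vecs X"
  shows "A (x - y) = A x - A y"
  using bounded_op_add[of A "x - y" y] assms by (simp add: vecs_diff)

lemma bounded_op_sum:
  assumes A: "bounded_op X A" and "\<And>i. i \<in> I \<Longrightarrow> f i \<in> vecs X"
  shows "A (sum f I) = (\<Sum>i\<in>I. A (f i))"
  using assms(2)
  by (induction I rule: infinite_finite_induct)
    (auto simp: bounded_op_0[OF A] bounded_op_add[OF A] vecs_sum)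

lemma bounded_op_bound:
  assumes "bounded_op X A"
  obtains K where "K > 0" "\<And>x. x \<in> vecs X \<Longrightarrow> nrm X (A x) \<le> K * nrm X x"
proof -
  obtain K where K: "\<And>x. x \<in> vecs X \<Longrightarrow> nrm X (A x) \<le> K * nrm X x"
    using assms unfolding bounded_op_def by blast
  have "nrm X (A x) \<le> max K 1 * nrm X x" if "x \<in> vecs X" for x
    using K[OF that] mult_right_mono[of K "max K 1" "nrm X x"] nrm_nonneg[OF that] by linarith
  then show ?thesis using that[of "max K 1"] by simp
qed

lemma bounded_op_conv:
  assumes A: "bounded_op X A" and "\<And>n. x n \<in> vecs X" "l \<in> vecs X" "conv x l"
  shows "conv (\<lambda>n. A (x n)) (A l)"
proof -
  obtain K where K: "K > 0" "\<And>x. x \<in> vecs X \<Longrightarrow> nrm X (A x) \<le> K * nrm X x"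
    using bounded_op_bound[OF A] by blast
  show ?thesis
  proof (rule conv_le)
    show "(\<lambda>n. K * nrm X (x n - l)) \<longlonglongrightarrow> 0"
      using assms(4) unfolding conv_def by (rule tendsto_mult_right_zero)
    show "nrm X (A (x n) - A l) \<le> K * nrm X (x n - l)" for n
      using K(2)[of "x n - l"] assms by (simp add: bounded_op_diff vecs_diff)
  qed (use assms bounded_op_vecs in auto)
qed

lemma bounded_op_compose:
  assumes A: "bounded_op X A" and B: "bounded_op X B"
  shows "bounded_op X (\<lambda>x. A (B x))"
proof -
  obtain K where K: "K > 0" "\<And>x. x \<in> vecs X \<Longrightarrow> nrm X (A x) \<le> K * nrm X x"
    using bounded_op_bound[OF A] by blast
  obtain L where L: "L > 0" "\<And>x. x \<in> vecs X \<Longrightarrow> nrm X (B x) \<le> L * nrm X x"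
    using bounded_op_bound[OF B] by blast
  have "nrm X (A (B x)) \<le> (K * L) * nrm X x" if "x \<in> vecs X" for x
    using K(2)[OF bounded_op_vecs[OF B that]] L(2)[OF that] K(1)
    by (smt (verit) mult.assoc mult_left_mono)
  then show ?thesis
    using A B unfolding bounded_op_def by (auto simp: image_subset_iff)
qed

lemma bounded_op_diff_op:
  assumes A: "bounded_op X A" and B: "bounded_op X B"
  shows "bounded_op X (\<lambda>x. A x - B x)"
proof -
  obtain K where K: "\<And>x. x \<in> vecs X \<Longrightarrow> nrm X (A x) \<le> K * nrm X x"
    using bounded_op_bound[OF A] by blast
  obtain L where L: "\<And>x. x \<in> vecs X \<Longrightarrow> nrm X (B x) \<le> L * nrm X x"
    using bounded_op_bound[OF B] by blast
  have "nrm X (A x - B x) \<le> (K + L) * nrm X x" if "x \<in> vecs X" for x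
    using nrm_diff_le[of "A x" "B x"] K[OF that] L[OF that] bounded_op_vecs[OF A that]
      bounded_op_vecs[OF B that] by (simp add: algebra_simps)
  then show ?thesis
    using A B unfolding bounded_op_def
    by (auto intro!: vecs_intros exI[of _ "K + L"] simp: scale_right_diff_distrib)
qed

lemma bounded_op_minus_scalar:
  assumes A: "bounded_op X A"
  shows "bounded_op X (minus_scalar X A z)"
proof -
  obtain K where K: "K > 0" "\<And>x. x \<in> vecs X \<Longrightarrow> nrm X (A x) \<le> K * nrm X x"
    using bounded_op_bound[OF A] by blast
  have "nrm X (A x - scl X z x) \<le> (K + cmod z) * nrm X x" if "x \<in> vecs X" for x
    using nrm_diff_le[of "A x" "scl X z x"] K(2)[OF that] that bounded_op_vecs[OF A that]
    by (simp add: nrm_scl vecs_scl algebra_simps)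
  then show ?thesis
    using A unfolding bounded_op_def minus_scalar_def
    by (auto intro!: vecs_intros exI[of _ "K + cmod z"]
        simp: scale_right_distrib scale_right_diff_distrib scale_left_commute algebra_simps)
qed

lemma bounded_op_image_subspace:
  assumes A: "bounded_op X A" and S: "subspace S" "S \<subseteq> vecs X"
  shows "subspace (A ` S)"
  unfolding subspace_def
proof (intro conjI ballI allI)
  show "0 \<in> A ` S" using bounded_op_0[OF A] subspace_0[OF S(1)] by (metis image_eqI)
  show "x + y \<in> A ` S" if "x \<in> A ` S" "y \<in> A ` S" for x y
  proof -
    from that obtain u v where "x = A u" "y = A v" "u \<in> S" "v \<in> S" by blast
    then show ?thesis
      using S(2)[THEN subsetD] bounded_op_add[OF A, of u v] subspace_add[OF S(1), of u v] by (auto intro!: image_eqI[of _ A "u + v"])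
  qed
  show "scl X c x \<in> A ` S" if "x \<in> A ` S" for x c
  proof -
    from that obtain u where "x = A u" "u \<in> S" by blast
    then show ?thesis
      using S(2)[THEN subsetD] bounded_op_scl[OF A, of u c] subspace_scale[OF S(1), of u c]
      by (auto intro!: image_eqI[of _ A "scl X c u"])
  qed
qed

lemma closed_subspace_kernel_on:
  assumes A: "bounded_op X A" and M: "closed_subspace X M"
  shows "closed_subspace X {x \<in> M. A x = 0}"
proof (rule closed_subspaceI)
  note M' = closed_subspaceD[OF M]
  note MV = M'(2)[THEN subsetD]
  show "subspace {x \<in> M. A x = 0}"
    unfolding subspace_def
    using subspace_0[OF M'(1)] subspace_add[OF M'(1)] subspace_scale[OF M'(1)] MV
      bounded_op_0[OF A] bounded_op_add[OF A] bounded_op_scl[OF A] by auto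
  show "{x \<in> M. A x = 0} \<subseteq> vecs X" using MV by auto
  fix x l assume x: "\<And>n. x n \<in> {x \<in> M. A x = 0}" and l: "l \<in> vecs X" and c: "conv x l"
  have "conv (\<lambda>n. A (x n)) (A l)"
    using x MV by (intro bounded_op_conv[OF A _ l c]) auto
  then have "A l = 0"
    using conv_unique[of "\<lambda>n. A (x n)" "A l" 0] x bounded_op_vecs[OF A l] by simp
  then show "l \<in> {x \<in> M. A x = 0}"
    using x M'(3)[OF _ l c] by auto
qed

end

context banach_sp
begin

lemma cauchy_conv:
  assumes "\<And>n. x n \<in> vecs X" "cauchy x"
  obtains l where "l \<in> vecs X" "conv x l"
  using complete assms unfolding mcomplete_iff by blast

lemma geometric_series:
  assumes x: "\<And>n. x n \<in> vecs X" and le: "\<And>n. nrm X (x n) \<le> C * q ^ n"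
    and q: "0 \<le> q" "q < 1"
  obtains l where "l \<in> vecs X" "conv (\<lambda>n. \<Sum>i<n. x i) l" "nrm X l \<le> C / (1 - q)"
proof -
  define s where "s n = (\<Sum>i<n. x i)" for n
  have sV: "s n \<in> vecs X" for n unfolding s_def using x by (auto intro: vecs_intros)
  have C: "C \<ge> 0" using le[of 0] nrm_nonneg[OF x, of 0] by simp
  have geo: "(\<Sum>i\<in>{m..<n}. C * q ^ i) \<le> C * q ^ m / (1 - q)" if "m \<le> n" for m n
  proof -
    have "(1 - q) * (\<Sum>i\<in>{m..<n}. C * q ^ i) = C * (q ^ m - q ^ n)"
      using that
    proof (induction n rule: dec_induct)
      case (step k)
      have "(1 - q) * (\<Sum>i\<in>{m..<Suc k}. C * q ^ i) = (1 - q) * (\<Sum>i\<in>{m..<k}. C * q ^ i) + (1 - q) * (C * q ^ k)"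
        using step.hyps by (simp add: distrib_left)
      then show ?case unfolding step.IH by (simp add: algebra_simps)
    qed simp
    then have "(\<Sum>i\<in>{m..<n}. C * q ^ i) = C * (q ^ m - q ^ n) / (1 - q)"
      using q by (simp add: field_simps)
    also have "\<dots> \<le> C * q ^ m / (1 - q)"
      using q C by (intro divide_right_mono mult_left_mono) auto
    finally show ?thesis .
  qed
  have diff: "nrm X (s n - s m) \<le> C * q ^ m / (1 - q)" if "m \<le> n" for m n
  proof -
    have "s n - s m = (\<Sum>i\<in>{m..<n}. x i)"
      unfolding s_def using that by (simp add: lessThan_atLeast0 sum_diff_nat_ivl)
    also have "nrm X \<dots> \<le> (\<Sum>i\<in>{m..<n}. nrm X (x i))" using x by (intro nrm_sum_le)
    also have "\<dots> \<le> (\<Sum>i\<in>{m..<n}. C * q ^ i)" by (intro sum_mono le)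
    finally show ?thesis using geo[OF that] by linarith
  qed
  have lim0: "(\<lambda>m. C * q ^ m / (1 - q)) \<longlonglongrightarrow> 0"
    using q by (intro tendsto_divide_zero tendsto_mult_right_zero LIMSEQ_realpow_zero)
  have "cauchy s"
    unfolding cauchy_def
  proof (intro allI impI)
    fix e :: real assume "e > 0"
    then obtain N where N: "\<And>m. m \<ge> N \<Longrightarrow> C * q ^ m / (1 - q) < e"
      using order_tendstoD(2)[OF lim0] unfolding eventually_sequentially by blast
    have "nrm X (s m - s n) < e" if "m \<ge> N" "n \<ge> N" for m n
      using diff[of m n] diff[of n m] N[OF that(1)] N[OF that(2)] nrm_diff_commute[OF sV sV, of m n]
      by (cases "m \<le> n") auto
    then show "\<exists>N. \<forall>m\<ge>N. \<forall>n\<ge>N. nrm X (s m - s n) < e" by blast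
  qed
  then obtain l where l: "l \<in> vecs X" "conv s l" using cauchy_conv[of s] sV by blast
  have "nrm X (s n) \<le> C / (1 - q)" for n using diff[of 0 n] by (simp add: s_def)
  then have "nrm X l \<le> C / (1 - q)" using conv_bound[OF sV l] by blast
  with l that show ?thesis unfolding s_def by blast
qed

lemma banach_sp_restr:
  assumes M: "closed_subspace X M"
  shows "banach_sp (restr X M)"
proof -
  have M': "subspace M" "M \<subseteq> vecs X" using closed_subspaceD[OF M] by auto
  interpret R: normed_sp "restr X M" using normed_sp_restr[OF M'] .
  show ?thesis
  proof
    have "\<exists>l\<in>M. R.conv x l" if x: "\<And>n. x n \<in> M" and c: "R.cauchy x" for x
    proof -
      have "cauchy x" using c unfolding cauchy_def R.cauchy_def by simp
      then obtain l where l: "l \<in> vecs X" "conv x l" using cauchy_conv[of x] x M' by blast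
      then have "l \<in> M" using closed_subspaceD(3)[OF M, of x l] x by simp
      then show ?thesis using l conv_restr[OF M', of x l] by blast
    qed
    then show "Metric_space.mcomplete (vecs (restr X M)) (ndist (restr X M))"
      unfolding R.mcomplete_iff unfolding restr_simps by blast
  qed
qed

lemma bounded_below_image_closed:
  assumes A: "bounded_op X A" and c: "c > 0" "\<And>x. x \<in> vecs X \<Longrightarrow> c * nrm X x \<le> nrm X (A x)"
    and S: "closed_subspace X S"
  shows "closed_subspace X (A ` S)"
proof (rule closed_subspaceI)
  note S' = closed_subspaceD[OF S]
  show "subspace (A ` S)" using bounded_op_image_subspace[OF A S'(1,2)] .
  show "A ` S \<subseteq> vecs X" using S'(2) bounded_op_vecs[OF A] by auto
  fix y l assume y: "\<And>n. y n \<in> A ` S" and l: "l \<in> vecs X" and cv: "conv y l"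
  from y have "\<exists>x. x \<in> S \<and> y n = A x" for n by blast
  then obtain x where x: "\<And>n. x n \<in> S" "\<And>n. y n = A (x n)" by metis
  have xV: "x n \<in> vecs X" for n using x S'(2) by auto
  have yV: "y n \<in> vecs X" for n using x xV bounded_op_vecs[OF A] by auto
  have "cauchy x"
  proof (rule cauchy_le[OF conv_imp_cauchy[OF yV l cv]])
    show "nrm X (x m - x n) \<le> (1/c) * nrm X (y m - y n)" for m n
      using c(2)[of "x m - x n"] xV c(1) unfolding x
      by (simp add: vecs_diff bounded_op_diff[OF A] field_simps)
  qed (use c in simp)
  then obtain k where k: "k \<in> vecs X" "conv x k" using cauchy_conv[of x] xV by blast
  then have "A k = l"
    using conv_unique[OF yV _ l _ cv, of "A k"] bounded_op_conv[OF A xV k] bounded_op_vecs[OF A]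
    unfolding x by blast
  then show "l \<in> A ` S" using S'(3)[OF x(1) k] by blast
qed

end

section \<open>Approximation by finite-dimensional extensions\<close>

context normed_sp
begin

text \<open>The unit ball of a finite-dimensional quotient is totally bounded. The induction adds one
  vector at a time: its coefficients are bounded, so they converge along a subsequence.\<close>

lemma finite_extension_pigeonhole:
  assumes S: "closed_subspace X S" and "finite F" "F \<subseteq> vecs X"
    and "\<And>n::nat. y n \<in> span (S \<union> F)" "\<And>n. nrm X (y n) \<le> B" "e > 0"
  shows "\<exists>r :: nat \<Rightarrow> nat. strict_mono r \<and> (\<forall>i j. \<exists>s\<in>S. nrm X (y (r i) - y (r j) - s) < e)"
  using assms(2-)
proof (induction F arbitrary: y B e)
  case empty
  have S': "subspace S" using closed_subspaceD(1)[OF S] .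
  then have "y n \<in> S" for n using empty(2)[of n] by (simp add: span_eq_iff[THEN iffD2])
  then have "\<exists>s\<in>S. nrm X (y i - y j - s) < e" for i j
    using empty.prems(4) subspace_diff[OF S'] by (intro bexI[of _ "y i - y j"]) auto
  then show ?case by (intro exI[of _ id]) (auto simp: strict_mono_def)
next
  case (insert f F)
  let ?S = "span (S \<union> F)"
  have clS: "closed_subspace X ?S" using insert by (intro closed_subspace_span_Un[OF S]) auto
  have sp: "span (S \<union> insert f F) = span (insert f ?S)" by (simp add: span_insert span_span)
  have fV: "f \<in> vecs X" using insert by auto
  show ?case
  proof (cases "f \<in> ?S")
    case True
    then have "span (S \<union> insert f F) = ?S" by (simp add: span_redundant)
    then have "\<And>n. y n \<in> ?S" using insert.prems(2) by simp
    then show ?thesis using insert.IH[of y B e] insert.prems by auto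
  next
    case False
    from dist_closed_subspace[OF clS fV False] obtain \<delta> where
      \<delta>: "\<delta> > 0" "\<And>s c. s \<in> ?S \<Longrightarrow> \<delta> * cmod c \<le> nrm X (s + scl X c f)" by metis
    have "\<exists>g c. g \<in> ?S \<and> y n = g + scl X c f" for n
      using insert.prems(2)[of n] span_insert_subspace[of ?S f] unfolding sp by auto
    then obtain g c where g: "\<And>n. g n \<in> ?S" and yg: "\<And>n. y n = g n + scl X (c n) f" by metis
    have gV: "g n \<in> vecs X" for n using g closed_subspaceD(2)[OF clS] by auto
    have "\<delta> * cmod (c n) \<le> B" for n using \<delta>(2)[OF g[of n], of "c n"] insert.prems(3)[of n] yg by simp
    then have cB: "cmod (c n) \<le> B / \<delta>" for n using \<delta>(1) by (simp add: field_simps)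
    then have "bounded (range c)" by (auto simp: bounded_iff)
    then obtain c0 r where r: "strict_mono r" "(c \<circ> r) \<longlonglongrightarrow> c0"
      using bounded_imp_convergent_subsequence[of c] by blast
    have "Cauchy (c \<circ> r)" using r(2) by (rule LIMSEQ_imp_Cauchy)
    have "nrm X f > 0" using False fV nrm_nonneg[OF fV] nrm_eq_0[OF fV] span_zero
      by (metis order_less_le)
    then have "e / 2 / nrm X f > 0" using insert.prems(4) by simp
    with \<open>Cauchy (c \<circ> r)\<close> obtain N where
      "\<And>m n. m \<ge> N \<Longrightarrow> n \<ge> N \<Longrightarrow> dist ((c \<circ> r) m) ((c \<circ> r) n) < e / 2 / nrm X f"
      unfolding Cauchy_def by blast
    then have N: "cmod (c (r (m + N)) - c (r (n + N))) * nrm X f < e / 2" for m n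
      using \<open>nrm X f > 0\<close> by (simp add: dist_norm field_simps)
    have "\<exists>t :: nat \<Rightarrow> nat. strict_mono t \<and> (\<forall>i j. \<exists>s\<in>S. nrm X (g (r (t i + N)) - g (r (t j + N)) - s) < e / 2)"
    proof -
      have "nrm X (g (r (n + N))) \<le> B + B / \<delta> * nrm X f" for n
      proof -
        let ?k = "r (n + N)"
        have "nrm X (g ?k) \<le> nrm X (y ?k) + nrm X (scl X (c ?k) f)"
          using nrm_diff_le[of "y ?k" "scl X (c ?k) f"] gV fV by (simp add: yg vecs_intros)
        also have "nrm X (scl X (c ?k) f) \<le> B / \<delta> * nrm X f"
          using mult_right_mono[OF cB[of ?k], of "nrm X f"] \<open>nrm X f > 0\<close>
          by (simp add: nrm_scl fV)
        finally show ?thesis using insert.prems(3)[of ?k] by simp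
      qed
      moreover have "F \<subseteq> vecs X" "0 < e / 2" using insert.prems by auto
      ultimately show ?thesis
        by (intro insert.IH[of "\<lambda>i. g (r (i + N))"] g)
    qed
    then obtain t :: "nat \<Rightarrow> nat" where t: "strict_mono t"
      "\<And>i j. \<exists>s\<in>S. nrm X (g (r (t i + N)) - g (r (t j + N)) - s) < e / 2" by blast
    have "\<exists>s\<in>S. nrm X (y (r (t i + N)) - y (r (t j + N)) - s) < e" for i j
    proof -
      obtain s where s: "s \<in> S" "nrm X (g (r (t i + N)) - g (r (t j + N)) - s) < e / 2"
        using t(2) by blast
      have sV: "s \<in> vecs X" using s(1) closed_subspaceD(2)[OF S] by auto
      let ?i = "r (t i + N)" and ?j = "r (t j + N)"
      have "y ?i - y ?j - s = (g ?i - g ?j - s) + scl X (c ?i - c ?j) f"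
        unfolding yg by (simp add: algebra_simps)
      also have "nrm X \<dots> \<le> nrm X (g ?i - g ?j - s) + nrm X (scl X (c ?i - c ?j) f)"
        using gV sV fV by (intro nrm_triangle) (auto intro: vecs_intros)
      also have "\<dots> < e" using s(2) N[of "t i" "t j"] by (simp add: nrm_scl fV)
      finally show ?thesis using s(1) by blast
    qed
    moreover have "strict_mono (\<lambda>i. r (t i + N))"
      using r(1) t(1) by (simp add: strict_mono_def)
    ultimately show ?thesis by (intro exI[of _ "\<lambda>i. r (t i + N)"]) auto
  qed
qed

lemma riesz_lemma:
  assumes S: "closed_subspace X S" and N: "subspace N" "S \<subseteq> N" "N \<subseteq> vecs X" and f: "f \<in> N" "f \<notin> S"
  obtains y where "y \<in> N" "nrm X y \<le> 1" "\<And>s. s \<in> S \<Longrightarrow> 1/2 \<le> nrm X (y - s)"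
proof -
  note S' = closed_subspaceD(1)[OF S]
  have SV [simp]: "s \<in> S \<Longrightarrow> s \<in> vecs X" for s using closed_subspaceD(2)[OF S] by auto
  have fV: "f \<in> vecs X" using f N by auto
  from dist_closed_subspace[OF S fV f(2)] obtain \<delta> where
    \<delta>: "\<delta> > 0" "\<And>s. s \<in> S \<Longrightarrow> \<delta> \<le> nrm X (f - s)" by metis
  define d where "d = (INF s\<in>S. nrm X (f - s))"
  have bdd: "bdd_below ((\<lambda>s. nrm X (f - s)) ` S)" using \<delta>(2) by (auto simp: bdd_below_def)
  have ne: "S \<noteq> {}" using subspace_0[OF S'] by auto
  have "\<delta> \<le> d" unfolding d_def using \<delta>(2) ne by (intro cINF_greatest)
  have d: "d \<le> nrm X (f - s)" if "s \<in> S" for s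
    unfolding d_def using bdd that by (intro cINF_lower)
  have "d < 2 * d" using \<open>\<delta> \<le> d\<close> \<delta>(1) by simp
  then obtain s0 where s0: "s0 \<in> S" "nrm X (f - s0) < 2 * d"
    unfolding d_def using bdd ne by (meson cINF_less_iff)
  define a where "a = nrm X (f - s0)"
  have a: "a > 0" using d[OF s0(1)] \<open>\<delta> \<le> d\<close> \<delta>(1) by (simp add: a_def)
  let ?y = "scl X (of_real (1 / a)) (f - s0)"
  show ?thesis
  proof (rule that)
    show "?y \<in> N" using f s0 N by (auto intro!: subspace_scale subspace_diff)
    show "nrm X ?y \<le> 1"
      using a fV s0 by (subst nrm_scl) (auto simp: vecs_diff a_def[symmetric] norm_divide)
    fix s assume s: "s \<in> S"
    have eq: "?y - s = scl X (of_real (1 / a)) (f - (s0 + scl X (of_real a) s))"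
      using a by (simp add: scale_right_diff_distrib scale_right_distrib flip: of_real_mult)
    have "d \<le> nrm X (f - (s0 + scl X (of_real a) s))"
      using s s0 S' by (intro d subspace_add subspace_scale)
    then have "d / a \<le> nrm X (?y - s)"
      unfolding eq using a fV s0 s
      by (subst nrm_scl) (auto intro!: vecs_intros simp: divide_right_mono norm_divide)
    moreover have "1/2 < d / a" using s0(2) a by (simp add: a_def[symmetric] field_simps)
    ultimately show "1/2 \<le> nrm X (?y - s)" by linarith
  qed
qed

text \<open>Iterating Riesz's lemma, the span of \<open>S\<close> and the vectors already chosen being closed again.\<close>

lemma riesz_sequence:
  assumes S: "closed_subspace X S" and N: "subspace N" "S \<subseteq> N" "N \<subseteq> vecs X"
    and inf: "\<And>F. finite F \<Longrightarrow> F \<subseteq> N \<Longrightarrow> N \<noteq> span (S \<union> F)"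
  obtains y :: "nat \<Rightarrow> 'a" where "\<And>n. y n \<in> N" "\<And>n. nrm X (y n) \<le> 1"
    "\<And>i j s. i < j \<Longrightarrow> s \<in> S \<Longrightarrow> 1/2 \<le> nrm X (y j - y i - s)"
proof -
  define P where "P y n v \<longleftrightarrow> v \<in> N \<and> nrm X v \<le> 1 \<and>
    (\<forall>s\<in>span (S \<union> y ` {..<n}). 1/2 \<le> nrm X (v - s))" for y :: "nat \<Rightarrow> 'a" and n v
  have "\<exists>y. \<forall>n. P y n (y n)"
  proof (rule dependent_wellorder_choice)
    fix r and f g :: "nat \<Rightarrow> 'a" and n :: nat assume "\<And>m. m < n \<Longrightarrow> f m = g m"
    then have "f ` {..<n} = g ` {..<n}" by auto
    then show "P f n r = P g n r" by (simp add: P_def)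
  next
    fix n f assume "\<And>m. m < n \<Longrightarrow> P f m (f m)"
    then have fN: "f ` {..<n} \<subseteq> N" by (auto simp: P_def)
    let ?S = "span (S \<union> f ` {..<n})"
    have "?S \<subseteq> N" using fN N by (intro span_minimal) auto
    moreover have "?S \<noteq> N" using inf[of "f ` {..<n}"] fN by auto
    ultimately obtain v where "v \<in> N" "v \<notin> ?S" by auto
    moreover have "closed_subspace X ?S"
      using fN N by (intro closed_subspace_span_Un[OF S]) auto
    ultimately show "\<exists>r. P f n r"
      using riesz_lemma[OF _ N(1) \<open>?S \<subseteq> N\<close> N(3)] unfolding P_def by metis
  qed
  then obtain y where y: "\<And>n. P y n (y n)" by blast
  show ?thesis
  proof (rule that)
    show "y n \<in> N" "nrm X (y n) \<le> 1" for n using y[of n] by (auto simp: P_def)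
    fix i j :: nat and s assume "i < j" "s \<in> S"
    then have "y i + s \<in> span (S \<union> y ` {..<j})" by (intro span_add span_base) auto
    then have "1/2 \<le> nrm X (y j - (y i + s))" using y[of j] by (auto simp: P_def)
    then show "1/2 \<le> nrm X (y j - y i - s)" by (simp add: algebra_simps)
  qed
qed

end

section \<open>Stability of finite codimension and of finite nullity\<close>

context banach_sp
begin

text \<open>If the range of \<open>A\<close> had infinite codimension, there would be a bounded sequence whose terms
  stay apart modulo the range of \<open>A\<close>. As \<open>A\<close> is bounded below, a small multiple of the
  identity moves the range so little that they would also stay apart modulo the range of
  \<open>A - z\<close>, which is impossible in a finite-dimensional quotient.\<close>

lemma finite_codim_range_perturb:
  assumes A: "bounded_op X A"
    and c: "c > 0" "\<And>x. x \<in> vecs X \<Longrightarrow> c * nrm X x \<le> nrm X (A x)"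
    and z: "cmod z \<le> c / 8"
    and fin: "finite_codim X (range_space X (minus_scalar X A z))"
  shows "finite_codim X (range_space X A)"
proof (rule ccontr)
  assume contra: "\<not> ?thesis"
  let ?B = "minus_scalar X A z"
  note AV = bounded_op_vecs[OF A]
  have B: "bounded_op X ?B" using bounded_op_minus_scalar[OF A] .
  have below: "(7 * c / 8) * nrm X x \<le> nrm X (?B x)"
    and zx: "cmod z * nrm X x \<le> c / 8 * nrm X x" if x: "x \<in> vecs X" for x
  proof -
    show zx: "cmod z * nrm X x \<le> c / 8 * nrm X x"
      using z nrm_nonneg[OF x] by (rule mult_right_mono)
    have "nrm X (A x) \<le> nrm X (?B x) + nrm X (scl X z x)"
      using nrm_triangle[of "?B x" "scl X z x"] x AV[OF x]
      by (simp add: minus_scalar_def vecs_intros)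
    then show "(7 * c / 8) * nrm X x \<le> nrm X (?B x)"
      using c(2)[OF x] zx x by (simp add: nrm_scl)
  qed
  have clA: "closed_subspace X (A ` vecs X)"
    using bounded_below_image_closed[OF A c closed_subspace_vecs] .
  have clB: "closed_subspace X (?B ` vecs X)"
    by (rule bounded_below_image_closed[OF B _ below closed_subspace_vecs]) (use c in auto)
  have "vecs X \<noteq> span (A ` vecs X \<union> F)" if "finite F" "F \<subseteq> vecs X" for F
    using contra that by (auto simp: finite_codim_def range_space_def)
  then obtain y :: "nat \<Rightarrow> 'a" where y: "\<And>n. y n \<in> vecs X" "\<And>n. nrm X (y n) \<le> 1"
    "\<And>i j s. i < j \<Longrightarrow> s \<in> A ` vecs X \<Longrightarrow> 1/2 \<le> nrm X (y j - y i - s)"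
    using riesz_sequence[OF clA subspace_vecs closed_subspaceD(2)[OF clA] order_refl] by metis
  obtain F where F: "finite F" "F \<subseteq> vecs X" "vecs X = span (?B ` vecs X \<union> F)"
    using fin by (auto simp: finite_codim_def range_space_def)
  have "\<exists>r :: nat \<Rightarrow> nat. strict_mono r \<and>
      (\<forall>i j. \<exists>s\<in>?B ` vecs X. nrm X (y (r i) - y (r j) - s) < 1/8)"
    by (rule finite_extension_pigeonhole[OF clB F(1,2)]) (use y F(3) in auto)
  then obtain r :: "nat \<Rightarrow> nat" and x where r: "strict_mono r" and x: "x \<in> vecs X"
    and s: "nrm X (y (r 1) - y (r 0) - ?B x) < 1/8" by blast
  \<comment> \<open>The constants: \<open>(A - z) x\<close> has norm below \<open>2 + 1/8\<close>, so \<open>c * nrm X x < 17/7\<close> and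
    \<open>cmod z * nrm X x < 17/56\<close>, whereas \<open>1/8 + 17/56 < 1/2\<close>.\<close>
  let ?d = "y (r 1) - y (r 0)"
  have d: "?d \<in> vecs X" "nrm X ?d \<le> 2"
    using y(1) nrm_diff_le[OF y(1) y(1), of "r 1" "r 0"] y(2)[of "r 0"] y(2)[of "r 1"]
    by (auto intro: vecs_intros)
  have BV: "?B x \<in> vecs X" using bounded_op_vecs[OF B x] .
  have "nrm X (?B x) \<le> nrm X ?d + nrm X (?d - ?B x)"
    using nrm_diff_le[of ?d "?d - ?B x"] d BV by (simp add: vecs_diff)
  with s d have "nrm X (?B x) < 17/8" by simp
  with below[OF x] have "c * nrm X x < 17/7" by simp
  with zx[OF x] have "cmod z * nrm X x < 17/56" by simp
  moreover have "nrm X (?d - A x) \<le> nrm X (?d - ?B x) + nrm X (scl X z x)"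
  proof -
    have "?d - A x = (?d - ?B x) - scl X z x" by (simp add: minus_scalar_def)
    then show ?thesis
      using nrm_diff_le[OF vecs_diff[OF d(1) BV] vecs_scl[OF x]] by metis
  qed
  moreover have "1/2 \<le> nrm X (?d - A x)"
    using y(3)[of "r 0" "r 1" "A x"] strict_monoD[OF r, of 0 1] x by auto
  ultimately show False using s x by (simp add: nrm_scl)
qed

text \<open>A null vector \<open>u\<close> of \<open>A\<close> is the zeroth term of the series \<open>\<Sum>k. z^k x\<^sub>k\<close> with
  \<open>A x\<^sub>0 = 0\<close> and \<open>A x\<^sub>k\<^sub>+\<^sub>1 = x\<^sub>k\<close>, whose sum is annihilated by \<open>A - z\<close>.\<close>

lemma null_vector_perturb:
  assumes A: "bounded_op X A"
    and K: "K > 0" "\<And>y. y \<in> vecs X \<Longrightarrow> \<exists>x\<in>vecs X. A x = y \<and> nrm X x \<le> K * nrm X y"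
    and z: "cmod z * K \<le> 1/8"
    and u: "u \<in> vecs X" "A u = 0"
  obtains v where "v \<in> vecs X" "minus_scalar X A z v = 0" "nrm X (v - u) \<le> nrm X u / 7"
proof -
  obtain R where R: "\<And>y. y \<in> vecs X \<Longrightarrow> R y \<in> vecs X" "\<And>y. y \<in> vecs X \<Longrightarrow> A (R y) = y"
    "\<And>y. y \<in> vecs X \<Longrightarrow> nrm X (R y) \<le> K * nrm X y"
    using K(2) by metis
  define x where "x k = (R ^^ k) u" for k
  have x0: "x 0 = u" and xS: "x (Suc k) = R (x k)" for k by (simp_all add: x_def)
  have xV: "x k \<in> vecs X" for k by (induction k) (auto simp: x0 xS u R)
  have xle: "nrm X (x k) \<le> K ^ k * nrm X u" for k
  proof (induction k)
    case (Suc k)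
    then show ?case
      using R(3)[OF xV, of k] mult_left_mono[OF Suc, of K] K(1)
      by (auto simp: xS mult.assoc intro: order_trans)
  qed (simp add: x0)
  define t where "t k = scl X (z ^ k) (x k)" for k
  have tV: "t k \<in> vecs X" for k using xV by (auto simp: t_def intro: vecs_intros)
  have tle: "nrm X (t k) \<le> nrm X u * (1/8) ^ k" for k
  proof -
    have "nrm X (t k) \<le> cmod z ^ k * (K ^ k * nrm X u)"
      unfolding t_def using xV xle[of k] by (simp add: nrm_scl norm_power mult_left_mono)
    also have "\<dots> = (cmod z * K) ^ k * nrm X u" by (simp add: power_mult_distrib)
    also have "\<dots> \<le> (1/8) ^ k * nrm X u"
      using z K(1) nrm_nonneg[OF u(1)] by (intro mult_right_mono power_mono) auto
    finally show ?thesis by (simp add: mult.commute)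
  qed
  have At: "A (t (Suc k)) = scl X z (t k)" for k
    using R(2)[OF xV] xV by (simp add: t_def xS bounded_op_scl[OF A] R)
  define s where "s n = (\<Sum>k<n. t (Suc k))" for n
  have sV: "s n \<in> vecs X" for n using tV by (auto simp: s_def intro: vecs_intros)
  obtain w where w: "w \<in> vecs X" "conv s w" "nrm X w \<le> (nrm X u / 8) / (1 - 1/8)"
  proof (rule geometric_series)
    show "nrm X (t (Suc n)) \<le> nrm X u / 8 * (1/8) ^ n" for n using tle[of "Suc n"] by simp
  qed (use tV in \<open>auto simp: s_def[abs_def]\<close>)
  have us: "u + s n = (\<Sum>k<Suc n. t k)" for n
    unfolding s_def by (subst sum.lessThan_Suc_shift) (simp add: t_def x0)
  have As: "A (s (Suc n)) = scl X z (u + s n)" for n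
    unfolding us unfolding s_def
    using tV by (subst bounded_op_sum[OF A]) (auto simp: At scale_sum_right scale_right_distrib)
  have "conv (\<lambda>n. A (s (Suc n))) (A w)"
    using conv_subseq[OF w(2), of Suc] bounded_op_conv[OF A sV w(1), of Suc] w sV
    by (intro bounded_op_conv[OF A]) (auto simp: o_def strict_mono_def)
  moreover have "conv (\<lambda>n. A (s (Suc n))) (scl X z (u + w))"
    unfolding As using u w sV by (intro conv_scl conv_add) (auto intro: vecs_intros)
  ultimately have Aw: "A w = scl X z (u + w)"
    using sV u w bounded_op_vecs[OF A] by (intro conv_unique) (auto intro: vecs_intros)
  show ?thesis
  proof (rule that)
    show "u + w \<in> vecs X" using u w by (auto intro: vecs_intros)
    show "minus_scalar X A z (u + w) = 0"
      using u w by (simp add: minus_scalar_def bounded_op_add[OF A] Aw)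
    show "nrm X (u + w - u) \<le> nrm X u / 7" using w by simp
  qed
qed

text \<open>Hence the null space of \<open>A\<close> lies close to that of \<open>A - z\<close>, and an infinite separated sequence
  in the unit ball of the former would yield one in the latter.\<close>

lemma finite_dim_kernel_perturb:
  assumes A: "bounded_op X A"
    and K: "K > 0" "\<And>y. y \<in> vecs X \<Longrightarrow> \<exists>x\<in>vecs X. A x = y \<and> nrm X x \<le> K * nrm X y"
    and z: "cmod z * K \<le> 1/8"
    and fin: "finite_dim X (null_space X (minus_scalar X A z))"
  shows "finite_dim X (null_space X A)"
proof (rule ccontr)
  assume contra: "\<not> ?thesis"
  let ?N = "null_space X A"
  have N: "subspace ?N" "?N \<subseteq> vecs X"
    using closed_subspace_kernel_on[OF A closed_subspace_vecs] closed_subspaceD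
    by (auto simp: null_space_def)
  have "?N \<noteq> span ({0} \<union> F)" if "finite F" "F \<subseteq> ?N" for F
    using contra that by (auto simp: finite_dim_def)
  then obtain y :: "nat \<Rightarrow> 'a" where y: "\<And>n. y n \<in> ?N" "\<And>n. nrm X (y n) \<le> 1"
    "\<And>i j s. i < j \<Longrightarrow> s \<in> {0} \<Longrightarrow> 1/2 \<le> nrm X (y j - y i - s)"
    using riesz_sequence[OF closed_subspace_zero N(1) _ N(2)] subspace_0[OF N(1)]
    by (metis empty_subsetI insert_subset)
  have "\<exists>v. v \<in> vecs X \<and> minus_scalar X A z v = 0 \<and> nrm X (v - y n) \<le> 1/7" for n
  proof -
    have "y n \<in> vecs X" "A (y n) = 0" using y(1)[of n] by (auto simp: null_space_def)
    from null_vector_perturb[OF A K z this] obtain v where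
      "v \<in> vecs X" "minus_scalar X A z v = 0" "nrm X (v - y n) \<le> nrm X (y n) / 7"
      by blast
    with y(2)[of n] show ?thesis by (intro exI[of _ v]) auto
  qed
  then obtain v where v: "\<And>n. v n \<in> vecs X" "\<And>n. minus_scalar X A z (v n) = 0"
    "\<And>n. nrm X (v n - y n) \<le> 1/7" by metis
  have yV: "y n \<in> vecs X" for n using y(1) N(2) by auto
  obtain F where F: "finite F" "null_space X (minus_scalar X A z) = span F"
    using fin by (auto simp: finite_dim_def)
  have FV: "F \<subseteq> vecs X" using F(2) span_superset[of F] by (auto simp: null_space_def)
  have "\<exists>r :: nat \<Rightarrow> nat. strict_mono r \<and> (\<forall>i j. \<exists>s\<in>{0}. nrm X (v (r i) - v (r j) - s) < 1/8)"
  proof (rule finite_extension_pigeonhole[OF closed_subspace_zero F(1) FV])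
    show "v n \<in> span ({0} \<union> F)" for n using v F(2) by (auto simp: null_space_def)
    show "nrm X (v n) \<le> 2" for n
      using nrm_triangle[of "v n - y n" "y n"] v(1,3)[of n] y(2)[of n] yV by (simp add: vecs_diff)
  qed simp
  then obtain r :: "nat \<Rightarrow> nat" where r: "strict_mono r" "nrm X (v (r 1) - v (r 0)) < 1/8" by auto
  \<comment> \<open>Replacing \<open>y\<close> by \<open>v\<close> costs \<open>1/7\<close> twice, and \<open>1/8 + 2/7 < 1/2\<close>.\<close>
  have "1/2 \<le> nrm X (y (r 1) - y (r 0))"
    using y(3)[of "r 0" "r 1" 0] strict_monoD[OF r(1), of 0 1] by auto
  moreover have "nrm X (y (r 1) - y (r 0)) \<le>
      nrm X (y (r 1) - v (r 1)) + (nrm X (v (r 1) - v (r 0)) + nrm X (v (r 0) - y (r 0)))"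
    using nrm_triangle_via[of "y (r 1)" "v (r 1)" "y (r 0)"]
      nrm_triangle_via[of "v (r 1)" "v (r 0)" "y (r 0)"] yV v(1) by simp
  ultimately show False
    using r(2) v(3)[of "r 0"] v(3)[of "r 1"] nrm_diff_commute[OF yV v(1), of "r 1" "r 1"] by simp
qed

section \<open>Bounded projections\<close>

text \<open>This is the closed graph theorem for the projection along a closed complement. By Baire some
  set \<open>{x. nrm X (P x) \<le> k}\<close> is dense in a ball; successive approximation then expands every
  small vector as \<open>\<Sum>i. y\<^sub>i\<close> with geometrically decreasing \<open>P y\<^sub>i\<close>, and closedness of both
  summands identifies \<open>\<Sum>i. P y\<^sub>i\<close> as its projection.\<close>

lemma bounded_projection:
  assumes M: "closed_subspace X M" and N: "closed_subspace X N" and MN: "direct_sum X M N"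
  obtains P where "bounded_op X P" "\<And>x. x \<in> vecs X \<Longrightarrow> P x \<in> M"
    "\<And>x. x \<in> vecs X \<Longrightarrow> x - P x \<in> N" "\<And>m n. m \<in> M \<Longrightarrow> n \<in> N \<Longrightarrow> P (m + n) = m"
proof -
  note M' = closed_subspaceD[OF M] and N' = closed_subspaceD[OF N]
  note MV = M'(2)[THEN subsetD] and NV = N'(2)[THEN subsetD]
  have ds: "vecs X = {m + n | m n. m \<in> M \<and> n \<in> N}" "M \<inter> N = {0}"
    using MN by (auto simp: direct_sum_def)
  have "\<exists>m. m \<in> M \<and> x - m \<in> N" if "x \<in> vecs X" for x
    using that unfolding ds(1) by force
  then obtain P where P: "\<And>x. x \<in> vecs X \<Longrightarrow> P x \<in> M" "\<And>x. x \<in> vecs X \<Longrightarrow> x - P x \<in> N"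
    by metis
  have uniq: "P x = m" if "x \<in> vecs X" "m \<in> M" "x - m \<in> N" for x m
  proof -
    have "P x - m \<in> M" using that P M'(1) by (auto intro: subspace_diff)
    moreover have "(x - m) - (x - P x) \<in> N"
      using subspace_diff[OF N'(1) that(3) P(2)[OF that(1)]] .
    ultimately have "P x - m \<in> M \<inter> N" by simp
    then show ?thesis unfolding ds(2) by simp
  qed
  have PV: "P x \<in> vecs X" if "x \<in> vecs X" for x using P(1)[OF that] MV by auto
  have Padd: "P (x + y) = P x + P y" if "x \<in> vecs X" "y \<in> vecs X" for x y
    using that P subspace_add[OF M'(1)] subspace_add[OF N'(1) P(2)[OF that(1)] P(2)[OF that(2)]]
    by (intro uniq) (auto intro: vecs_intros simp: algebra_simps)
  have Pscl: "P (scl X c x) = scl X c (P x)" if "x \<in> vecs X" for x c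
    using that P subspace_scale[OF M'(1)] subspace_scale[OF N'(1) P(2)[OF that], of c]
    by (intro uniq) (auto intro: vecs_intros simp: scale_right_diff_distrib)
  have Pdiff: "P (x - y) = P x - P y" if "x \<in> vecs X" "y \<in> vecs X" for x y
    using Padd[of "x - y" y] that by (simp add: vecs_diff)
  define Q where "Q k = {x \<in> vecs X. nrm X (P x) \<le> real k}" for k
  define T where "T k = met.mtopology closure_of Q k" for k
  have QT: "Q k \<subseteq> T k" for k
    unfolding T_def by (rule closure_of_subset) (auto simp: Q_def)
  have "\<exists>k. met.mtopology interior_of T k \<noteq> {}"
  proof (rule ccontr)
    assume "\<not> ?thesis"
    then have "met.mtopology interior_of \<Union>(range T) = {}"
      by (intro met.metric_Baire_category_alt[OF complete]) (auto simp: T_def)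
    moreover have "vecs X \<subseteq> \<Union>(range T)"
    proof
      fix x assume "x \<in> vecs X"
      moreover obtain k where "nrm X (P x) \<le> real k" using real_arch_simple by blast
      ultimately have "x \<in> Q k" by (simp add: Q_def)
      with QT show "x \<in> \<Union>(range T)" by auto
    qed
    then have "0 \<in> met.mtopology interior_of \<Union>(range T)"
      unfolding met.metric_interior_of by (auto intro!: exI[of _ 1])
    ultimately show False by simp
  qed
  then obtain k a \<epsilon> where a: "a \<in> vecs X" and eps: "\<epsilon> > 0" "met.mball a \<epsilon> \<subseteq> T k"
    unfolding met.metric_interior_of by auto
  \<comment> \<open>The ball need not be centred at 0; taking differences centres it and doubles the bound.\<close>
  define b where "b = 2 * real k"
  have near: "\<exists>y\<in>Q k. nrm X (x - y) < r" if "x \<in> T k" "r > 0" for x r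
    using that unfolding T_def met.metric_closure_of
    by (fastforce simp: ndist_def Q_def)
  have approx0: "\<exists>y\<in>vecs X. nrm X (P y) \<le> b \<and> nrm X (x - y) < r"
    if x: "x \<in> vecs X" "nrm X x < \<epsilon>" and r: "r > 0" for x r
  proof -
    have "a + x \<in> T k" "a \<in> T k"
      using x a eps nrm_minus[OF x(1)] by (auto intro!: eps(2)[THEN subsetD] simp: ndist_def vecs_intros)
    then obtain y1 y2 where y: "y1 \<in> Q k" "nrm X (a + x - y1) < r / 2" "y2 \<in> Q k"
      "nrm X (a - y2) < r / 2"
      using near[of _ "r / 2"] r by (meson half_gt_zero)
    have yV: "y1 \<in> vecs X" "y2 \<in> vecs X" using y by (auto simp: Q_def)
    have "nrm X (P (y1 - y2)) \<le> b"
      using nrm_diff_le[OF PV[OF yV(1)] PV[OF yV(2)]] y by (simp add: Q_def Pdiff b_def)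
    moreover have "nrm X (x - (y1 - y2)) < r"
      using nrm_diff_le[of "a + x - y1" "a - y2"] y a x yV by (simp add: vecs_intros algebra_simps)
    ultimately show ?thesis using yV by (auto intro: vecs_intros)
  qed
  have approx: "\<exists>y. y \<in> vecs X \<and> nrm X (P y) \<le> b * (1/2) ^ n \<and> nrm X (x - y) < \<epsilon> * (1/2) ^ Suc n"
    if x: "x \<in> vecs X" "nrm X x < \<epsilon> * (1/2) ^ n" for x and n :: nat
  proof -
    have "nrm X (scl X (2 ^ n) x) < \<epsilon>"
      using x by (simp add: nrm_scl norm_power field_simps power_one_over)
    then obtain y where y: "y \<in> vecs X" "nrm X (P y) \<le> b" "nrm X (scl X (2 ^ n) x - y) < \<epsilon> / 2"
      using approx0[of "scl X (2 ^ n) x" "\<epsilon> / 2"] x eps by (auto intro: vecs_intros)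
    let ?y = "scl X ((1/2) ^ n) y"
    have eq: "x - ?y = scl X ((1/2) ^ n) (scl X (2 ^ n) x - y)"
      by (simp add: scale_right_diff_distrib power_one_over)
    have "nrm X (P ?y) \<le> b * (1/2) ^ n"
      using y PV[OF y(1)] by (simp add: Pscl nrm_scl norm_power norm_divide power_one_over field_simps)
    moreover have "nrm X (x - ?y) < \<epsilon> * (1/2) ^ Suc n"
      unfolding eq using x y
      by (subst nrm_scl) (auto intro!: vecs_intros simp: norm_power norm_divide power_one_over field_simps)
    ultimately show ?thesis using y by (auto intro: vecs_intros)
  qed
  define Y where "Y n x = (SOME y. y \<in> vecs X \<and> nrm X (P y) \<le> b * (1/2) ^ n \<and>
      nrm X (x - y) < \<epsilon> * (1/2) ^ Suc n)" for n x
  have Y: "Y n x \<in> vecs X \<and> nrm X (P (Y n x)) \<le> b * (1/2) ^ n \<and>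
      nrm X (x - Y n x) < \<epsilon> * (1/2) ^ Suc n" if "x \<in> vecs X" "nrm X x < \<epsilon> * (1/2) ^ n" for n x
    unfolding Y_def by (rule someI_ex[OF approx[OF that]])
  have small: "nrm X (P x) \<le> 2 * b" if x: "x \<in> vecs X" "nrm X x < \<epsilon>" for x
  proof -
    define xs where "xs = rec_nat x (\<lambda>n v. v - Y n v)"
    have xs: "xs 0 = x" "\<And>n. xs (Suc n) = xs n - Y n (xs n)" by (simp_all add: xs_def)
    have xsV: "xs n \<in> vecs X \<and> nrm X (xs n) < \<epsilon> * (1/2) ^ n" for n
      by (induction n) (use x Y in \<open>auto simp: xs intro: vecs_intros\<close>)
    define y where "y n = Y n (xs n)" for n
    have y: "y n \<in> vecs X" "nrm X (P (y n)) \<le> b * (1/2) ^ n" for n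
      using Y xsV by (auto simp: y_def)
    obtain m where m: "m \<in> vecs X" "conv (\<lambda>n. \<Sum>i<n. P (y i)) m" "nrm X m \<le> b / (1 - 1/2)"
      by (rule geometric_series[of "\<lambda>n. P (y n)" b "1/2"]) (use y PV in auto)
    have "m \<in> M"
      by (rule M'(3)[OF _ m(1,2)]) (use P(1) y M'(1) in \<open>auto intro: subspace_sum\<close>)
    have sy: "(\<Sum>i<n. y i) = x - xs n" for n
      by (induction n) (auto simp: xs y_def)
    have "conv (\<lambda>n. x - xs n) x"
    proof (rule conv_le)
      show "(\<lambda>n. \<epsilon> * (1/2) ^ n) \<longlonglongrightarrow> 0"
        by (intro tendsto_mult_right_zero LIMSEQ_realpow_zero) auto
      show "nrm X (x - xs n - x) \<le> \<epsilon> * (1/2) ^ n" for n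
        using xsV[of n] nrm_minus[of "xs n"] by simp
    qed (use x xsV in \<open>auto intro: vecs_intros\<close>)
    then have "conv (\<lambda>n. (x - xs n) - (\<Sum>i<n. P (y i))) (x - m)"
      using m x xsV PV y by (intro conv_diff) (auto intro: vecs_intros)
    then have "conv (\<lambda>n. \<Sum>i<n. y i - P (y i)) (x - m)"
      by (simp add: sum_subtractf sy)
    then have "x - m \<in> N"
      by (rule N'(3)[rotated 2]) (use P(2) y N'(1) x m in \<open>auto intro: subspace_sum vecs_intros\<close>)
    then have "P x = m" using uniq x \<open>m \<in> M\<close> by blast
    with m show ?thesis by simp
  qed
  have "nrm X (P x) \<le> (4 * b / \<epsilon>) * nrm X x" if x: "x \<in> vecs X" for x
  proof (cases "x = 0")
    case True
    then show ?thesis using Pdiff[of 0 0] by simp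
  next
    case False
    then have pos: "nrm X x > 0" using nrm_nonneg[OF x] nrm_eq_0[OF x] by linarith
    define c where "c = \<epsilon> / (2 * nrm X x)"
    have c: "c > 0" using eps pos by (simp add: c_def)
    have "nrm X (scl X (of_real c) x) = c * nrm X x" using x c by (simp add: nrm_scl)
    also have "\<dots> < \<epsilon>" using eps pos by (simp add: c_def)
    finally have "nrm X (scl X (of_real c) x) < \<epsilon>" .
    then have "nrm X (P (scl X (of_real c) x)) \<le> 2 * b"
      using small x by (auto intro: vecs_intros)
    then have "c * nrm X (P x) \<le> 2 * b" using x PV[OF x] c by (simp add: Pscl nrm_scl)
    then show ?thesis using eps pos by (simp add: c_def field_simps)
  qed
  then have "bounded_op X P"
    unfolding bounded_op_def using PV Padd Pscl by blast
  moreover have "P (m + n) = m" if "m \<in> M" "n \<in> N" for m n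
    using that MV NV by (intro uniq) (auto intro: vecs_intros)
  ultimately show ?thesis using that P by blast
qed

end

section \<open>Reducing decompositions\<close>

text \<open>The common consequence of the Riesz and the meromorphic property on which both
  obstructions rest.\<close>

definition fredholm_near_zero :: "'a::ab_group_add cnspace \<Rightarrow> ('a \<Rightarrow> 'a) \<Rightarrow> bool" where
  "fredholm_near_zero X A \<longleftrightarrow>
     (\<forall>e>0. \<exists>z. z \<noteq> 0 \<and> cmod z < e \<and>
        finite_dim X (null_space X (minus_scalar X A z)) \<and>
        finite_codim X (range_space X (minus_scalar X A z)))"

lemma fredholm_near_zeroD:
  assumes "fredholm_near_zero X A" "e > 0"
  obtains z where "z \<noteq> 0" "cmod z \<le> e" "finite_dim X (null_space X (minus_scalar X A z))"
    "finite_codim X (range_space X (minus_scalar X A z))"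
  using assms unfolding fredholm_near_zero_def by (meson less_imp_le)

lemma Riesz_fredholm_near_zero:
  assumes "Riesz X A"
  shows "fredholm_near_zero X A"
  unfolding fredholm_near_zero_def
proof (intro allI impI)
  fix e :: real assume "e > 0"
  then have "complex_of_real (e / 2) \<noteq> 0" "cmod (complex_of_real (e / 2)) < e"
    by (simp_all add: norm_divide)
  with assms show "\<exists>z. z \<noteq> 0 \<and> cmod z < e \<and>
        finite_dim X (null_space X (minus_scalar X A z)) \<and>
        finite_codim X (range_space X (minus_scalar X A z))"
    unfolding Riesz_def by blast
qed

text \<open>A punctured disc around a pole lies in the resolvent set, so the nonzero points of the
  spectrum cannot fill a punctured neighbourhood of 0.\<close>

lemma (in normed_sp) meromorphic_fredholm_near_zero:
  assumes A: "bounded_op X A" and mero: "meromorphic_op X A"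
  shows "fredholm_near_zero X A"
  unfolding fredholm_near_zero_def
proof (intro allI impI)
  fix e :: real assume e: "e > 0"
  have "\<exists>z. z \<noteq> 0 \<and> cmod z < e \<and> z \<notin> spectrum X A"
  proof (cases "complex_of_real (e / 2) \<in> spectrum X A")
    case False
    with e show ?thesis by (intro exI[of _ "complex_of_real (e / 2)"]) (simp add: norm_divide)
  next
    case True
    then have "resolvent_pole X A (complex_of_real (e / 2))"
      using mero e by (auto simp: meromorphic_op_def)
    then obtain r where r: "r > 0" "\<And>z. 0 < cmod (z - complex_of_real (e / 2)) \<Longrightarrow>
        cmod (z - complex_of_real (e / 2)) < r \<Longrightarrow> z \<notin> spectrum X A"
      unfolding resolvent_pole_def by blast
    define d where "d = min r (e / 2) / 2"
    have d: "d > 0" "d < r" "d < e / 2" using r(1) e by (auto simp: d_def min_def)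
    have "complex_of_real (e / 2 + d) \<notin> spectrum X A"
      using d by (intro r(2)) auto
    moreover have "cmod (complex_of_real (e / 2 + d)) < e" "complex_of_real (e / 2 + d) \<noteq> 0"
      unfolding norm_of_real of_real_eq_0_iff using d e by auto
    ultimately show ?thesis by blast
  qed
  then obtain z where z: "z \<noteq> 0" "cmod z < e" "z \<notin> spectrum X A" by blast
  let ?T = "minus_scalar X A z"
  have T: "bounded_op X ?T" using bounded_op_minus_scalar[OF A] .
  obtain B where B: "bounded_op X B" "\<And>x. x \<in> vecs X \<Longrightarrow> ?T (B x) = x"
    "\<And>x. x \<in> vecs X \<Longrightarrow> B (?T x) = x"
    using z(3) by (auto simp: spectrum_def invertible_op_def)
  have "x = 0" if "x \<in> vecs X" "?T x = 0" for x
    using B(3)[OF that(1)] that(2) bounded_op_0[OF B(1)] by simp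
  then have "null_space X ?T = {0}"
    using bounded_op_0[OF T] by (auto simp: null_space_def)
  then have "finite_dim X (null_space X ?T)"
    unfolding finite_dim_def by (intro exI[of _ "{}"]) simp
  moreover have "range_space X ?T = vecs X"
    using B bounded_op_vecs[OF T] bounded_op_vecs[OF B(1)]
    unfolding range_space_def by (metis image_eqI image_subsetI subsetI subset_antisym)
  then have "finite_codim X (range_space X ?T)"
    unfolding finite_codim_def using subspace_vecs
    by (intro exI[of _ "{}"]) (simp add: span_eq_iff[THEN iffD2])
  ultimately show "\<exists>z. z \<noteq> 0 \<and> cmod z < e \<and>
        finite_dim X (null_space X (minus_scalar X A z)) \<and>
        finite_codim X (range_space X (minus_scalar X A z))"
    using z by blast
qed

context normed_sp
begin

lemma Riesz_or_meromorphic_fredholm_near_zero: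
  assumes "\<P> = Riesz \<or> \<P> = meromorphic_op" "bounded_op X A" "\<P> X A"
  shows "fredholm_near_zero X A"
  using assms Riesz_fredholm_near_zero meromorphic_fredholm_near_zero by blast

lemma finite_complement:
  assumes S: "subspace S" and "finite F"
  obtains G where "G \<subseteq> F" "span (S \<union> G) = span (S \<union> F)" "S \<inter> span G = {0}"
proof -
  have "\<exists>G\<subseteq>F. span (S \<union> G) = span (S \<union> F) \<and> S \<inter> span G = {0}"
    using assms(2)
  proof (induction F)
    case empty
    then show ?case using subspace_0[OF S] by auto
  next
    case (insert f F)
    from insert.IH obtain G where
      G: "G \<subseteq> F" "span (S \<union> G) = span (S \<union> F)" "S \<inter> span G = {0}"
      by (elim exE conjE) (rule that)
    show ?case
    proof (cases "f \<in> span (S \<union> G)")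
      case True
      then have "span (S \<union> insert f F) = span (S \<union> F)"
        using G(2) by (simp add: span_redundant)
      with G show ?thesis by (intro exI[of _ G]) auto
    next
      case False
      have "x = 0" if x: "x \<in> S" "x \<in> span (insert f G)" for x
      proof -
        obtain k where k: "x - scl X k f \<in> span G" using x(2) by (auto simp: span_insert)
        then have 1: "x - scl X k f \<in> span (S \<union> G)" using span_mono[of G "S \<union> G"] by auto
        have 2: "x \<in> span (S \<union> G)" using x(1) by (auto intro: span_base)
        from span_diff[OF 2 1] have kf: "scl X k f \<in> span (S \<union> G)" by simp
        have "k = 0"
        proof (rule ccontr)
          assume "k \<noteq> 0"
          with span_scale[OF kf, of "inverse k"] False show False by simp
        qed
        with k x(1) G(3) show ?thesis by auto
      qed
      then have "S \<inter> span (insert f G) = {0}" using subspace_0[OF S] span_zero by blast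
      moreover have "span (S \<union> insert f G) = span (S \<union> insert f F)"
        using G(2) by (simp add: span_insert)
      ultimately show ?thesis using G(1) by (intro exI[of _ "insert f G"]) auto
    qed
  qed
  then show ?thesis by (elim exE conjE) (rule that)
qed

definition bounded_functional :: "('a \<Rightarrow> complex) \<Rightarrow> bool" where
  "bounded_functional \<phi> \<longleftrightarrow>
     (\<forall>x\<in>vecs X. \<forall>y\<in>vecs X. \<phi> (x + y) = \<phi> x + \<phi> y) \<and>
     (\<forall>c. \<forall>x\<in>vecs X. \<phi> (scl X c x) = c * \<phi> x) \<and>
     (\<exists>K. \<forall>x\<in>vecs X. cmod (\<phi> x) \<le> K * nrm X x)"

lemma closed_subspace_functional_kernel:
  assumes \<phi>: "bounded_functional \<phi>" and M: "closed_subspace X M"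
  shows "closed_subspace X {x \<in> M. \<phi> x = 0}"
proof (rule closed_subspaceI)
  note M' = closed_subspaceD[OF M]
  note MV = M'(2)[THEN subsetD]
  have add: "\<And>x y. x \<in> vecs X \<Longrightarrow> y \<in> vecs X \<Longrightarrow> \<phi> (x + y) = \<phi> x + \<phi> y"
    and sc: "\<And>c x. x \<in> vecs X \<Longrightarrow> \<phi> (scl X c x) = c * \<phi> x"
    using \<phi> by (auto simp: bounded_functional_def)
  obtain K where K: "\<And>x. x \<in> vecs X \<Longrightarrow> cmod (\<phi> x) \<le> K * nrm X x"
    using \<phi> unfolding bounded_functional_def by blast
  show "subspace {x \<in> M. \<phi> x = 0}"
    unfolding subspace_def
    using subspace_0[OF M'(1)] subspace_add[OF M'(1)] subspace_scale[OF M'(1)] MV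
      sc[of 0 0] add sc by auto
  show "{x \<in> M. \<phi> x = 0} \<subseteq> vecs X" using MV by auto
  fix x l assume x: "\<And>n. x n \<in> {x \<in> M. \<phi> x = 0}" and l: "l \<in> vecs X" and c: "conv x l"
  have "cmod (\<phi> l) \<le> K * nrm X (x n - l)" for n
  proof -
    have "\<phi> l = \<phi> (l - x n)" using add[of "l - x n" "x n"] x[of n] MV l by (simp add: vecs_diff)
    then show ?thesis
      using K[of "l - x n"] x[of n] MV l by (simp add: vecs_diff nrm_diff_commute[of "x n" l])
  qed
  moreover have "(\<lambda>n. K * nrm X (x n - l)) \<longlonglongrightarrow> 0"
    using c unfolding conv_def by (rule tendsto_mult_right_zero)
  ultimately have "cmod (\<phi> l) \<le> 0"
    by (intro tendsto_lowerbound[of "\<lambda>n. K * nrm X (x n - l)"]) auto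
  then show "l \<in> {x \<in> M. \<phi> x = 0}" using M'(3)[of x l] x l c by auto
qed

text \<open>Finite-dimensional subspaces are complemented by the Hahn--Banach theorem; with enough
  functionals at hand, a complement can be cut out by one functional at a time.\<close>

lemma finite_dim_complement:
  assumes N: "closed_subspace X N" and "finite F" "span F \<subseteq> N"
    and sep: "\<And>x. x \<in> span F \<Longrightarrow> x \<noteq> 0 \<Longrightarrow> \<exists>\<phi>. bounded_functional \<phi> \<and> \<phi> x \<noteq> 0"
  obtains U where "closed_subspace X U" "U \<subseteq> N" "span F \<inter> U = {0}"
    "\<And>x. x \<in> N \<Longrightarrow> \<exists>e\<in>span F. x - e \<in> U"
proof -
  have "\<exists>U. closed_subspace X U \<and> U \<subseteq> N \<and> span F \<inter> U = {0} \<and> (\<forall>x\<in>N. \<exists>e\<in>span F. x - e \<in> U)"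
    using assms(2-)
  proof (induction F)
    case empty
    then show ?case
      using N subspace_0[OF closed_subspaceD(1)[OF N]] by (intro exI[of _ N]) auto
  next
    case (insert f F)
    have sub: "span F \<subseteq> span (insert f F)" by (rule span_mono) auto
    then have sF: "span F \<subseteq> N" using insert.prems(1) by blast
    have "\<exists>U. closed_subspace X U \<and> U \<subseteq> N \<and> span F \<inter> U = {0} \<and> (\<forall>x\<in>N. \<exists>e\<in>span F. x - e \<in> U)"
    proof (rule insert.IH[OF sF])
      fix x assume "x \<in> span F" "x \<noteq> 0"
      with sub show "\<exists>\<phi>. bounded_functional \<phi> \<and> \<phi> x \<noteq> 0"
        by (intro insert.prems(2)) auto
    qed
    then obtain U where U: "closed_subspace X U" "U \<subseteq> N" "span F \<inter> U = {0}"
      "\<forall>x\<in>N. \<exists>e\<in>span F. x - e \<in> U"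
      by (elim exE conjE) (rule that)
    note U' = closed_subspaceD[OF U(1)]
    have "f \<in> N" using insert.prems(1) span_base by blast
    then obtain e where e: "e \<in> span F" "f - e \<in> U" using U(4) by blast
    define g where "g = f - e"
    have sp: "span (insert f F) = span (insert g F)"
      using e(1) by (intro eq_span_insert_eq) (simp add: g_def)
    show ?case
    proof (cases "g = 0")
      case True
      then have "span (insert f F) = span F" unfolding sp by simp
      with U show ?thesis by (intro exI[of _ U]) auto
    next
      case False
      have gU: "g \<in> U" using e by (simp add: g_def)
      have "g \<in> span (insert f F)" unfolding sp by (rule span_base) simp
      then obtain \<phi> where \<phi>: "bounded_functional \<phi>" "\<phi> g \<noteq> 0"
        using insert.prems(2) False by blast
      have add: "\<And>x y. x \<in> vecs X \<Longrightarrow> y \<in> vecs X \<Longrightarrow> \<phi> (x + y) = \<phi> x + \<phi> y"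
        and sc: "\<And>c x. x \<in> vecs X \<Longrightarrow> \<phi> (scl X c x) = c * \<phi> x"
        using \<phi> by (auto simp: bounded_functional_def)
      let ?U = "{x \<in> U. \<phi> x = 0}"
      have "x = 0" if x: "x \<in> span (insert f F)" "x \<in> ?U" for x
      proof -
        obtain k where k: "x - scl X k g \<in> span F" using x(1) unfolding sp by (auto simp: span_insert)
        have "x - scl X k g \<in> U"
          using x gU U'(1) by (intro subspace_diff subspace_scale) auto
        with k have "x - scl X k g \<in> span F \<inter> U" by simp
        then have "x = scl X k g" unfolding U(3) by simp
        with x(2) \<phi>(2) sc[of g k] gU U'(2) show ?thesis by auto
      qed
      moreover have "0 \<in> ?U" "0 \<in> span (insert f F)"
        using subspace_0[OF closed_subspaceD(1)[OF closed_subspace_functional_kernel[OF \<phi>(1) U(1)]]]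
        by (auto simp: span_zero)
      ultimately have "span (insert f F) \<inter> ?U = {0}" by blast
      moreover have "\<exists>e\<in>span (insert f F). x - e \<in> ?U" if "x \<in> N" for x
      proof -
        from bspec[OF U(4) that] obtain e where e: "e \<in> span F" "x - e \<in> U"
          by (elim bexE) (rule that)
        let ?k = "\<phi> (x - e) / \<phi> g"
        have "x - (e + scl X ?k g) \<in> U"
          using subspace_diff[OF U'(1) e(2) subspace_scale[OF U'(1) gU, of ?k]]
          by (simp add: algebra_simps)
        moreover have "\<phi> (x - e) = \<phi> (x - (e + scl X ?k g)) + \<phi> (scl X ?k g)"
          using U'(2) calculation gU subspace_scale[OF U'(1) gU, of ?k]
          by (subst add[symmetric]) auto
        then have "\<phi> (x - (e + scl X ?k g)) = 0"
          using sc[of g ?k] gU U'(2) \<phi>(2) by auto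
        moreover have "e + scl X ?k g \<in> span (insert f F)"
          unfolding sp using e(1) span_mono[of F "insert g F"]
          by (intro span_add span_scale) (auto intro: span_base)
        ultimately show ?thesis by blast
      qed
      ultimately show ?thesis
        using closed_subspace_functional_kernel[OF \<phi>(1) U(1)] U(2) by (intro exI[of _ ?U]) auto
    qed
  qed
  then show ?thesis by (elim exE conjE) (rule that, assumption+, erule (1) bspec)
qed

lemma RedD:
  assumes "(M, N) \<in> Red X A"
  shows "closed_subspace X M" "closed_subspace X N" "A ` M \<subseteq> M" "A ` N \<subseteq> N"
    "direct_sum X M N" "vecs X = {m + n | m n. m \<in> M \<and> n \<in> N}" "M \<inter> N = {0}"
  using assms by (auto simp: Red_def direct_sum_def)

end

context banach_sp
begin

text \<open>On \<open>N\<close> the range has finite codimension, hence a finite-dimensional complement there, and adding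
  it to a closed complement \<open>W\<close> in \<open>M\<close> keeps the sum closed.\<close>

lemma complemented_range_of_Red:
  assumes A: "bounded_op X A"
    and c: "c > 0" "\<And>x. x \<in> vecs X \<Longrightarrow> c * nrm X x \<le> nrm X (A x)"
    and red: "(M, N) \<in> Red X A"
    and M: "complemented (restr X M) (range_space (restr X M) A)"
    and N: "fredholm_near_zero (restr X N) A"
  shows "complemented X (range_space X A)"
proof -
  note R = RedD[OF red]
  note M' = closed_subspaceD[OF R(1)] and N' = closed_subspaceD[OF R(2)]
  obtain W where W: "closed_subspace X W" "M = {m + n | m n. m \<in> A ` M \<and> n \<in> W}" "A ` M \<inter> W = {0}"
    using M unfolding complemented_restr[OF R(1)] by (auto simp: range_space_def)
  note W' = closed_subspaceD[OF W(1)]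
  have "0 \<in> A ` M" using W(3) by auto
  then have WM: "W \<subseteq> M" by (subst W(2)) (force intro: exI[of _ 0])
  interpret RN: banach_sp "restr X N" using banach_sp_restr[OF R(2)] .
  have AN: "bounded_op (restr X N) A" using bounded_op_restr[OF A N'(2) R(4)] .
  obtain z where z: "cmod z \<le> c / 8"
    "finite_codim (restr X N) (range_space (restr X N) (minus_scalar (restr X N) A z))"
    using fredholm_near_zeroD[OF N, of "c / 8"] c(1) by auto
  have "finite_codim (restr X N) (range_space (restr X N) A)"
    by (rule RN.finite_codim_range_perturb[OF AN c(1) _ z]) (use c(2) N'(2) in auto)
  then obtain F where F: "finite F" "F \<subseteq> N" "N = span (A ` N \<union> F)"
    by (auto simp: finite_codim_def range_space_def)
  have ANs: "subspace (A ` N)" using bounded_op_image_subspace[OF A N'(1,2)] .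
  obtain G where G: "G \<subseteq> F" "span (A ` N \<union> G) = span (A ` N \<union> F)" "A ` N \<inter> span G = {0}"
    using finite_complement[OF ANs F(1)] by blast
  have GN: "span G \<subseteq> N" using G(1) F(2) N'(1) by (intro span_minimal) auto
  let ?T = "span (W \<union> G)"
  have T: "?T = {w + g | w g. w \<in> W \<and> g \<in> span G}"
    unfolding span_Un using W'(1) by (simp add: span_eq_iff[THEN iffD2])
  have Neq: "N = {a + g | a g. a \<in> A ` N \<and> g \<in> span G}"
    using F(3) G(2) ANs unfolding span_Un by (simp add: span_eq_iff[THEN iffD2])
  have clR: "closed_subspace X (range_space X A)"
    unfolding range_space_def by (rule bounded_below_image_closed[OF A c closed_subspace_vecs])
  have clT: "closed_subspace X ?T"
    using G(1) F N'(2) by (intro closed_subspace_span_Un[OF W(1)]) (auto intro: finite_subset)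
  have "vecs X = {m + n | m n. m \<in> range_space X A \<and> n \<in> ?T}"
  proof (intro equalityI subsetI)
    fix x assume "x \<in> vecs X"
    then obtain m n where mn: "x = m + n" "m \<in> M" "n \<in> N" using R(6) by auto
    obtain m' w where m': "m = A m' + w" "m' \<in> M" "w \<in> W" using mn(2) W(2) by blast
    obtain n' g where n': "n = A n' + g" "n' \<in> N" "g \<in> span G" using mn(3) Neq by blast
    have V: "m' \<in> vecs X" "n' \<in> vecs X" using m' n' M'(2) N'(2) by auto
    then have "x = A (m' + n') + (w + g)"
      using mn m' n' by (simp add: bounded_op_add[OF A])
    moreover have "A (m' + n') \<in> range_space X A"
      unfolding range_space_def using V by (intro imageI vecs_add)
    ultimately show "x \<in> {m + n | m n. m \<in> range_space X A \<and> n \<in> ?T}"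
      unfolding T using m'(3) n'(3) by blast
  next
    fix x assume "x \<in> {m + n | m n. m \<in> range_space X A \<and> n \<in> ?T}"
    then show "x \<in> vecs X"
      using closed_subspaceD(2)[OF clT] closed_subspaceD(2)[OF clR] by (auto intro: vecs_intros)
  qed
  moreover have "x = 0" if x: "x \<in> range_space X A" "x \<in> ?T" for x
  proof -
    obtain w g where wg: "x = w + g" "w \<in> W" "g \<in> span G" using x(2) unfolding T by blast
    obtain v where "v \<in> vecs X" "x = A v" using x(1) by (auto simp: range_space_def)
    then obtain m n where mn: "x = A (m + n)" "m \<in> M" "n \<in> N" using R(6) by auto
    then have eq: "A m + A n = w + g"
      using wg(1) M'(2) N'(2) by (auto simp: subset_iff bounded_op_add[OF A])
    then have "A m - w = g - A n" by (simp add: algebra_simps)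
    moreover have "A m - w \<in> M" using mn R(3) wg WM M'(1) by (auto intro!: subspace_diff)
    moreover have "g - A n \<in> N" using mn R(4) wg GN N'(1) by (auto intro!: subspace_diff)
    ultimately have "A m - w \<in> M \<inter> N" by simp
    then have "A m - w = 0" unfolding R(7) by simp
    moreover from this have "g - A n = 0" using \<open>A m - w = g - A n\<close> by simp
    ultimately
    have "w \<in> A ` M \<inter> W" "g \<in> A ` N \<inter> span G" using wg mn by auto
    then have "w = 0" "g = 0" unfolding W(3) G(3) by auto
    then show ?thesis using wg by simp
  qed
  then have "range_space X A \<inter> ?T = {0}"
    using subspace_0[OF closed_subspaceD(1)[OF clR]] span_zero by blast
  ultimately show ?thesis
    unfolding complemented_def direct_sum_def using clR clT by blast
qed

text \<open>Sums of closed subspaces need not be closed; here the bounded projection onto \<open>M\<close> splits a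
  convergent sequence into convergent parts.\<close>

lemma closed_subspace_direct_sum:
  assumes M: "closed_subspace X M" and N: "closed_subspace X N" and MN: "direct_sum X M N"
    and W: "closed_subspace X W" "W \<subseteq> M" and U: "closed_subspace X U" "U \<subseteq> N"
  shows "closed_subspace X {w + u | w u. w \<in> W \<and> u \<in> U}"
proof (rule closed_subspaceI)
  note W' = closed_subspaceD[OF W(1)] and U' = closed_subspaceD[OF U(1)]
  show "subspace {w + u | w u. w \<in> W \<and> u \<in> U}" using W'(1) U'(1) by (rule subspace_sums)
  show "{w + u | w u. w \<in> W \<and> u \<in> U} \<subseteq> vecs X" using W'(2) U'(2) by (auto intro: vecs_intros)
  obtain P where P: "bounded_op X P" "\<And>m n. m \<in> M \<Longrightarrow> n \<in> N \<Longrightarrow> P (m + n) = m"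
    using bounded_projection[OF M N MN] by metis
  fix x l assume x: "\<And>n. x n \<in> {w + u | w u. w \<in> W \<and> u \<in> U}" and l: "l \<in> vecs X" and c: "conv x l"
  from x have "\<exists>w u. w \<in> W \<and> u \<in> U \<and> x n = w + u" for n by blast
  then obtain w u where wu: "\<And>n. w n \<in> W" "\<And>n. u n \<in> U" "\<And>n. x n = w n + u n" by metis
  have xV: "x n \<in> vecs X" for n
    unfolding wu(3) using wu(1,2)[of n] W'(2) U'(2) by (intro vecs_add) auto
  have Px: "P (x n) = w n" for n
    unfolding wu(3) using wu(1,2)[of n] W(2) U(2) by (intro P(2)) auto
  then have cw: "conv w (P l)" using bounded_op_conv[OF P(1) xV l c] by simp
  have PlV: "P l \<in> vecs X" using bounded_op_vecs[OF P(1) l] .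
  have "P l \<in> W" using W'(3)[OF wu(1) PlV cw] .
  moreover have "conv (\<lambda>n. x n - w n) (l - P l)"
    using W'(2) wu(1) by (intro conv_diff xV l PlV c cw) auto
  then have "conv u (l - P l)" unfolding wu(3) by simp
  then have "l - P l \<in> U" using U'(3)[of u "l - P l"] wu(2) l PlV vecs_diff by blast
  ultimately show "l \<in> {w + u | w u. w \<in> W \<and> u \<in> U}" by (smt (verit) add_diff_cancel_left' diff_add_cancel mem_Collect_eq add.commute)
qed

text \<open>Projecting preimages to \<open>N\<close> shows that \<open>A\<close> is surjective on \<open>N\<close> with a uniform constant, so its null
  space there is finite-dimensional. The functionals separating the null space provide a closed
  complement of this part.\<close>

lemma complemented_null_space_of_Red:
  assumes A: "bounded_op X A"
    and K: "K > 0" "\<And>y. y \<in> vecs X \<Longrightarrow> \<exists>x\<in>vecs X. A x = y \<and> nrm X x \<le> K * nrm X y"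
    and sep: "\<And>x. x \<in> null_space X A \<Longrightarrow> x \<noteq> 0 \<Longrightarrow> \<exists>\<phi>. bounded_functional \<phi> \<and> \<phi> x \<noteq> 0"
    and red: "(M, N) \<in> Red X A"
    and M: "complemented (restr X M) (null_space (restr X M) A)"
    and N: "fredholm_near_zero (restr X N) A"
  shows "complemented X (null_space X A)"
proof -
  note R = RedD[OF red]
  note M' = closed_subspaceD[OF R(1)] and N' = closed_subspaceD[OF R(2)]
  let ?kM = "{x \<in> M. A x = 0}" and ?kN = "{x \<in> N. A x = 0}"
  obtain W where W: "closed_subspace X W" "M = {m + n | m n. m \<in> ?kM \<and> n \<in> W}" "?kM \<inter> W = {0}"
    using M unfolding complemented_restr[OF R(1)] by (auto simp: null_space_def)
  note W' = closed_subspaceD[OF W(1)]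
  have "0 \<in> ?kM" using W(3) by blast
  then have WM: "W \<subseteq> M" by (subst W(2)) (force intro: exI[of _ 0])
  interpret RN: banach_sp "restr X N" using banach_sp_restr[OF R(2)] .
  have AN: "bounded_op (restr X N) A" using bounded_op_restr[OF A N'(2) R(4)] .
  have NM: "direct_sum X N M"
  proof -
    have "{m + n | m n. m \<in> M \<and> n \<in> N} = {m + n | m n. m \<in> N \<and> n \<in> M}"
      using add.commute by blast
    then show ?thesis using R(6,7) by (simp add: direct_sum_def Int_commute)
  qed
  obtain P where P: "bounded_op X P" "\<And>x. x \<in> vecs X \<Longrightarrow> P x \<in> N" "\<And>x. x \<in> vecs X \<Longrightarrow> x - P x \<in> M"
    using bounded_projection[OF R(2,1) NM] by metis
  obtain L where L: "L > 0" "\<And>x. x \<in> vecs X \<Longrightarrow> nrm X (P x) \<le> L * nrm X x"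
    using bounded_op_bound[OF P(1)] by blast
  have KN: "\<exists>x\<in>vecs (restr X N). A x = y \<and> nrm (restr X N) x \<le> (L * K) * nrm (restr X N) y"
    if "y \<in> vecs (restr X N)" for y
  proof -
    have y: "y \<in> N" "y \<in> vecs X" using that N'(2) by auto
    obtain x where x: "x \<in> vecs X" "A x = y" "nrm X x \<le> K * nrm X y" using K(2)[OF y(2)] by blast
    have Px: "P x \<in> N" "x - P x \<in> M" "P x \<in> vecs X" using P x bounded_op_vecs[OF P(1)] by auto
    have "A (x - P x) = y - A (P x)" using x Px by (simp add: bounded_op_diff[OF A])
    moreover have "A (x - P x) \<in> M" using Px R(3) by auto
    moreover have "y - A (P x) \<in> N" using Px R(4) y N'(1) by (auto intro!: subspace_diff)
    ultimately have "y - A (P x) \<in> M \<inter> N" by simp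
    then have "A (P x) = y" unfolding R(7) by simp
    moreover have "nrm X (P x) \<le> (L * K) * nrm X y"
      using order_trans[OF L(2)[OF x(1)] mult_left_mono[OF x(3)]] L(1) by (simp add: mult.assoc)
    ultimately show ?thesis using Px by auto
  qed
  have LK: "L * K > 0" using L K by simp
  obtain z where z: "cmod z \<le> 1 / (8 * (L * K))"
    "finite_dim (restr X N) (null_space (restr X N) (minus_scalar (restr X N) A z))"
    using fredholm_near_zeroD[OF N, of "1 / (8 * (L * K))"] LK by auto
  have "cmod z * (L * K) \<le> 1 / 8" using z(1) LK by (simp add: field_simps)
  then have "finite_dim (restr X N) (null_space (restr X N) A)"
    using RN.finite_dim_kernel_perturb[OF AN LK KN _ z(2)] by blast
  then obtain F where F: "finite F" "?kN = span F"
    by (auto simp: finite_dim_def null_space_def)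
  have kNsub: "x \<in> null_space X A" if "x \<in> span F" for x
    using that N'(2) unfolding F(2)[symmetric] by (auto simp: null_space_def)
  obtain U where U: "closed_subspace X U" "U \<subseteq> N" "span F \<inter> U = {0}"
    "\<And>x. x \<in> N \<Longrightarrow> \<exists>e\<in>span F. x - e \<in> U"
  proof (rule finite_dim_complement[OF R(2) F(1)])
    show "span F \<subseteq> N" unfolding F(2)[symmetric] by auto
    show "\<exists>\<phi>. bounded_functional \<phi> \<and> \<phi> x \<noteq> 0" if "x \<in> span F" "x \<noteq> 0" for x
      using sep kNsub that by blast
  qed (rule that)
  let ?T = "{w + u | w u. w \<in> W \<and> u \<in> U}"
  have clT: "closed_subspace X ?T"
    using closed_subspace_direct_sum[OF R(1,2,5) W(1) WM U(1,2)] .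
  have clK: "closed_subspace X (null_space X A)"
    unfolding null_space_def by (rule closed_subspace_kernel_on[OF A closed_subspace_vecs])
  have "vecs X = {m + n | m n. m \<in> null_space X A \<and> n \<in> ?T}"
  proof (intro equalityI subsetI)
    fix x assume "x \<in> vecs X"
    then obtain m n where mn: "x = m + n" "m \<in> M" "n \<in> N" using R(6) by auto
    have "\<exists>m' w. m = m' + w \<and> m' \<in> ?kM \<and> w \<in> W" using mn(2) by (subst (asm) W(2)) blast
    then obtain m' w where m': "m = m' + w" "m' \<in> ?kM" "w \<in> W" by blast
    obtain e where e: "e \<in> span F" "n - e \<in> U" using U(4) mn(3) by blast
    have "m' + e \<in> null_space X A"
      using m'(2) kNsub[OF e(1)] M'(2) by (auto simp: null_space_def bounded_op_add[OF A] intro: vecs_intros)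
    moreover have "x = (m' + e) + (w + (n - e))" using mn m' by simp
    ultimately show "x \<in> {m + n | m n. m \<in> null_space X A \<and> n \<in> ?T}" using m'(3) e(2) by blast
  next
    fix x assume "x \<in> {m + n | m n. m \<in> null_space X A \<and> n \<in> ?T}"
    then show "x \<in> vecs X"
      using closed_subspaceD(2)[OF clT] closed_subspaceD(2)[OF clK] by (blast intro: vecs_intros)
  qed
  moreover have "x = 0" if x: "x \<in> null_space X A" "x \<in> ?T" for x
  proof -
    obtain w u where wu: "x = w + u" "w \<in> W" "u \<in> U" using x(2) by blast
    have V: "w \<in> vecs X" "u \<in> vecs X" using wu W'(2) U(2) N'(2) by auto
    have mem: "w \<in> M" "u \<in> N" using wu WM U(2) by auto
    have "A w + A u = 0" using x(1) V by (simp add: wu null_space_def bounded_op_add[OF A])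
    then have eq: "A w = - A u" by (simp add: add_eq_0_iff2)
    have "A w \<in> M" "- A u \<in> N" using mem R(3,4) N'(1) by (auto intro!: subspace_neg)
    with eq have "A w \<in> M \<inter> N" by simp
    then have "A w = 0" unfolding R(7) by simp
    with eq have "A u = 0" by simp
    with \<open>A w = 0\<close> have "w \<in> ?kM \<inter> W" "u \<in> span F \<inter> U"
      using mem wu unfolding F(2)[symmetric] by auto
    then show ?thesis using W(3) U(3) wu(1) by auto
  qed
  then have "null_space X A \<inter> ?T = {0}"
    using subspace_0[OF closed_subspaceD(1)[OF clK]] subspace_0[OF closed_subspaceD(1)[OF clT]] by blast
  ultimately show ?thesis
    unfolding complemented_def direct_sum_def using clK clT by blast
qed

end

section \<open>One-sided generalized Drazin inverses\<close>

context normed_sp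
begin

lemma idempotent_Red:
  assumes A: "bounded_op X A" and P: "bounded_op X P"
    and idem: "\<And>x. x \<in> vecs X \<Longrightarrow> P (P x) = P x"
    and comm: "\<And>x. x \<in> vecs X \<Longrightarrow> A (P x) = P (A x)"
  shows "({x \<in> vecs X. P x = x}, {x \<in> vecs X. P x = 0}) \<in> Red X A"
proof -
  have "minus_scalar X P 1 x = 0 \<longleftrightarrow> P x = x" for x by (simp add: minus_scalar_def)
  then have "closed_subspace X {x \<in> vecs X. P x = x}"
    using closed_subspace_kernel_on[OF bounded_op_minus_scalar[OF P] closed_subspace_vecs, of 1]
    by simp
  moreover have "closed_subspace X {x \<in> vecs X. P x = 0}"
    using closed_subspace_kernel_on[OF P closed_subspace_vecs] .
  moreover have "A ` {x \<in> vecs X. P x = x} \<subseteq> {x \<in> vecs X. P x = x}"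
    using comm bounded_op_vecs[OF A] by (auto simp flip: comm)
  moreover have "A ` {x \<in> vecs X. P x = 0} \<subseteq> {x \<in> vecs X. P x = 0}"
    using bounded_op_vecs[OF A] bounded_op_0[OF A] by (auto simp flip: comm)
  moreover have "direct_sum X {x \<in> vecs X. P x = x} {x \<in> vecs X. P x = 0}"
    unfolding direct_sum_def
  proof (intro conjI equalityI subsetI)
    fix x assume x: "x \<in> vecs X"
    have "P (x - P x) = 0" using x bounded_op_vecs[OF P] idem by (simp add: bounded_op_diff[OF P])
    then show "x \<in> {m + n |m n. m \<in> {x \<in> vecs X. P x = x} \<and> n \<in> {x \<in> vecs X. P x = 0}}"
      using x bounded_op_vecs[OF P x] idem[OF x]
      by (intro CollectI exI[of _ "P x"] exI[of _ "x - P x"]) (auto intro: vecs_intros)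
  qed (use bounded_op_0[OF P] in \<open>auto intro: vecs_intros\<close>)
  ultimately show ?thesis by (simp add: Red_def)
qed

text \<open>The operator \<open>A - A P\<close> is \<open>0\<close> on the range of \<open>P\<close> and \<open>A\<close> on its kernel. As \<open>- z\<close> is invertible on
  the range, the null space and the cokernel of \<open>A - A P - z\<close> are those of \<open>A - z\<close> on the kernel.\<close>

lemma fredholm_near_zero_kernel_of_idempotent:
  assumes A: "bounded_op X A" and P: "bounded_op X P"
    and idem: "\<And>x. x \<in> vecs X \<Longrightarrow> P (P x) = P x"
    and comm: "\<And>x. x \<in> vecs X \<Longrightarrow> A (P x) = P (A x)"
    and C: "\<And>x. x \<in> vecs X \<Longrightarrow> C x = A x - A (P x)"
    and fn: "fredholm_near_zero X C"
  shows "fredholm_near_zero (restr X {x \<in> vecs X. P x = 0}) A"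
  unfolding fredholm_near_zero_def minus_scalar_restr
proof (intro allI impI)
  let ?N = "{x \<in> vecs X. P x = 0}"
  note AV = bounded_op_vecs[OF A] and PV = bounded_op_vecs[OF P]
  fix e :: real assume "e > 0"
  then obtain z where z: "z \<noteq> 0" "cmod z < e" "finite_dim X (null_space X (minus_scalar X C z))"
    "finite_codim X (range_space X (minus_scalar X C z))"
    using fn unfolding fredholm_near_zero_def by blast
  have CN: "minus_scalar X C z x = minus_scalar X A z x" if "x \<in> ?N" for x
    using that bounded_op_0[OF A] by (simp add: minus_scalar_def C)
  have PC: "P (minus_scalar X C z x) = - scl X z (P x)" if "x \<in> vecs X" for x
    using that AV PV by (simp add: minus_scalar_def C bounded_op_diff[OF P] vecs_intros
        bounded_op_scl[OF P] comm idem)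
  have "null_space (restr X ?N) (minus_scalar X A z) = null_space X (minus_scalar X C z)"
  proof (intro equalityI subsetI)
    fix x assume "x \<in> null_space (restr X ?N) (minus_scalar X A z)"
    then show "x \<in> null_space X (minus_scalar X C z)"
      using CN[of x] by (auto simp: null_space_def)
  next
    fix x assume x: "x \<in> null_space X (minus_scalar X C z)"
    then have "x \<in> vecs X" "scl X z (P x) = 0"
      using PC[of x] bounded_op_0[OF P] by (auto simp: null_space_def)
    then have "x \<in> ?N" using z(1) by simp
    then show "x \<in> null_space (restr X ?N) (minus_scalar X A z)"
      using CN[of x] x by (auto simp: null_space_def)
  qed
  with z(3) have "finite_dim (restr X ?N) (null_space (restr X ?N) (minus_scalar X A z))"
    by (simp add: finite_dim_def)
  moreover have "finite_codim (restr X ?N) (range_space (restr X ?N) (minus_scalar X A z))"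
  proof -
    let ?B = "minus_scalar X A z"
    have B: "bounded_op X ?B" using bounded_op_minus_scalar[OF A] .
    obtain F where F: "finite F" "F \<subseteq> vecs X"
      "vecs X = span (range_space X (minus_scalar X C z) \<union> F)"
      using z(4) by (auto simp: finite_codim_def)
    define Q where "Q x = x - P x" for x
    have QN: "Q x \<in> ?N" if "x \<in> vecs X" for x
      using that PV idem by (simp add: Q_def bounded_op_diff[OF P] vecs_intros)
    have Q0: "Q 0 = 0" by (simp add: Q_def bounded_op_0[OF P])
    have Qadd: "Q (x + y) = Q x + Q y" if "x \<in> vecs X" "y \<in> vecs X" for x y
      using that by (simp add: Q_def bounded_op_add[OF P])
    have Qscl: "Q (scl X c x) = scl X c (Q x)" if "x \<in> vecs X" for c x
      using that by (simp add: Q_def bounded_op_scl[OF P] scale_right_diff_distrib)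
    have QC: "Q (minus_scalar X C z x) = ?B (Q x)" if "x \<in> vecs X" for x
      using that PC[OF that] PV AV
      by (simp add: Q_def minus_scalar_def C bounded_op_diff[OF A] scale_right_diff_distrib)
    have Ns: "subspace ?N" "?N \<subseteq> vecs X"
      using closed_subspace_kernel_on[OF P closed_subspace_vecs] closed_subspaceD by auto
    let ?S = "span (?B ` ?N \<union> Q ` F)"
    have "x \<in> vecs X \<and> Q x \<in> ?S" if "x \<in> span (range_space X (minus_scalar X C z) \<union> F)" for x
      using that
    proof (induction rule: span_induct_alt)
      case base
      then show ?case using Q0 by (simp add: span_zero)
    next
      case (step c x y)
      have xV: "x \<in> vecs X" unfolding F(3) using step(1) by (rule span_base)
      have "Q x \<in> ?S"
        using step(1) QC QN by (auto simp: range_space_def intro: span_base)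
      with step(2) xV show ?case
        by (auto simp: Qadd Qscl vecs_intros intro!: span_add span_scale)
    qed
    then have "Q x \<in> ?S" if "x \<in> vecs X" for x using that F(3) by blast
    then have "x \<in> ?S" if "x \<in> ?N" for x
    proof -
      have "Q x = x" using that by (simp add: Q_def)
      with \<open>\<And>x. x \<in> vecs X \<Longrightarrow> Q x \<in> ?S\<close>[of x] that show ?thesis by simp
    qed
    moreover have "?B x \<in> ?N" if "x \<in> ?N" for x
      using that bounded_op_vecs[OF B] AV bounded_op_0[OF A]
      by (auto simp: minus_scalar_def bounded_op_diff[OF P] vecs_intros bounded_op_scl[OF P]
          simp flip: comm)
    then have "?S \<subseteq> ?N" using QN F(2) by (intro span_minimal Ns) auto
    ultimately have "?N = ?S" by blast
    moreover have "finite (Q ` F)" "Q ` F \<subseteq> ?N" using F QN by auto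
    ultimately show ?thesis
      unfolding finite_codim_restr range_space_def restr_simps by blast
  qed
  ultimately show "\<exists>z. z \<noteq> 0 \<and> cmod z < e \<and>
        finite_dim (restr X ?N) (null_space (restr X ?N) (minus_scalar X A z)) \<and>
        finite_codim (restr X ?N) (range_space (restr X ?N) (minus_scalar X A z))"
    using z by blast
qed

end

context banach_sp
begin

text \<open>The idempotent is \<open>P = B A\<close>. On its range \<open>P B\<close> is a left inverse of \<open>A\<close>, so that \<open>A P B\<close> projects
  the range of \<open>P\<close> onto the range of \<open>A\<close> there.\<close>

lemma complemented_range_of_left_gD:
  assumes A: "bounded_op X A"
    and c: "c > 0" "\<And>x. x \<in> vecs X \<Longrightarrow> c * nrm X x \<le> nrm X (A x)"
    and B: "bounded_op X B"
    and ABA: "\<And>x. x \<in> vecs X \<Longrightarrow> A (B (A x)) = B (A (A x))"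
    and BBA: "\<And>x. x \<in> vecs X \<Longrightarrow> B (B (A x)) = B x"
    and fn: "fredholm_near_zero X (\<lambda>x. A x - A (B (A x)))"
  shows "complemented X (range_space X A)"
proof -
  note AV = bounded_op_vecs[OF A] and BV = bounded_op_vecs[OF B]
  define P where "P x = B (A x)" for x
  have P: "bounded_op X P" unfolding P_def[abs_def] by (rule bounded_op_compose[OF B A])
  note PV = bounded_op_vecs[OF P]
  have idem: "P (P x) = P x" if "x \<in> vecs X" for x
    using that AV by (simp add: P_def ABA BBA)
  have comm: "A (P x) = P (A x)" if "x \<in> vecs X" for x using that by (simp add: P_def ABA)
  have PB: "bounded_op X (\<lambda>x. P (B x))" by (rule bounded_op_compose[OF P B])
  let ?M = "{x \<in> vecs X. P x = x}" and ?N = "{x \<in> vecs X. P x = 0}"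
  have red: "(?M, ?N) \<in> Red X A" using idempotent_Red[OF A P idem comm] .
  note R = RedD[OF red] and Ms = closed_subspaceD(1)[OF RedD(1)[OF red]]
  have N: "fredholm_near_zero (restr X ?N) A"
    by (rule fredholm_near_zero_kernel_of_idempotent[OF A P idem comm, where C = "\<lambda>x. A x - A (B (A x))"])
      (simp_all add: fn P_def ABA)
  let ?W = "{x \<in> ?M. P (B x) = 0}"
  have W: "closed_subspace X ?W" by (rule closed_subspace_kernel_on[OF PB R(1)])
  have PBA: "P (B (A x)) = x" if "x \<in> ?M" for x using that by (simp add: P_def[symmetric])
  have "?M = {m + n | m n. m \<in> A ` ?M \<and> n \<in> ?W}"
  proof (intro equalityI subsetI)
    fix m assume m: "m \<in> ?M"
    define m' where "m' = P (B m)"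
    have m': "m' \<in> ?M" using m BV PV idem by (simp add: m'_def)
    have "A m' \<in> ?M" using m' R(3) by blast
    with m have "m - A m' \<in> ?M" using Ms subspace_diff by blast
    moreover have "P (B (m - A m')) = P (B m) - P (B (A m'))"
      using m m' AV by (intro bounded_op_diff[OF PB]) auto
    then have "P (B (m - A m')) = 0" using PBA[OF m'] by (simp add: m'_def)
    ultimately have "m - A m' \<in> ?W" by simp
    then show "m \<in> {m + n | m n. m \<in> A ` ?M \<and> n \<in> ?W}"
      using m' by (intro CollectI exI[of _ "A m'"] exI[of _ "m - A m'"] conjI imageI) simp_all
  next
    fix x assume "x \<in> {m + n | m n. m \<in> A ` ?M \<and> n \<in> ?W}"
    then obtain m n where "x = A m + n" "m \<in> ?M" "n \<in> ?M" by blast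
    moreover from this have "A m \<in> ?M" using R(3) by blast
    ultimately show "x \<in> ?M" using Ms subspace_add by blast
  qed
  moreover have "A ` ?M \<inter> ?W = {0}"
  proof -
    have "x = 0" if "x \<in> A ` ?M" "x \<in> ?W" for x
    proof -
      obtain m where m: "m \<in> ?M" "x = A m" using \<open>x \<in> A ` ?M\<close> by blast
      with PBA[OF m(1)] \<open>x \<in> ?W\<close> have "m = 0" by simp
      with m show ?thesis by (simp add: bounded_op_0[OF A])
    qed
    moreover have "0 \<in> A ` ?M"
      using bounded_op_0[OF A] subspace_0[OF Ms] by (intro image_eqI[of _ _ 0]) auto
    moreover have "0 \<in> ?W" using subspace_0[OF closed_subspaceD(1)[OF W]] .
    ultimately show ?thesis by blast
  qed
  moreover have "closed_subspace X (A ` ?M)" by (rule bounded_below_image_closed[OF A c R(1)])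
  ultimately have "complemented (restr X ?M) (range_space (restr X ?M) A)"
    unfolding complemented_restr[OF R(1)] range_space_def restr_simps using W by blast
  then show ?thesis using complemented_range_of_Red[OF A c red _ N] by blast
qed

text \<open>The idempotent is \<open>P = A B\<close>. On its range \<open>B\<close> is a right inverse of \<open>A\<close>, so that \<open>1 - B A\<close> projects
  the range of \<open>P\<close> onto the null space of \<open>A\<close> there.\<close>

lemma complemented_null_space_of_right_gD:
  assumes A: "bounded_op X A"
    and K: "K > 0" "\<And>y. y \<in> vecs X \<Longrightarrow> \<exists>x\<in>vecs X. A x = y \<and> nrm X x \<le> K * nrm X y"
    and sep: "\<And>x. x \<in> null_space X A \<Longrightarrow> x \<noteq> 0 \<Longrightarrow> \<exists>\<phi>. bounded_functional \<phi> \<and> \<phi> x \<noteq> 0"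
    and B: "bounded_op X B"
    and ABA: "\<And>x. x \<in> vecs X \<Longrightarrow> A (B (A x)) = A (A (B x))"
    and ABB: "\<And>x. x \<in> vecs X \<Longrightarrow> A (B (B x)) = B x"
    and fn: "fredholm_near_zero X (\<lambda>x. A x - A (B (A x)))"
  shows "complemented X (null_space X A)"
proof -
  note AV = bounded_op_vecs[OF A] and BV = bounded_op_vecs[OF B]
  define P where "P x = A (B x)" for x
  have P: "bounded_op X P" unfolding P_def[abs_def] by (rule bounded_op_compose[OF A B])
  have idem: "P (P x) = P x" if "x \<in> vecs X" for x
    using that BV by (simp add: P_def ABA ABB)
  have comm: "A (P x) = P (A x)" if "x \<in> vecs X" for x using that by (simp add: P_def ABA)
  have BA: "bounded_op X (\<lambda>x. B (A x))" by (rule bounded_op_compose[OF B A])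
  let ?M = "{x \<in> vecs X. P x = x}" and ?N = "{x \<in> vecs X. P x = 0}"
  have red: "(?M, ?N) \<in> Red X A" using idempotent_Red[OF A P idem comm] .
  note R = RedD[OF red] and Ms = closed_subspaceD(1)[OF RedD(1)[OF red]]
  have N: "fredholm_near_zero (restr X ?N) A"
    by (rule fredholm_near_zero_kernel_of_idempotent[OF A P idem comm, where C = "\<lambda>x. A x - A (B (A x))"])
      (simp_all add: fn P_def ABA)
  let ?W = "{x \<in> ?M. minus_scalar X (\<lambda>x. B (A x)) 1 x = 0}" and ?k = "{x \<in> ?M. A x = 0}"
  have Wiff: "x \<in> ?W \<longleftrightarrow> x \<in> ?M \<and> B (A x) = x" for x by (simp add: minus_scalar_def)
  have W: "closed_subspace X ?W"
    by (rule closed_subspace_kernel_on[OF bounded_op_minus_scalar[OF BA] R(1)])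
  have k: "closed_subspace X ?k" by (rule closed_subspace_kernel_on[OF A R(1)])
  have "?M = {m + n | m n. m \<in> ?k \<and> n \<in> ?W}"
  proof (intro equalityI subsetI)
    fix m assume m: "m \<in> ?M"
    define w where "w = B (A m)"
    have wM: "w \<in> ?M" using m AV BV by (simp add: w_def P_def ABB)
    have Aw: "A w = A m" using m comm[of m] by (simp add: w_def P_def)
    have "w \<in> ?W" unfolding Wiff using wM by (simp add: Aw) (simp add: w_def)
    moreover have "m - w \<in> ?k"
      using m wM Aw subspace_diff[OF Ms m wM] by (simp add: bounded_op_diff[OF A])
    ultimately show "m \<in> {m + n | m n. m \<in> ?k \<and> n \<in> ?W}"
      by (intro CollectI exI[of _ "m - w"] exI[of _ w] conjI) simp_all
  next
    fix x assume "x \<in> {m + n | m n. m \<in> ?k \<and> n \<in> ?W}"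
    then obtain m n where "x = m + n" "m \<in> ?M" "n \<in> ?M" by blast
    then show "x \<in> ?M" using Ms subspace_add by blast
  qed
  moreover have "?k \<inter> ?W = {0}"
  proof -
    have "x = 0" if "x \<in> ?k" "x \<in> ?W" for x
      using that unfolding Wiff by (simp add: bounded_op_0[OF B])
    then show ?thesis
      using subspace_0[OF closed_subspaceD(1)[OF W]] subspace_0[OF closed_subspaceD(1)[OF k]]
      by blast
  qed
  ultimately have "complemented (restr X ?M) (null_space (restr X ?M) A)"
    unfolding complemented_restr[OF R(1)] null_space_def restr_simps using W k by blast
  then show ?thesis using complemented_null_space_of_Red[OF A K sep red _ N] by blast
qed

theorem bounded_below_obstruction:
  assumes A: "bounded_op X A" "bounded_below X A"
    and ncompl: "\<not> complemented X (range_space X A)"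
    and \<P>: "\<P> = Riesz \<or> \<P> = meromorphic_op"
  shows "\<not> generalized_Saphar_decomposition \<P> X A" "\<not> left_gD_invertible \<P> X A"
proof -
  obtain c where c: "c > 0" "\<And>x. x \<in> vecs X \<Longrightarrow> c * nrm X x \<le> nrm X (A x)"
    using A(2) by (auto simp: bounded_below_def)
  show "\<not> generalized_Saphar_decomposition \<P> X A"
  proof
    assume "generalized_Saphar_decomposition \<P> X A"
    then obtain M N where red: "(M, N) \<in> Red X A"
      and M: "complemented (restr X M) (range_space (restr X M) A)" and N: "\<P> (restr X N) A"
      by (auto simp: generalized_Saphar_decomposition_def Saphar_def)
    note R = RedD[OF red] and N' = closed_subspaceD[OF RedD(2)[OF red]]
    have "fredholm_near_zero (restr X N) A"
      by (rule normed_sp.Riesz_or_meromorphic_fredholm_near_zero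
          [OF normed_sp_restr[OF N'(1,2)] \<P> bounded_op_restr[OF A(1) N'(2) R(4)] N])
    with ncompl complemented_range_of_Red[OF A(1) c red M] show False by blast
  qed
  show "\<not> left_gD_invertible \<P> X A"
  proof
    assume "left_gD_invertible \<P> X A"
    then obtain B where B: "bounded_op X B"
      "\<And>x. x \<in> vecs X \<Longrightarrow> A (B (A x)) = B (A (A x))"
      "\<And>x. x \<in> vecs X \<Longrightarrow> B (B (A x)) = B x" and C: "\<P> X (\<lambda>x. A x - A (B (A x)))"
      by (auto simp: left_gD_invertible_def)
    have "bounded_op X (\<lambda>x. A x - A (B (A x)))"
      by (rule bounded_op_diff_op[OF A(1) bounded_op_compose[OF A(1) bounded_op_compose[OF B(1) A(1)]]])
    then have "fredholm_near_zero X (\<lambda>x. A x - A (B (A x)))"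
      using Riesz_or_meromorphic_fredholm_near_zero
        [where \<P> = \<P> and A = "\<lambda>x. A x - A (B (A x))"] \<P> C by argo
    with ncompl complemented_range_of_left_gD[OF A(1) c B] show False by blast
  qed
qed

theorem surjective_obstruction:
  assumes A: "bounded_op X A"
    and K: "K > 0" "\<And>y. y \<in> vecs X \<Longrightarrow> \<exists>x\<in>vecs X. A x = y \<and> nrm X x \<le> K * nrm X y"
    and sep: "\<And>x. x \<in> null_space X A \<Longrightarrow> x \<noteq> 0 \<Longrightarrow> \<exists>\<phi>. bounded_functional \<phi> \<and> \<phi> x \<noteq> 0"
    and ncompl: "\<not> complemented X (null_space X A)"
    and \<P>: "\<P> = Riesz \<or> \<P> = meromorphic_op"
  shows "\<not> generalized_Saphar_decomposition \<P> X A" "\<not> right_gD_invertible \<P> X A"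
proof -
  show "\<not> generalized_Saphar_decomposition \<P> X A"
  proof
    assume "generalized_Saphar_decomposition \<P> X A"
    then obtain M N where red: "(M, N) \<in> Red X A"
      and M: "complemented (restr X M) (null_space (restr X M) A)" and N: "\<P> (restr X N) A"
      by (auto simp: generalized_Saphar_decomposition_def Saphar_def)
    note R = RedD[OF red] and N' = closed_subspaceD[OF RedD(2)[OF red]]
    have "fredholm_near_zero (restr X N) A"
      by (rule normed_sp.Riesz_or_meromorphic_fredholm_near_zero
          [OF normed_sp_restr[OF N'(1,2)] \<P> bounded_op_restr[OF A(1) N'(2) R(4)] N])
    with ncompl complemented_null_space_of_Red[OF A K sep red M] show False by blast
  qed
  show "\<not> right_gD_invertible \<P> X A"
  proof
    assume "right_gD_invertible \<P> X A"
    then obtain B where B: "bounded_op X B"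
      "\<And>x. x \<in> vecs X \<Longrightarrow> A (B (A x)) = A (A (B x))"
      "\<And>x. x \<in> vecs X \<Longrightarrow> A (B (B x)) = B x" and C: "\<P> X (\<lambda>x. A x - A (B (A x)))"
      by (auto simp: right_gD_invertible_def)
    have "bounded_op X (\<lambda>x. A x - A (B (A x)))"
      by (rule bounded_op_diff_op[OF A(1) bounded_op_compose[OF A(1) bounded_op_compose[OF B(1) A(1)]]])
    then have "fredholm_near_zero X (\<lambda>x. A x - A (B (A x)))"
      using Riesz_or_meromorphic_fredholm_near_zero
        [where \<P> = \<P> and A = "\<lambda>x. A x - A (B (A x))"] \<P> C by argo
    with ncompl complemented_null_space_of_right_gD[OF A K sep B] show False by blast
  qed
qed

end

context normed_sp
begin

lemma zero_space_class:
  assumes "A 0 = 0"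
  shows "Riesz (restr X {0}) A" "meromorphic_op (restr X {0}) A"
proof -
  have im: "minus_scalar X A z 0 = 0" for z by (simp add: minus_scalar_def assms)
  have "null_space (restr X {0}) (minus_scalar X A z) = span {}" for z
    by (auto simp: null_space_def im)
  then show "Riesz (restr X {0}) A"
    unfolding Riesz_def minus_scalar_restr
    by (auto simp: finite_dim_def finite_codim_def range_space_def im intro!: exI[of _ "{}"])
  have "bounded_op (restr X {0}) id" by (auto simp: bounded_op_def intro!: exI[of _ 1])
  then have "spectrum (restr X {0}) A = {}"
    unfolding spectrum_def invertible_op_def minus_scalar_restr by (auto simp: im intro!: exI[of _ id])
  then show "meromorphic_op (restr X {0}) A" by (simp add: meromorphic_op_def)
qed

lemma Red_trivial:
  assumes "bounded_op X A"
  shows "(vecs X, {0}) \<in> Red X A"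
  using assms closed_subspace_zero closed_subspace_vecs bounded_op_0[OF assms] bounded_op_vecs[OF assms]
  by (auto simp: Red_def direct_sum_def)

lemma upper_gD_invertibleI:
  assumes "bounded_op X A" "bounded_below X A"
  shows "upper_gD_invertible Riesz X A" "upper_gD_invertible meromorphic_op X A"
  using Red_trivial[OF assms(1)] zero_space_class[of A] bounded_op_0[OF assms(1)] assms(2)
  unfolding upper_gD_invertible_def by (auto simp: restr_vecs intro!: bexI[of _ "(vecs X, {0})"])

lemma lower_gD_invertibleI:
  assumes "bounded_op X A" "surjective X A"
  shows "lower_gD_invertible Riesz X A" "lower_gD_invertible meromorphic_op X A"
  using Red_trivial[OF assms(1)] zero_space_class[of A] bounded_op_0[OF assms(1)] assms(2)
  unfolding lower_gD_invertible_def by (auto simp: restr_vecs intro!: bexI[of _ "(vecs X, {0})"])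

end

section \<open>There is no bounded projection of bounded sequences onto null sequences\<close>

definition bounded_seq :: "(nat \<Rightarrow> complex) \<Rightarrow> bool" where
  "bounded_seq x \<longleftrightarrow> (\<exists>b. \<forall>n. cmod (x n) \<le> b)"

lemma bounded_seq_finite_support:
  assumes "finite {n. x n \<noteq> 0}"
  shows "bounded_seq x"
proof -
  have "finite (range (\<lambda>n. cmod (x n)))"
  proof (rule finite_subset)
    show "range (\<lambda>n. cmod (x n)) \<subseteq> insert 0 ((\<lambda>n. cmod (x n)) ` {n. x n \<noteq> 0})" by auto
  qed (use assms in auto)
  then obtain b where "\<forall>y\<in>range (\<lambda>n. cmod (x n)). y \<le> b"
    by (meson bdd_above_finite bdd_above_def)
  then show ?thesis by (auto simp: bounded_seq_def)
qed

text \<open>The sets \<open>{(n, \<lfloor>n r\<rfloor>) | n}\<close>, for real \<open>r\<close>, are infinite and have pairwise finite intersections,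
  since \<open>\<lfloor>n r\<rfloor> = \<lfloor>n s\<rfloor>\<close> forces \<open>n \<bar>r - s\<bar> < 1\<close>.\<close>

definition slope_set :: "real \<Rightarrow> nat set" where
  "slope_set r = range (\<lambda>n::nat. to_nat (n, \<lfloor>real n * r\<rfloor>))"

lemma infinite_slope_set: "infinite (slope_set r)"
  unfolding slope_set_def by (intro range_inj_infinite injI) simp

lemma slope_sets_almost_disjoint:
  assumes "r \<noteq> s"
  shows "finite (slope_set r \<inter> slope_set s)"
proof (rule finite_subset)
  let ?m = "nat \<lceil>1 / \<bar>r - s\<bar>\<rceil>"
  show "slope_set r \<inter> slope_set s \<subseteq> (\<lambda>n. to_nat (n, \<lfloor>real n * r\<rfloor>)) ` {..?m}"
  proof
    fix k assume "k \<in> slope_set r \<inter> slope_set s"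
    then obtain n where k: "k = to_nat (n, \<lfloor>real n * r\<rfloor>)" and eq: "\<lfloor>real n * r\<rfloor> = \<lfloor>real n * s\<rfloor>"
      by (auto simp: slope_set_def)
    have "\<bar>real n * r - real n * s\<bar> < 1" using eq by linarith
    then have "real n * \<bar>r - s\<bar> < 1" by (simp add: abs_mult flip: right_diff_distrib)
    then have "real n < 1 / \<bar>r - s\<bar>" using assms by (simp add: field_simps)
    then have "n \<le> ?m" by linarith
    with k show "k \<in> (\<lambda>n. to_nat (n, \<lfloor>real n * r\<rfloor>)) ` {..?m}" by auto
  qed
qed auto

text \<open>Whitley's argument. A functional \<open>x \<mapsto> x k - T x k\<close> is bounded and vanishes on finitely
  supported sequences. Modulo such sequences, a unimodular combination of indicator functions of
  finitely many almost disjoint sets has norm at most one, so each of these functionals is nonzero on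
  only countably many of the indicator functions of an almost disjoint family. As there are only
  countably many functionals, they all vanish at the indicator function of some infinite set; it is
  then fixed by \<open>T\<close>, although it does not tend to 0.\<close>

lemma no_projection_onto_null_sequences:
  fixes T :: "(nat \<Rightarrow> complex) \<Rightarrow> nat \<Rightarrow> complex"
  assumes add: "\<And>x y k. bounded_seq x \<Longrightarrow> bounded_seq y \<Longrightarrow> T (\<lambda>n. x n + y n) k = T x k + T y k"
    and scl: "\<And>c x k. bounded_seq x \<Longrightarrow> T (\<lambda>n. c * x n) k = c * T x k"
    and bnd: "\<And>x k. (\<And>n. cmod (x n) \<le> 1) \<Longrightarrow> cmod (T x k) \<le> K"
    and fin: "\<And>x k. finite {n. x n \<noteq> 0} \<Longrightarrow> T x k = x k"
    and null: "\<And>x. bounded_seq x \<Longrightarrow> T x \<longlonglongrightarrow> 0"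
  shows False
proof -
  define u :: "real \<Rightarrow> nat \<Rightarrow> complex" where "u r n = (if n \<in> slope_set r then 1 else 0)" for r n
  define \<phi> where "\<phi> k x = x k - T x k" for k x
  have bu: "bounded_seq (u r)" for r unfolding bounded_seq_def u_def by (intro exI[of _ 1]) auto
  have bsum: "bounded_seq (\<lambda>n. \<Sum>r\<in>F. c r * u r n)" for c :: "real \<Rightarrow> complex" and F
    unfolding bounded_seq_def
  proof (intro exI[of _ "\<Sum>r\<in>F. cmod (c r)"] allI)
    fix n
    show "cmod (\<Sum>r\<in>F. c r * u r n) \<le> (\<Sum>r\<in>F. cmod (c r))"
      by (intro order_trans[OF norm_sum] sum_mono) (auto simp: u_def)
  qed
  have bscl: "bounded_seq (\<lambda>n. c * u r n)" for c r
    using bsum[of "\<lambda>_. c" "{r}"] by simp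
  have \<phi>add: "\<phi> k (\<lambda>n. x n + y n) = \<phi> k x + \<phi> k y" if "bounded_seq x" "bounded_seq y" for x y k
    using add[OF that] by (simp add: \<phi>_def)
  have \<phi>fin: "\<phi> k x = 0" if "finite {n. x n \<noteq> 0}" for x k
    using fin[OF that] by (simp add: \<phi>_def)
  have \<phi>bnd: "cmod (\<phi> k x) \<le> 1 + K" if "\<And>n. cmod (x n) \<le> 1" for x k
    unfolding \<phi>_def using norm_triangle_ineq4[of "x k" "T x k"] bnd[of x k, OF that] that[of k]
    by linarith
  have \<phi>sum: "\<phi> k (\<lambda>n. \<Sum>r\<in>F. c r * u r n) = (\<Sum>r\<in>F. c r * \<phi> k (u r))"
    if "finite F" for c F k
    using that
  proof (induction F)
    case empty
    then show ?case using \<phi>fin[of "\<lambda>_. 0"] by simp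
  next
    case (insert r F)
    have "\<phi> k (\<lambda>n. c r * u r n + (\<Sum>r\<in>F. c r * u r n)) =
        \<phi> k (\<lambda>n. c r * u r n) + \<phi> k (\<lambda>n. \<Sum>r\<in>F. c r * u r n)"
      by (rule \<phi>add[OF bscl bsum])
    moreover have "\<phi> k (\<lambda>n. c r * u r n) = c r * \<phi> k (u r)"
      using scl[OF bu] by (simp add: \<phi>_def right_diff_distrib)
    ultimately show ?case using insert by simp
  qed
  have card: "real (card F) * e \<le> 1 + K"
    if F: "finite F" "\<And>r. r \<in> F \<Longrightarrow> e \<le> cmod (\<phi> k (u r))" and e: "e > 0" for F e k
  proof -
    define c where "c r = cnj (sgn (\<phi> k (u r)))" for r
    have nz: "\<phi> k (u r) \<noteq> 0" if "r \<in> F" for r using F(2)[OF that] e by auto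
    have c1: "cmod (c r) = 1" if "r \<in> F" for r using nz[OF that] by (simp add: c_def norm_sgn)
    have c2: "c r * \<phi> k (u r) = of_real (cmod (\<phi> k (u r)))" for r
      by (cases "\<phi> k (u r) = 0")
        (simp_all add: c_def sgn_eq complex_norm_square[symmetric] mult.commute power2_eq_square)
    define D where "D = (\<Union>r\<in>F. \<Union>s\<in>F - {r}. slope_set r \<inter> slope_set s)"
    have D: "finite D"
      unfolding D_def using F(1) by (intro finite_UN_I) (auto intro: slope_sets_almost_disjoint)
    define x where "x n = (\<Sum>r\<in>F. c r * u r n)" for n
    define x1 where "x1 n = (if n \<in> D then 0 else x n)" for n
    define x2 where "x2 n = (if n \<in> D then x n else 0)" for n
    have x1: "cmod (x1 n) \<le> 1" for n
    proof (cases "n \<notin> D \<and> (\<exists>r\<in>F. n \<in> slope_set r)")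
      case True
      then obtain r where r: "r \<in> F" "n \<in> slope_set r" "n \<notin> D" by blast
      have "u s n = 0" if "s \<in> F" "s \<noteq> r" for s
      proof -
        have "n \<in> D" if "n \<in> slope_set s"
          unfolding D_def using r(1,2) that \<open>s \<in> F\<close> \<open>s \<noteq> r\<close>
          by (intro UN_I[of r] UN_I[of s]) auto
        with r(3) show ?thesis by (auto simp: u_def)
      qed
      then have "x n = c r * u r n"
        unfolding x_def using F(1) r(1) by (subst sum.remove[of F r]) auto
      then show ?thesis using c1[OF r(1)] r by (simp add: x1_def u_def)
    next
      case False
      then have "x1 n = 0" by (auto simp: x1_def x_def u_def intro!: sum.neutral)
      then show ?thesis by simp
    qed
    have "finite {n. x2 n \<noteq> 0}" using D by (rule rev_finite_subset) (auto simp: x2_def)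
    then have "\<phi> k x2 = 0" by (rule \<phi>fin)
    moreover have "bounded_seq x1" unfolding bounded_seq_def using x1 by blast
    moreover have "bounded_seq x" unfolding x_def[abs_def] by (rule bsum)
    then have "bounded_seq x2" unfolding bounded_seq_def x2_def
      by (auto intro: order_trans[OF norm_ge_zero])
    moreover have "x = (\<lambda>n. x1 n + x2 n)" by (auto simp: x1_def x2_def)
    ultimately have "\<phi> k x = \<phi> k x1" using \<phi>add by simp
    then have "cmod (\<phi> k x) \<le> 1 + K" using \<phi>bnd x1 by simp
    moreover have "\<phi> k x = of_real (\<Sum>r\<in>F. cmod (\<phi> k (u r)))"
      using \<phi>sum[OF F(1)] by (simp add: x_def[abs_def] c2)
    moreover have "real (card F) * e \<le> (\<Sum>r\<in>F. cmod (\<phi> k (u r)))"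
      using F(2) by (rule sum_bounded_below)
    ultimately show ?thesis
      by (smt (verit) norm_of_real)
  qed
  have "finite {r. inverse (Suc j) \<le> cmod (\<phi> k (u r))}" for j k
  proof (rule ccontr)
    assume inf: "infinite {r. inverse (Suc j) \<le> cmod (\<phi> k (u r))}"
    obtain m :: nat where m: "(1 + K) * Suc j < m" using reals_Archimedean2 by blast
    obtain F where F: "F \<subseteq> {r. inverse (Suc j) \<le> cmod (\<phi> k (u r))}" "finite F" "card F = m"
      using infinite_arbitrarily_large[OF inf] by blast
    then have "real m * inverse (Suc j) \<le> 1 + K"
      using card[of F "inverse (Suc j)" k] by auto
    with m show False by (simp add: field_simps)
  qed
  then have "countable (\<Union>k. \<Union>j. {r. inverse (Suc j) \<le> cmod (\<phi> k (u r))})"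
    by (intro countable_UN countableI_type countable_finite)
  moreover have "{r. \<exists>k. \<phi> k (u r) \<noteq> 0} \<subseteq> (\<Union>k. \<Union>j. {r. inverse (Suc j) \<le> cmod (\<phi> k (u r))})"
  proof clarsimp
    fix r k assume "\<phi> k (u r) \<noteq> 0"
    then have "0 < cmod (\<phi> k (u r))" by simp
    from reals_Archimedean[OF this]
    show "\<exists>k j. inverse (1 + real j) \<le> cmod (\<phi> k (u r))" by (auto intro: less_imp_le)
  qed
  ultimately have "countable {r. \<exists>k. \<phi> k (u r) \<noteq> 0}" by (rule countable_subset[rotated])
  then have "{r. \<exists>k. \<phi> k (u r) \<noteq> 0} \<noteq> UNIV" using uncountable_UNIV_real by metis
  then obtain r where "\<And>k. \<phi> k (u r) = 0" by blast
  then have "T (u r) = u r" by (auto simp: \<phi>_def)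
  with null[OF bu] have "u r \<longlonglongrightarrow> 0" by metis
  then have "eventually (\<lambda>n. cmod (u r n) < 1) sequentially"
    using order_tendstoD(2)[OF tendsto_norm[of "u r" 0], of sequentially 1] by simp
  then obtain N where "\<And>n. n \<ge> N \<Longrightarrow> n \<notin> slope_set r"
    unfolding eventually_sequentially by (force simp: u_def)
  then have "slope_set r \<subseteq> {..<N}" by (meson lessThan_iff not_le subsetI)
  then show False using infinite_slope_set finite_subset by blast
qed

text \<open>If \<open>P\<close> were a bounded projection onto \<open>S\<close>, then embedding by \<open>J\<close>, applying \<open>P\<close> and reading off the
  coordinates \<open>ev k\<close> would be a map of the kind just excluded.\<close>

lemma (in banach_sp) not_complemented_if_null_sequences:
  fixes J :: "(nat \<Rightarrow> complex) \<Rightarrow> 'a" and ev :: "nat \<Rightarrow> 'a \<Rightarrow> complex"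
  assumes J: "\<And>x. bounded_seq x \<Longrightarrow> J x \<in> vecs X"
      "\<And>x y. bounded_seq x \<Longrightarrow> bounded_seq y \<Longrightarrow> J (\<lambda>n. x n + y n) = J x + J y"
      "\<And>c x. bounded_seq x \<Longrightarrow> J (\<lambda>n. c * x n) = scl X c (J x)"
      "\<And>x. (\<And>n. cmod (x n) \<le> 1) \<Longrightarrow> nrm X (J x) \<le> 1"
    and ev: "\<And>k x y. x \<in> vecs X \<Longrightarrow> y \<in> vecs X \<Longrightarrow> ev k (x + y) = ev k x + ev k y"
      "\<And>k c x. x \<in> vecs X \<Longrightarrow> ev k (scl X c x) = c * ev k x"
      "\<And>k x. x \<in> vecs X \<Longrightarrow> cmod (ev k x) \<le> nrm X x"
    and evJ: "\<And>k x. bounded_seq x \<Longrightarrow> ev k (J x) = x k"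
    and JS: "\<And>x. finite {n. x n \<noteq> 0} \<Longrightarrow> J x \<in> S"
    and evS: "\<And>s. s \<in> S \<Longrightarrow> (\<lambda>k. ev k s) \<longlonglongrightarrow> 0"
  shows "\<not> complemented X S"
proof
  assume "complemented X S"
  then obtain W where W: "closed_subspace X S" "closed_subspace X W" "direct_sum X S W"
    unfolding complemented_def by blast
  obtain P where P: "bounded_op X P" "\<And>x. x \<in> vecs X \<Longrightarrow> P x \<in> S"
    "\<And>m n. m \<in> S \<Longrightarrow> n \<in> W \<Longrightarrow> P (m + n) = m"
    using bounded_projection[OF W] by metis
  note PV = bounded_op_vecs[OF P(1)]
  obtain L where L: "L > 0" "\<And>x. x \<in> vecs X \<Longrightarrow> nrm X (P x) \<le> L * nrm X x"
    using bounded_op_bound[OF P(1)] by blast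
  have PS: "P s = s" if "s \<in> S" for s
    using P(3)[OF that, of 0] subspace_0[OF closed_subspaceD(1)[OF W(2)]] by simp
  show False
  proof (rule no_projection_onto_null_sequences[of "\<lambda>x k. ev k (P (J x))" L])
    show "ev k (P (J (\<lambda>n. x n + y n))) = ev k (P (J x)) + ev k (P (J y))"
      if "bounded_seq x" "bounded_seq y" for x y k
      using that J(1) PV by (simp add: J(2) bounded_op_add[OF P(1)] ev(1))
    show "ev k (P (J (\<lambda>n. c * x n))) = c * ev k (P (J x))" if "bounded_seq x" for c x k
      using that J(1) PV by (simp add: J(3) bounded_op_scl[OF P(1)] ev(2))
    show "cmod (ev k (P (J x))) \<le> L" if x: "\<And>n. cmod (x n) \<le> 1" for x k
    proof -
      have Jx: "J x \<in> vecs X" using J(1) x by (auto simp: bounded_seq_def)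
      have "cmod (ev k (P (J x))) \<le> L * nrm X (J x)"
        using ev(3)[OF PV[OF Jx]] L(2)[OF Jx] by (rule order_trans)
      also have "\<dots> \<le> L" using J(4)[OF x] L(1) by (simp add: mult_left_le)
      finally show ?thesis .
    qed
    show "ev k (P (J x)) = x k" if "finite {n. x n \<noteq> 0}" for x k
      using PS[OF JS[OF that]] evJ[OF bounded_seq_finite_support[OF that]] by simp
    show "(\<lambda>k. ev k (P (J x))) \<longlonglongrightarrow> 0" if "bounded_seq x" for x
      using evS[OF P(2)[OF J(1)[OF that]]] .
  qed
qed

section \<open>Quotient spaces realised on algebraic complements\<close>

lemma (in vector_space) algebraic_complement:
  assumes "subspace K" "subspace U" "K \<subseteq> U"
  obtains V where "subspace V" "V \<subseteq> U" "U = {k + v | k v. k \<in> K \<and> v \<in> V}" "K \<inter> V = {0}"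
proof -
  obtain C where C: "C \<subseteq> K" "independent C" "K \<subseteq> span C"
    using maximal_independent_subset[of K] by blast
  obtain B where B: "C \<subseteq> B" "B \<subseteq> U" "independent B" "U \<subseteq> span B"
    using maximal_independent_subset_extend[of C U] C assms(3) by blast
  have K: "span C = K" using C assms(1) by (meson span_minimal subset_antisym)
  have U: "span B = U" using B assms(2) by (meson span_minimal subset_antisym)
  show ?thesis
  proof (rule that[of "span (B - C)"])
    show "span (B - C) \<subseteq> U" unfolding U[symmetric] by (rule span_mono) auto
    have "C \<union> (B - C) = B" using B(1) by auto
    then show "U = {k + v | k v. k \<in> K \<and> v \<in> span (B - C)}"
      unfolding U[symmetric] K[symmetric] using span_Un[of C "B - C"] by simp
    have "x = 0" if x: "x \<in> span C" "x \<in> span (B - C)" for x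
    proof -
      have "representation B x = representation C x"
        using B x by (intro representation_extend) auto
      moreover have "representation B x = representation (B - C) x"
        using B x by (intro representation_extend) auto
      ultimately have "representation B x b = 0" for b
        by (metis Diff_iff representation_ne_zero)
      moreover have "x \<in> span B" using x(1) span_mono[OF B(1)] by blast
      ultimately show "x = 0"
        using sum_nonzero_representation_eq[OF B(3), of x] by simp
    qed
    then show "K \<inter> span (B - C) = {0}"
      unfolding K[symmetric] using span_zero by blast
  qed auto
qed

definition quotient_norm :: "'a::ab_group_add cnspace \<Rightarrow> 'a set \<Rightarrow> 'a \<Rightarrow> real" where
  "quotient_norm X K x = (INF k\<in>K. nrm X (x - k))"

text \<open>Representing each class modulo \<open>K\<close> by its element in a linear complement \<open>V\<close> keeps the quotient
  inside the ambient type.\<close>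

definition quotient_space :: "'a::ab_group_add cnspace \<Rightarrow> 'a set \<Rightarrow> 'a set \<Rightarrow> 'a cnspace" where
  "quotient_space X K V = \<lparr>vecs = V, scl = scl X, nrm = quotient_norm X K\<rparr>"

lemma quotient_space_simps [simp]:
  "vecs (quotient_space X K V) = V" "scl (quotient_space X K V) = scl X"
  "nrm (quotient_space X K V) = quotient_norm X K"
  by (simp_all add: quotient_space_def)

context normed_sp
begin

lemma quotient_norm_le:
  assumes K: "closed_subspace X K" and "x \<in> vecs X" "k \<in> K"
  shows "quotient_norm X K x \<le> nrm X (x - k)"
  unfolding quotient_norm_def
proof (rule cINF_lower)
  show "bdd_below ((\<lambda>k. nrm X (x - k)) ` K)"
    using assms closed_subspaceD(2)[OF K]
    by (intro bdd_belowI[of _ 0]) (auto intro!: nrm_nonneg vecs_diff)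
qed (fact assms)

lemma quotient_norm_ge:
  assumes K: "closed_subspace X K" and "\<And>k. k \<in> K \<Longrightarrow> b \<le> nrm X (x - k)"
  shows "b \<le> quotient_norm X K x"
  unfolding quotient_norm_def using assms(2) subspace_0[OF closed_subspaceD(1)[OF K]]
  by (intro cINF_greatest) auto

lemma quotient_norm_less:
  assumes K: "closed_subspace X K" and "quotient_norm X K x < b"
  obtains k where "k \<in> K" "nrm X (x - k) < b"
  using quotient_norm_ge[OF K, of b x] assms(2) by (meson not_le)

lemma quotient_norm_shift:
  assumes K: "closed_subspace X K" and xy: "x \<in> vecs X" "y \<in> vecs X" "x - y \<in> K"
  shows "quotient_norm X K x = quotient_norm X K y"
proof -
  have le: "quotient_norm X K x \<le> quotient_norm X K y"
    if "x \<in> vecs X" "y \<in> vecs X" "x - y \<in> K" for x y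
  proof (rule quotient_norm_ge[OF K])
    fix k assume "k \<in> K"
    then have "(x - y) + k \<in> K" using that(3) closed_subspaceD(1)[OF K] by (intro subspace_add)
    from quotient_norm_le[OF K that(1) this] show "quotient_norm X K x \<le> nrm X (y - k)" by simp
  qed
  have "y - x \<in> K" using subspace_neg[OF closed_subspaceD(1)[OF K] xy(3)] by simp
  with le xy show ?thesis by (meson antisym)
qed

end

text \<open>An absolutely convergent series in the quotient lifts to one in \<open>X\<close>.\<close>

lemma (in banach_sp) banach_sp_quotient:
  assumes K: "closed_subspace X K" and V: "subspace V" and KV: "direct_sum X K V"
  shows "banach_sp (quotient_space X K V)"
proof -
  let ?Q = "quotient_space X K V" and ?q = "quotient_norm X K"
  note K' = closed_subspaceD[OF K]
  have ds: "vecs X = {k + v | k v. k \<in> K \<and> v \<in> V}" "K \<inter> V = {0}"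
    using KV by (auto simp: direct_sum_def)
  have VX: "v \<in> vecs X" if "v \<in> V" for v
    unfolding ds(1) using that subspace_0[OF K'(1)] by (intro CollectI exI[of _ 0] exI[of _ v]) simp
  have KX: "k \<in> vecs X" if "k \<in> K" for k using that K'(2) by blast
  have q0: "0 \<le> ?q v" if "v \<in> V" for v
    using that VX KX by (intro quotient_norm_ge[OF K] nrm_nonneg vecs_diff)
  have qtri: "?q (v + w) \<le> ?q v + ?q w" if "v \<in> V" "w \<in> V" for v w
  proof (rule field_le_epsilon)
    fix e :: real assume "e > 0"
    then obtain k where k: "k \<in> K" "nrm X (v - k) < ?q v + e / 2"
      using quotient_norm_less[OF K, of v "?q v + e / 2"] by auto
    obtain l where l: "l \<in> K" "nrm X (w - l) < ?q w + e / 2"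
      using quotient_norm_less[OF K, of w "?q w + e / 2"] \<open>e > 0\<close> by auto
    have "?q (v + w) \<le> nrm X (v + w - (k + l))"
      using that VX k l K'(1) by (intro quotient_norm_le[OF K] subspace_add vecs_add) auto
    also have "v + w - (k + l) = (v - k) + (w - l)" by simp
    also have "nrm X \<dots> \<le> nrm X (v - k) + nrm X (w - l)"
      using that k l VX KX by (intro nrm_triangle vecs_diff)
    finally show "?q (v + w) \<le> ?q v + ?q w + e" using k l by simp
  qed
  have q_zero: "?q 0 = 0"
    using quotient_norm_le[OF K, of 0 0] q0[of 0] subspace_0[OF K'(1)] subspace_0[OF V] by simp
  have qscl_le: "?q (scl X c v) \<le> cmod c * ?q v" if "v \<in> V" for c v
  proof (cases "c = 0")
    case False
    have "?q (scl X c v) / cmod c \<le> ?q v"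
    proof (rule quotient_norm_ge[OF K])
      fix k assume k: "k \<in> K"
      have "?q (scl X c v) \<le> nrm X (scl X c v - scl X c k)"
        using that VX k K'(1) by (intro quotient_norm_le[OF K] subspace_scale vecs_scl) auto
      also have "\<dots> = cmod c * nrm X (v - k)"
        using that VX KX k by (simp add: nrm_scl vecs_diff flip: scale_right_diff_distrib)
      finally show "?q (scl X c v) / cmod c \<le> nrm X (v - k)" using False by (simp add: field_simps)
    qed
    with False show ?thesis by (simp add: field_simps)
  qed (simp add: q_zero)
  have qscl: "?q (scl X c v) = cmod c * ?q v" if "v \<in> V" for c v
  proof (cases "c = 0")
    case False
    have "?q v \<le> cmod (inverse c) * ?q (scl X c v)"
      using qscl_le[of "scl X c v" "inverse c"] that V False by (simp add: subspace_scale)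
    then have "?q v \<le> ?q (scl X c v) / cmod c" by (simp add: norm_inverse divide_inverse mult.commute)
    with False have "cmod c * ?q v \<le> ?q (scl X c v)" by (simp add: pos_le_divide_eq mult.commute)
    with qscl_le[OF that, of c] show ?thesis by simp
  qed (simp add: q_zero)
  interpret Q: normed_sp ?Q
  proof (unfold normed_sp_def normed_sp_axioms_def quotient_space_simps, intro conjI allI impI)
    show "vector_space (scl X)" by (rule vector_space_axioms)
    fix v assume v: "v \<in> V"
    have "v = 0" if "?q v = 0"
    proof (rule ccontr)
      assume "v \<noteq> 0"
      then have "v \<notin> K" using v ds(2) by blast
      then obtain \<delta> where "\<delta> > 0" "\<And>k. k \<in> K \<Longrightarrow> \<delta> \<le> nrm X (v - k)"
        using dist_closed_subspace[OF K VX[OF v]] by metis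
      then show False using quotient_norm_ge[OF K, of \<delta> v] that by simp
    qed
    then show "(?q v = 0) = (v = 0)" using q_zero by auto
  qed (use V q0 qtri qscl in auto)
  have "Q.met.mcomplete"
  proof (rule Q.mcompleteI_series, unfold quotient_space_simps)
    fix x :: "nat \<Rightarrow> 'a" assume x: "\<And>n. x n \<in> V" and le: "\<And>n. ?q (x n) \<le> (1/2) ^ n"
    have "\<exists>k. k \<in> K \<and> nrm X (x n - k) < 2 * (1/2) ^ n" for n
    proof -
      have "?q (x n) < 2 * (1/2) ^ n" using le[of n] by (rule order_le_less_trans) simp
      then show ?thesis using quotient_norm_less[OF K] by metis
    qed
    then obtain k where k: "\<And>n. k n \<in> K" "\<And>n. nrm X (x n - k n) < 2 * (1/2) ^ n" by metis
    obtain l where l: "l \<in> vecs X" "conv (\<lambda>n. \<Sum>i<n. x i - k i) l"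
      by (rule geometric_series[of "\<lambda>n. x n - k n" 2 "1/2"])
        (use x VX k KX in \<open>auto intro: vecs_diff less_imp_le\<close>)
    obtain k0 v where kv: "l = k0 + v" "k0 \<in> K" "v \<in> V" using l(1) unfolding ds(1) by blast
    have "Q.conv (\<lambda>n. \<Sum>i<n. x i) v"
    proof (rule Q.conv_le, unfold quotient_space_simps)
      show "(\<lambda>n. nrm X ((\<Sum>i<n. x i - k i) - l)) \<longlonglongrightarrow> 0" using l(2) by (simp add: conv_def)
      fix n
      have "?q ((\<Sum>i<n. x i) - v) \<le> nrm X ((\<Sum>i<n. x i) - v - ((\<Sum>i<n. k i) + k0))"
        using x k kv VX K'(1)
        by (intro quotient_norm_le[OF K] subspace_add subspace_sum vecs_diff vecs_sum) auto
      also have "(\<Sum>i<n. x i) - v - ((\<Sum>i<n. k i) + k0) = (\<Sum>i<n. x i - k i) - l"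
        by (simp add: kv sum_subtractf algebra_simps)
      finally show "?q ((\<Sum>i<n. x i) - v) \<le> nrm X ((\<Sum>i<n. x i - k i) - l)" .
      show "(\<Sum>i<n. x i) \<in> V" using x V by (intro subspace_sum) auto
    qed (use kv in auto)
    then show "\<exists>l\<in>V. Q.conv (\<lambda>n. \<Sum>i<n. x i) l" using kv by blast
  qed
  then show ?thesis using Q.normed_sp_axioms by (simp add: banach_sp_def banach_sp_axioms_def)
qed

section \<open>Bounded sequences\<close>

definition linf :: "(nat \<Rightarrow> complex) cnspace" where
  "linf = \<lparr>vecs = {x. bounded_seq x}, scl = (\<lambda>c x n. c * x n), nrm = (\<lambda>x. SUP n. cmod (x n))\<rparr>"

lemma linf_simps [simp]:
  "vecs linf = {x. bounded_seq x}" "scl linf c x = (\<lambda>n. c * x n)"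
  by (simp_all add: linf_def)

lemma bounded_seqI: "(\<And>n. cmod (x n) \<le> b) \<Longrightarrow> bounded_seq x"
  by (auto simp: bounded_seq_def)

lemma linf_nrm_le: "(\<And>n. cmod (x n) \<le> b) \<Longrightarrow> nrm linf x \<le> b"
  unfolding linf_def by (auto intro: cSUP_least)

lemma linf_nrm_ge:
  assumes "bounded_seq x"
  shows "cmod (x n) \<le> nrm linf x"
proof -
  have "bdd_above (range (\<lambda>n. cmod (x n)))" using assms by (auto simp: bounded_seq_def bdd_above_def)
  then show ?thesis unfolding linf_def by (auto intro: cSUP_upper)
qed

lemma bounded_seq_add:
  assumes "bounded_seq x" "bounded_seq y"
  shows "bounded_seq (x + y)"
proof (rule bounded_seqI)
  show "cmod ((x + y) n) \<le> nrm linf x + nrm linf y" for n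
    using norm_triangle_ineq[of "x n" "y n"] linf_nrm_ge[OF assms(1), of n]
      linf_nrm_ge[OF assms(2), of n] by simp
qed

lemma bounded_seq_scl: "bounded_seq x \<Longrightarrow> bounded_seq (\<lambda>n. c * x n)"
  by (rule bounded_seqI[of _ "cmod c * nrm linf x"]) (simp add: norm_mult mult_left_mono linf_nrm_ge)

lemma bounded_seq_comp: "bounded_seq x \<Longrightarrow> bounded_seq (\<lambda>n. x (f n))"
  by (auto simp: bounded_seq_def)

lemma linf_nrm_comp: "bounded_seq x \<Longrightarrow> nrm linf (\<lambda>n. x (f n)) \<le> nrm linf x"
  by (intro linf_nrm_le linf_nrm_ge)

lemma vector_space_sequences: "vector_space (\<lambda>(c::complex) (x :: nat \<Rightarrow> complex) n. c * x n)"
  by standard (auto simp: fun_eq_iff algebra_simps)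

lemma scl_linf: "scl linf = (\<lambda>c x n. c * x n)"
  by (simp add: linf_def)

interpretation linf: normed_sp linf
proof (unfold normed_sp_def normed_sp_axioms_def, intro conjI allI impI)
  show vs: "vector_space (scl linf)" unfolding scl_linf by (rule vector_space_sequences)
  then interpret vector_space "scl linf" .
  show "subspace (vecs linf)"
    unfolding subspace_def by (auto simp: bounded_seq_add bounded_seq_scl intro: bounded_seqI[of _ 0])
  fix x assume x: "x \<in> vecs linf"
  then have bx: "bounded_seq x" by simp
  show nn: "0 \<le> nrm linf x" using linf_nrm_ge[OF bx, of 0] norm_ge_zero order_trans by blast
  have "x = 0" if "nrm linf x = 0"
    using linf_nrm_ge[OF bx] that by (auto simp: fun_eq_iff)
  moreover have "nrm linf 0 = 0" unfolding linf_def by simp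
  ultimately show "(nrm linf x = 0) = (x = 0)" by blast
  show "nrm linf (scl linf c x) = cmod c * nrm linf x" for c
  proof (rule antisym)
    show "nrm linf (scl linf c x) \<le> cmod c * nrm linf x"
      by (rule linf_nrm_le) (simp add: norm_mult mult_left_mono linf_nrm_ge[OF bx])
    show "cmod c * nrm linf x \<le> nrm linf (scl linf c x)"
    proof (cases "c = 0")
      case False
      have "nrm linf x \<le> nrm linf (scl linf c x) / cmod c"
        using linf_nrm_ge[OF bounded_seq_scl[OF bx, of c]] False
        by (intro linf_nrm_le) (simp add: norm_mult field_simps)
      with False show ?thesis by (simp add: field_simps)
    next
      case True
      have "nrm linf (\<lambda>n. 0) = 0" unfolding linf_def by simp
      then show ?thesis using True by simp
    qed
  qed
  fix y assume "y \<in> vecs linf"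
  then have bxy: "bounded_seq y" by simp
  show "nrm linf (x + y) \<le> nrm linf x + nrm linf y"
  proof (rule linf_nrm_le)
    show "cmod ((x + y) n) \<le> nrm linf x + nrm linf y" for n
      using norm_triangle_ineq[of "x n" "y n"] linf_nrm_ge[OF bx, of n] linf_nrm_ge[OF bxy, of n]
      by simp
  qed
qed

interpretation linf: banach_sp linf
proof
  have "\<exists>l\<in>vecs linf. linf.conv x l" if x: "\<And>n. x n \<in> vecs linf" and c: "linf.cauchy x" for x
  proof -
    have pt: "cmod (x m k - x n k) \<le> nrm linf (x m - x n)" for m n k
      using linf_nrm_ge[of "x m - x n" k] linf.vecs_diff[OF x x, of m n] by simp
    have "Cauchy (\<lambda>n. x n k)" for k
    proof (rule metric_CauchyI)
      fix e :: real assume "e > 0"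
      then obtain N where "\<And>m n. m \<ge> N \<Longrightarrow> n \<ge> N \<Longrightarrow> nrm linf (x m - x n) < e"
        using c unfolding linf.cauchy_def by blast
      then show "\<exists>N. \<forall>m\<ge>N. \<forall>n\<ge>N. dist (x m k) (x n k) < e"
        unfolding dist_norm using pt by (meson order_le_less_trans)
    qed
    then have "\<exists>l. (\<lambda>n. x n k) \<longlonglongrightarrow> l" for k by (meson Cauchy_convergent convergentD)
    then obtain l where l: "\<And>k. (\<lambda>n. x n k) \<longlonglongrightarrow> l k" by metis
    have unif: "\<exists>N. \<forall>m\<ge>N. \<forall>k. cmod (x m k - l k) \<le> e" if e: "e > 0" for e
    proof -
      obtain N where N: "\<And>m n. m \<ge> N \<Longrightarrow> n \<ge> N \<Longrightarrow> nrm linf (x m - x n) < e"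
        using c e unfolding linf.cauchy_def by blast
      have "cmod (x m k - l k) \<le> e" if "m \<ge> N" for m k
      proof (rule tendsto_upperbound)
        show "(\<lambda>n. cmod (x m k - x n k)) \<longlonglongrightarrow> cmod (x m k - l k)"
          by (intro tendsto_intros l)
        show "\<forall>\<^sub>F n in sequentially. cmod (x m k - x n k) \<le> e"
          unfolding eventually_sequentially using N[OF that] pt
          by (meson less_imp_le order_trans)
      qed simp
      then show ?thesis by blast
    qed
    obtain N where N: "\<And>k. cmod (x N k - l k) \<le> 1" using unif[of 1] by auto
    then have "bounded_seq (x N - l)" by (intro bounded_seqI[of _ 1]) simp
    then have lV: "l \<in> vecs linf" using linf.vecs_diff[of "x N" "x N - l"] x[of N] by simp
    moreover have "linf.conv x l"
      unfolding linf.conv_def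
    proof (rule LIMSEQ_I)
      fix e :: real assume "e > 0"
      then obtain N where N: "\<And>m k. m \<ge> N \<Longrightarrow> cmod (x m k - l k) \<le> e / 2"
        using unif[of "e / 2"] by auto
      have "norm (nrm linf (x m - l) - 0) < e" if "m \<ge> N" for m
      proof -
        have "nrm linf (x m - l) \<le> e / 2" using N[OF that] by (intro linf_nrm_le) simp
        moreover have "0 \<le> nrm linf (x m - l)" using linf.vecs_diff[OF x lV] by (rule linf.nrm_nonneg)
        ultimately show ?thesis using \<open>e > 0\<close> by simp
      qed
      then show "\<exists>N. \<forall>m\<ge>N. norm (nrm linf (x m - l) - 0) < e" by blast
    qed
    ultimately show ?thesis by blast
  qed
  then show "Metric_space.mcomplete (vecs linf) (ndist linf)"
    unfolding linf.mcomplete_iff by blast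
qed

section \<open>The two operators\<close>

text \<open>This permutation doubles even numbers, moves the numbers \<open>4k+3\<close> to the even numbers \<open>4k+2\<close> left out
  by this, and spreads the numbers \<open>4k+1\<close> over all odd numbers. Hence it maps the even numbers into
  themselves, and the odd numbers that it maps to even ones are the \<open>4k+3\<close>.\<close>

definition shift :: "nat \<Rightarrow> nat" where
  "shift n = (if even n then 2 * n else if n mod 4 = 1 then (n + 1) div 2 else n - 1)"

definition unshift :: "nat \<Rightarrow> nat" where
  "unshift n = (if n mod 4 = 0 then n div 2 else if n mod 4 = 2 then n + 1 else 2 * n - 1)"

lemma shift_simps: "shift (2 * n) = 4 * n" "shift (4 * n + 1) = 2 * n + 1"
    "shift (4 * n + 3) = 4 * n + 2"
  by (simp_all add: shift_def mod_Suc)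

lemma unshift_simps: "unshift (4 * n) = 2 * n" "unshift (4 * n + 2) = 4 * n + 3"
  "unshift (2 * n + 1) = 4 * n + 1"
proof -
  have "(2 * n + 1) mod 4 \<noteq> 0" "(2 * n + 1) mod 4 \<noteq> 2" by presburger+
  then show "unshift (2 * n + 1) = 4 * n + 1" by (simp add: unshift_def)
qed (simp_all add: unshift_def mod_Suc)

lemma shift_unshift: "shift (unshift n) = n"
proof -
  have "(\<exists>k. n = 4 * k) \<or> (\<exists>k. n = 4 * k + 2) \<or> (\<exists>k. n = 2 * k + 1)" by presburger
  then show ?thesis by (elim disjE exE) (simp_all only: unshift_simps shift_simps)
qed

lemma unshift_shift: "unshift (shift n) = n"
proof -
  have "(\<exists>k. n = 2 * k) \<or> (\<exists>k. n = 4 * k + 1) \<or> (\<exists>k. n = 4 * k + 3)" by presburger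
  then show ?thesis by (elim disjE exE) (simp_all only: unshift_simps shift_simps)
qed

definition spread :: "(nat \<Rightarrow> complex) \<Rightarrow> nat \<Rightarrow> complex" where
  "spread x n = (if n mod 4 = 3 then x (n div 4) else 0)"

lemma spread_at: "spread x (4 * n + 3) = x n"
  by (simp add: spread_def)

lemma spread_unshift: "spread x (unshift (2 * n)) = (if odd n then x (n div 2) else 0)"
proof (cases "odd n")
  case True
  then obtain k where "n = 2 * k + 1" by (elim oddE)
  then show ?thesis using unshift_simps(2)[of k] spread_at[of x k] by simp
next
  case False
  then have "even n" by simp
  then obtain k where n: "n = 2 * k" by (elim evenE)
  have "(2 * k) mod 4 \<noteq> 3" by presburger
  then show ?thesis using unshift_simps(1)[of k] n by (simp add: spread_def)
qed

lemma bounded_seq_spread: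
  assumes "bounded_seq x"
  shows "bounded_seq (spread x)"
  using assms by (auto simp: bounded_seq_def spread_def intro: order_trans[OF norm_ge_zero])

lemma spread_unshift_tendsto:
  assumes "finite {n. x n \<noteq> 0}"
  shows "(\<lambda>n. spread x (unshift (2 * n))) \<longlonglongrightarrow> 0"
proof -
  obtain N where N: "\<And>n. x n \<noteq> 0 \<Longrightarrow> n \<le> N"
    using assms by (auto simp: finite_nat_set_iff_bounded_le)
  have "spread x (unshift (2 * n)) = 0" if "n \<ge> 2 * N + 2" for n
  proof -
    have "N < n div 2" using that by arith
    then show ?thesis using N[of "n div 2"] by (auto simp: spread_unshift)
  qed
  then show ?thesis
    by (intro tendsto_eventually) (auto simp: eventually_sequentially)
qed

definition null_on_evens :: "(nat \<Rightarrow> complex) set" where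
  "null_on_evens = {x. bounded_seq x \<and> (\<lambda>n. x (2 * n)) \<longlonglongrightarrow> 0}"

lemma uniform_limit_tendsto_0:
  assumes x: "\<And>m. bounded_seq (x m)" "\<And>m. (\<lambda>n. x m (f n)) \<longlonglongrightarrow> 0"
    and l: "bounded_seq l" "linf.conv x l"
  shows "(\<lambda>n. l (f n)) \<longlonglongrightarrow> 0"
proof (rule LIMSEQ_I)
  fix e :: real assume "e > 0"
  then obtain m where m: "nrm linf (x m - l) < e / 2"
    using order_tendstoD(2)[OF l(2)[unfolded linf.conv_def], of "e / 2"]
    by (auto simp: eventually_sequentially)
  obtain N where N: "\<And>n. n \<ge> N \<Longrightarrow> cmod (x m (f n)) < e / 2"
    using LIMSEQ_D[OF x(2)[of m], of "e / 2"] \<open>e > 0\<close> by auto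
  have "cmod (l (f n)) < e" if "n \<ge> N" for n
  proof -
    have "cmod (x m (f n) - l (f n)) \<le> nrm linf (x m - l)"
      using linf_nrm_ge[of "x m - l" "f n"] linf.vecs_diff[of "x m" l] x(1) l(1) by simp
    then show ?thesis
      using m N[OF that] norm_triangle_ineq2[of "l (f n)" "x m (f n)"]
      by (simp add: norm_minus_commute)
  qed
  then show "\<exists>N. \<forall>n\<ge>N. norm (l (f n) - 0) < e" by auto
qed

lemma closed_null_on_evens: "closed_subspace linf null_on_evens"
proof (rule linf.closed_subspaceI)
  show "linf.subspace null_on_evens"
    unfolding linf.subspace_def
  proof (intro conjI ballI allI)
    show "0 \<in> null_on_evens" by (auto simp: null_on_evens_def intro: bounded_seqI[of _ 0])
  qed (auto simp: null_on_evens_def intro!: bounded_seq_add bounded_seq_scl tendsto_mult_right_zero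
      tendsto_add_zero)
  fix x l assume "\<And>n. x n \<in> null_on_evens" "l \<in> vecs linf" "linf.conv x l"
  then show "l \<in> null_on_evens"
    using uniform_limit_tendsto_0[of x "\<lambda>n. 2 * n" l] by (auto simp: null_on_evens_def)
qed (auto simp: null_on_evens_def)

text \<open>The range consists of the sequences that tend to 0 along the even numbers and along \<open>4k+3\<close>, while
  elements of \<open>X\<close> carried by the numbers \<open>4k+3\<close> are arbitrary bounded sequences there.\<close>

lemma example_bounded_below:
  defines "X \<equiv> restr linf null_on_evens" and "A \<equiv> \<lambda>x n. x (shift n)"
  shows "cbanach X \<and> bounded_op X A \<and> bounded_below X A \<and> \<not> complemented X (range_space X A)"
proof -
  interpret X: banach_sp X
    unfolding X_def by (rule linf.banach_sp_restr[OF closed_null_on_evens])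
  have vX: "vecs X = null_on_evens" and sX: "scl X c x = (\<lambda>n. c * x n)" and nX: "nrm X = nrm linf"
    for c x by (simp_all add: X_def)
  have bX: "bounded_seq x" "(\<lambda>n. x (2 * n)) \<longlonglongrightarrow> 0" if "x \<in> vecs X" for x
    using that by (auto simp: vX null_on_evens_def)
  have sub: "(\<lambda>n. f (g n)) \<longlonglongrightarrow> 0" if "f \<longlonglongrightarrow> 0" "strict_mono g" for f :: "nat \<Rightarrow> complex" and g
    using LIMSEQ_subseq_LIMSEQ[OF that] by (simp add: o_def)
  have AX: "A x \<in> vecs X" if "x \<in> vecs X" for x
  proof -
    have "shift (2 * n) = 2 * (2 * n)" for n by (simp add: shift_simps)
    then show ?thesis
      using sub[OF bX(2)[OF that], of "\<lambda>n. 2 * n"] bounded_seq_comp[OF bX(1)[OF that]]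
      by (simp add: vX null_on_evens_def A_def strict_mono_def)
  qed
  have "bounded_op X A"
    unfolding bounded_op_def nX sX
  proof (intro conjI exI[of _ 1])
    show "A ` vecs X \<subseteq> vecs X" using AX by blast
    show "\<forall>x\<in>vecs X. nrm linf (A x) \<le> 1 * nrm linf x"
      using linf_nrm_comp bX(1) by (simp add: A_def)
  qed (simp_all add: A_def plus_fun_def)
  moreover have "bounded_below X A"
    unfolding bounded_below_def nX
  proof (intro exI[of _ 1] conjI ballI)
    fix x assume x: "x \<in> vecs X"
    have "nrm linf (\<lambda>n. A x (unshift n)) \<le> nrm linf (A x)"
      using bX(1)[OF AX[OF x]] by (rule linf_nrm_comp)
    then show "1 * nrm linf x \<le> nrm linf (A x)" by (simp add: A_def shift_unshift)
  qed simp
  moreover have "\<not> complemented X (range_space X A)"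
  proof (rule X.not_complemented_if_null_sequences[of spread "\<lambda>k y. y (4 * k + 3)"])
    show "spread x \<in> vecs X" if "bounded_seq x" for x
    proof -
      have "spread x (2 * n) = 0" for n
      proof -
        have "(2 * n) mod 4 \<noteq> 3" by presburger
        then show ?thesis by (simp add: spread_def)
      qed
      then show ?thesis using bounded_seq_spread[OF that] by (simp add: vX null_on_evens_def)
    qed
    show "spread (\<lambda>n. x n + y n) = spread x + spread y" for x y by (auto simp: spread_def)
    show "spread (\<lambda>n. c * x n) = scl X c (spread x)" for c x by (auto simp: spread_def sX)
    show "nrm X (spread x) \<le> 1" if "\<And>n. cmod (x n) \<le> 1" for x
      unfolding nX using that by (intro linf_nrm_le) (simp add: spread_def)
    show "cmod (x (4 * k + 3)) \<le> nrm X x" if "x \<in> vecs X" for k x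
      unfolding nX by (rule linf_nrm_ge[OF bX(1)[OF that]])
    show "spread x (4 * k + 3) = x k" for x k by (rule spread_at)
    show "spread x \<in> range_space X A" if "finite {n. x n \<noteq> 0}" for x
    proof -
      have "(\<lambda>n. spread x (unshift n)) \<in> vecs X"
        using spread_unshift_tendsto[OF that] bounded_seq_comp[OF bounded_seq_spread[OF bounded_seq_finite_support[OF that]]]
        by (simp add: vX null_on_evens_def)
      then have "A (\<lambda>n. spread x (unshift n)) \<in> range_space X A" by (simp add: range_space_def)
      then show ?thesis by (simp add: A_def unshift_shift)
    qed
    show "(\<lambda>k. s (4 * k + 3)) \<longlonglongrightarrow> 0" if s: "s \<in> range_space X A" for s
    proof -
      obtain y where y: "y \<in> vecs X" "s = A y"
        using s unfolding range_space_def by blast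
      have "s (4 * k + 3) = y (2 * (2 * k + 1))" for k
        using shift_simps(3)[of k] by (simp add: y(2) A_def)
      then show ?thesis
        using sub[OF bX(2)[OF y(1)], of "\<lambda>k. 2 * k + 1"] by (simp only:) (simp add: strict_mono_def)
    qed
  qed (auto simp: sX)
  ultimately show ?thesis
    using X.banach_sp_axioms by (simp add: cbanach_iff)
qed

text \<open>The copy of \<open>c\<^sub>0\<close> carried by the even numbers.\<close>

definition null_in_evens :: "(nat \<Rightarrow> complex) set" where
  "null_in_evens = {x \<in> null_on_evens. \<forall>n. x (2 * n + 1) = 0}"

lemma closed_null_in_evens: "closed_subspace linf null_in_evens"
proof (rule linf.closed_subspaceI)
  note S = linf.closed_subspaceD[OF closed_null_on_evens]
  show "linf.subspace null_in_evens"
    using linf.subspace_0[OF S(1)] linf.subspace_add[OF S(1)] linf.subspace_scale[OF S(1)]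
    by (auto simp: linf.subspace_def null_in_evens_def)
  show "null_in_evens \<subseteq> vecs linf" using S(2) by (auto simp: null_in_evens_def)
  fix x l assume x: "\<And>n. x n \<in> null_in_evens" and l: "l \<in> vecs linf" "linf.conv x l"
  have "l \<in> null_on_evens" using S(3)[of x l] x l by (auto simp: null_in_evens_def)
  moreover have "l (2 * n + 1) = 0" for n
  proof -
    have "(\<lambda>_::nat. l (2 * n + 1)) \<longlonglongrightarrow> 0"
      using uniform_limit_tendsto_0[of x "\<lambda>_. 2 * n + 1" l] x l
      by (auto simp: null_in_evens_def null_on_evens_def)
    then show ?thesis by (simp add: LIMSEQ_const_iff)
  qed
  ultimately show "l \<in> null_in_evens" by (simp add: null_in_evens_def)
qed

lemma null_in_evens_unshift_iff:
  assumes "bounded_seq x"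
  shows "(\<lambda>n. x (unshift n)) \<in> null_in_evens \<longleftrightarrow>
    (\<lambda>n. x (unshift (2 * n))) \<longlonglongrightarrow> 0 \<and> (\<forall>n. x (4 * n + 1) = 0)"
  unfolding null_in_evens_def null_on_evens_def mem_Collect_eq unshift_simps
  using bounded_seq_comp[OF assms] by blast

lemma null_in_evens_unshift:
  assumes "x \<in> null_in_evens"
  shows "(\<lambda>n. x (unshift n)) \<in> null_in_evens"
proof -
  have x: "bounded_seq x" "(\<lambda>n. x (2 * n)) \<longlonglongrightarrow> 0" "\<And>n. x (2 * n + 1) = 0"
    using assms by (auto simp: null_in_evens_def null_on_evens_def)
  have "x (4 * n + 1) = 0" for n using x(3)[of "2 * n"] by simp
  moreover have "(\<lambda>n. x (unshift (2 * n))) \<longlonglongrightarrow> 0"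
  proof (rule LIMSEQ_I)
    fix e :: real assume e: "e > 0"
    then obtain N where N: "\<And>n. n \<ge> N \<Longrightarrow> cmod (x (2 * n)) < e"
      using LIMSEQ_D[OF x(2), of e] by auto
    have "cmod (x (unshift (2 * n))) < e" if "n \<ge> 2 * N" for n
    proof (cases "odd n")
      case True
      then obtain k where "n = 2 * k + 1" by (elim oddE)
      then have "unshift (2 * n) = 2 * (2 * k + 1) + 1" using unshift_simps(2)[of k] by simp
      then have "x (unshift (2 * n)) = 0" using x(3)[of "2 * k + 1"] by (simp only:)
      then show ?thesis using e by simp
    next
      case False
      then have "even n" by simp
      then obtain k where k: "n = 2 * k" by (elim evenE)
      then have "unshift (2 * n) = 2 * k" using unshift_simps(1)[of k] by simp
      then show ?thesis using N[of k] that k by simp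
    qed
    then show "\<exists>N. \<forall>n\<ge>N. norm (x (unshift (2 * n)) - 0) < e" by auto
  qed
  ultimately show ?thesis using null_in_evens_unshift_iff[OF x(1)] by blast
qed

text \<open>The space is the quotient of the bounded sequences by the null sequences carried by the even
  numbers, which composition with \<open>unshift\<close> maps into themselves. The coordinates at odd numbers are
  well defined on the quotient; they separate the null space because its elements tend to 0 along
  the even numbers.\<close>

lemma example_surjective:
  obtains X :: "(nat \<Rightarrow> complex) cnspace" and A K where
    "banach_sp X" "bounded_op X A" "K > 0"
    "\<forall>y\<in>vecs X. \<exists>x\<in>vecs X. A x = y \<and> nrm X x \<le> K * nrm X y"
    "\<forall>x\<in>null_space X A - {0}. \<exists>\<phi>. normed_sp.bounded_functional X \<phi> \<and> \<phi> x \<noteq> 0"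
    "\<not> complemented X (null_space X A)"
proof -
  let ?K = null_in_evens
  note clK = closed_null_in_evens and K' = linf.closed_subspaceD[OF closed_null_in_evens]
  obtain V where V: "linf.subspace V" "V \<subseteq> vecs linf"
    "vecs linf = {k + v | k v. k \<in> ?K \<and> v \<in> V}" "?K \<inter> V = {0}"
    by (rule linf.algebraic_complement[OF K'(1) linf.subspace_vecs K'(2)])
  have ds: "direct_sum linf ?K V" unfolding direct_sum_def using V(3,4) by blast
  define X where "X = quotient_space linf ?K V"
  interpret X: banach_sp X
    unfolding X_def by (rule linf.banach_sp_quotient[OF clK V(1) ds])
  let ?q = "quotient_norm linf ?K"
  have vX [simp]: "vecs X = V" and sX: "scl X = (\<lambda>c x n. c * x n)" and nX [simp]: "nrm X = ?q"
    by (simp_all add: X_def scl_linf)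
  have VB: "bounded_seq v" if "v \<in> V" for v using that V(2) by auto
  have KB: "bounded_seq k" if "k \<in> ?K" for k using that K'(2) by auto
  have "\<exists>v. v \<in> V \<and> x - v \<in> ?K" if "bounded_seq x" for x
  proof -
    have "x \<in> {k + v | k v. k \<in> ?K \<and> v \<in> V}" unfolding V(3)[symmetric] using that by simp
    then obtain k v where kv: "x = k + v" "k \<in> ?K" "v \<in> V" by blast
    then show ?thesis by (intro exI[of _ v]) simp
  qed
  then obtain \<pi> where \<pi>: "\<And>x. bounded_seq x \<Longrightarrow> \<pi> x \<in> V" "\<And>x. bounded_seq x \<Longrightarrow> x - \<pi> x \<in> ?K"
    by (metis (no_types, lifting))
  have \<pi>I: "\<pi> x = v" if "bounded_seq x" "v \<in> V" "x - v \<in> ?K" for x v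
  proof -
    have "(x - v) - (x - \<pi> x) \<in> ?K" using linf.subspace_diff[OF K'(1) that(3) \<pi>(2)[OF that(1)]] .
    moreover have "\<pi> x - v \<in> V" using linf.subspace_diff[OF V(1) \<pi>(1)[OF that(1)] that(2)] .
    ultimately have "\<pi> x - v \<in> ?K \<inter> V" by simp
    then show ?thesis unfolding V(4) by simp
  qed
  have \<pi>cong: "\<pi> x = \<pi> y" if "bounded_seq x" "bounded_seq y" "x - y \<in> ?K" for x y
  proof (rule \<pi>I)
    have "(x - y) + (y - \<pi> y) \<in> ?K" by (rule linf.subspace_add[OF K'(1) that(3) \<pi>(2)[OF that(2)]])
    then show "x - \<pi> y \<in> ?K" by simp
  qed (use \<pi> that in auto)
  have \<pi>add: "\<pi> (x + y) = \<pi> x + \<pi> y" if "bounded_seq x" "bounded_seq y" for x y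
  proof (rule \<pi>I)
    have "(x - \<pi> x) + (y - \<pi> y) \<in> ?K" using linf.subspace_add[OF K'(1)] \<pi>(2) that by blast
    then show "x + y - (\<pi> x + \<pi> y) \<in> ?K" by (simp add: algebra_simps)
  qed (use \<pi> that linf.subspace_add[OF V(1)] bounded_seq_add in auto)
  have \<pi>scl: "\<pi> (\<lambda>n. c * x n) = (\<lambda>n. c * \<pi> x n)" if "bounded_seq x" for c x
  proof (rule \<pi>I)
    show "(\<lambda>n. c * \<pi> x n) \<in> V" using linf.subspace_scale[OF V(1) \<pi>(1)[OF that], of c] by simp
    have "(\<lambda>n. c * (x - \<pi> x) n) \<in> ?K" using linf.subspace_scale[OF K'(1) \<pi>(2)[OF that], of c] by simp
    then show "(\<lambda>n. c * x n) - (\<lambda>n. c * \<pi> x n) \<in> ?K"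
      by (simp add: fun_diff_def right_diff_distrib)
  qed (use bounded_seq_scl that in auto)
  have q\<pi>: "?q (\<pi> x) = ?q x" if "bounded_seq x" for x
    using linf.quotient_norm_shift[OF clK, of x "\<pi> x"] \<pi>[OF that] VB that by simp
  have q_le: "?q x \<le> nrm linf x" if "bounded_seq x" for x
    using linf.quotient_norm_le[OF clK, of x 0] linf.subspace_0[OF K'(1)] that by simp
  have odd_le: "cmod (x (2 * j + 1)) \<le> ?q x" if "bounded_seq x" for x j
  proof (rule linf.quotient_norm_ge[OF clK])
    fix k assume k: "k \<in> ?K"
    then have "k (2 * j + 1) = 0" by (simp add: null_in_evens_def)
    then show "cmod (x (2 * j + 1)) \<le> nrm linf (x - k)"
      using linf_nrm_ge[of "x - k" "2 * j + 1"] linf.vecs_diff[of x k] that KB[OF k] by simp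
  qed
  define A where "A x = \<pi> (\<lambda>n. x (unshift n))" for x
  have AV: "A x \<in> V" if "bounded_seq x" for x using that bounded_seq_comp \<pi>(1) by (simp add: A_def)
  have A\<pi>: "A (\<pi> x) = A x" if "bounded_seq x" for x
  proof -
    have "(\<lambda>n. (x - \<pi> x) (unshift n)) \<in> ?K" using null_in_evens_unshift[OF \<pi>(2)[OF that]] .
    then have "(\<lambda>n. x (unshift n)) - (\<lambda>n. \<pi> x (unshift n)) \<in> ?K" by (simp add: fun_diff_def)
    from \<pi>cong[OF _ _ this] show ?thesis
      using bounded_seq_comp that VB[OF \<pi>(1)[OF that]] by (simp add: A_def)
  qed
  have bA: "bounded_op X A"
    unfolding bounded_op_def vX sX nX
  proof (intro conjI ballI allI exI[of _ 1])
    show "A ` V \<subseteq> V" using AV VB by blast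
    show "A (x + y) = A x + A y" if "x \<in> V" "y \<in> V" for x y
      using \<pi>add[of "\<lambda>n. x (unshift n)" "\<lambda>n. y (unshift n)"] VB bounded_seq_comp that
      by (simp add: A_def plus_fun_def)
    show "A (\<lambda>n. c * x n) = (\<lambda>n. c * A x n)" if "x \<in> V" for c x
      using \<pi>scl[of "\<lambda>n. x (unshift n)" c] VB bounded_seq_comp that by (simp add: A_def)
    show "?q (A x) \<le> 1 * ?q x" if x: "x \<in> V" for x
    proof -
      have bu: "bounded_seq (\<lambda>n. x (unshift n))" using VB[OF x] by (rule bounded_seq_comp)
      have "?q (\<lambda>n. x (unshift n)) \<le> ?q x"
      proof (rule linf.quotient_norm_ge[OF clK])
        fix k assume k: "k \<in> ?K"
        have "?q (\<lambda>n. x (unshift n)) \<le> nrm linf ((\<lambda>n. x (unshift n)) - (\<lambda>n. k (unshift n)))"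
          using bu null_in_evens_unshift[OF k] by (intro linf.quotient_norm_le[OF clK]) auto
        also have "\<dots> = nrm linf (\<lambda>n. (x - k) (unshift n))" by (simp add: fun_diff_def)
        also have "\<dots> \<le> nrm linf (x - k)"
          using linf.vecs_diff[of x k] VB[OF x] KB[OF k] by (intro linf_nrm_comp[of "x - k"]) simp
        finally show "?q (\<lambda>n. x (unshift n)) \<le> nrm linf (x - k)" .
      qed
      then show ?thesis using q\<pi>[OF bu] by (simp add: A_def)
    qed
  qed
  have onto: "\<exists>x\<in>vecs X. A x = y \<and> nrm X x \<le> 2 * nrm X y" if y: "y \<in> vecs X" for y
  proof (cases "y = 0")
    case True
    then show ?thesis
      using linf.subspace_0[OF V(1)] X.bounded_op_0[OF bA] X.nrm_0 by (intro bexI[of _ 0]) auto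
  next
    case False
    have yV: "y \<in> V" using y by simp
    have "?q y > 0" using X.nrm_nonneg[OF y] X.nrm_eq_0[OF y] False by simp
    then obtain k where k: "k \<in> ?K" "nrm linf (y - k) < 2 * ?q y"
      using linf.quotient_norm_less[OF clK, of y "2 * ?q y"] by auto
    have byk: "bounded_seq (y - k)" using linf.vecs_diff[of y k] VB[OF yV] KB[OF k(1)] by simp
    define f where "f n = (y - k) (shift n)" for n
    have bf: "bounded_seq f" unfolding f_def[abs_def] using byk by (rule bounded_seq_comp)
    have "A (\<pi> f) = \<pi> (y - k)" unfolding A\<pi>[OF bf]
      by (simp add: A_def f_def shift_unshift fun_diff_def)
    also have "\<dots> = y"
      by (rule \<pi>I[OF byk yV]) (use linf.subspace_neg[OF K'(1) k(1)] in simp)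
    finally have "A (\<pi> f) = y" .
    moreover have "?q (\<pi> f) \<le> 2 * ?q y"
      using q\<pi>[OF bf] q_le[OF bf] linf_nrm_comp[OF byk, of shift] k(2) by (simp add: f_def[abs_def])
    ultimately show ?thesis using \<pi>(1)[OF bf] by auto
  qed
  have A0: "(\<lambda>n. x (unshift n)) \<in> ?K \<longleftrightarrow> A x = 0" if "bounded_seq x" for x
  proof
    assume "(\<lambda>n. x (unshift n)) \<in> ?K"
    then show "A x = 0"
      unfolding A_def using bounded_seq_comp[OF that] linf.subspace_0[OF V(1)] by (intro \<pi>I) auto
  next
    assume "A x = 0"
    then show "(\<lambda>n. x (unshift n)) \<in> ?K"
      using \<pi>(2)[OF bounded_seq_comp[OF that, of unshift]] by (simp add: A_def)
  qed
  have kerD: "s \<in> V" "(\<lambda>n. s (unshift (2 * n))) \<longlonglongrightarrow> 0" if "s \<in> null_space X A" for s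
    using that A0[OF VB, of s] null_in_evens_unshift_iff[OF VB, of s] by (auto simp: null_space_def)
  have sub: "(\<lambda>n. f (g n)) \<longlonglongrightarrow> 0" if "f \<longlonglongrightarrow> 0" "strict_mono g" for f :: "nat \<Rightarrow> complex" and g
    using LIMSEQ_subseq_LIMSEQ[OF that] by (simp add: o_def)
  have sep: "\<exists>\<phi>. X.bounded_functional \<phi> \<and> \<phi> x \<noteq> 0" if x: "x \<in> null_space X A" "x \<noteq> 0" for x
  proof (rule ccontr)
    assume none: "\<not> ?thesis"
    have "X.bounded_functional (\<lambda>x. x (2 * j + 1))" for j
      unfolding X.bounded_functional_def vX sX nX using odd_le VB by (auto intro!: exI[of _ 1])
    with none have "x (2 * j + 1) = 0" for j by blast
    moreover have "(\<lambda>n. x (2 * n)) \<longlonglongrightarrow> 0"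
    proof -
      have "unshift (2 * (2 * n)) = 2 * n" for n using unshift_simps(1)[of n] by simp
      then show ?thesis
        using sub[OF kerD(2)[OF x(1)], of "\<lambda>n. 2 * n"] by (simp add: strict_mono_def)
    qed
    ultimately have "x \<in> ?K \<inter> V"
      using kerD(1)[OF x(1)] VB by (auto simp: null_in_evens_def null_on_evens_def)
    with x(2) V(4) show False by blast
  qed
  have "\<not> complemented X (null_space X A)"
  proof (rule X.not_complemented_if_null_sequences[of "\<lambda>x. \<pi> (spread x)" "\<lambda>k y. y (4 * k + 3)"])
    show "\<pi> (spread x) \<in> vecs X" if "bounded_seq x" for x
      using \<pi>(1)[OF bounded_seq_spread[OF that]] by simp
    show "\<pi> (spread (\<lambda>n. x n + y n)) = \<pi> (spread x) + \<pi> (spread y)"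
      if "bounded_seq x" "bounded_seq y" for x y
    proof -
      have "spread (\<lambda>n. x n + y n) = spread x + spread y" by (auto simp: spread_def)
      then show ?thesis using \<pi>add bounded_seq_spread that by simp
    qed
    show "\<pi> (spread (\<lambda>n. c * x n)) = scl X c (\<pi> (spread x))" if "bounded_seq x" for c x
    proof -
      have "spread (\<lambda>n. c * x n) = (\<lambda>n. c * spread x n)" by (auto simp: spread_def)
      then show ?thesis using \<pi>scl[OF bounded_seq_spread[OF that]] by (simp add: sX)
    qed
    show "nrm X (\<pi> (spread x)) \<le> 1" if "\<And>n. cmod (x n) \<le> 1" for x
    proof -
      have "bounded_seq (spread x)" using that by (intro bounded_seq_spread bounded_seqI)
      moreover have "nrm linf (spread x) \<le> 1"
        using that by (intro linf_nrm_le) (simp add: spread_def)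
      ultimately show ?thesis using q\<pi> q_le by fastforce
    qed
    show "cmod (x (4 * k + 3)) \<le> nrm X x" if "x \<in> vecs X" for k x
      using odd_le[of x "2 * k + 1"] VB that by (simp add: numeral_3_eq_3)
    show "\<pi> (spread x) (4 * k + 3) = x k" if "bounded_seq x" for x k
    proof -
      have "(spread x - \<pi> (spread x)) (2 * (2 * k + 1) + 1) = 0"
        using \<pi>(2)[OF bounded_seq_spread[OF that]] unfolding null_in_evens_def by blast
      then show ?thesis using spread_at[of x k] by (simp add: numeral_3_eq_3)
    qed
    show "\<pi> (spread x) \<in> null_space X A" if "finite {n. x n \<noteq> 0}" for x
    proof -
      have b: "bounded_seq (spread x)" using that by (intro bounded_seq_spread bounded_seq_finite_support)
      have "spread x (4 * n + 1) = 0" for n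
      proof -
        have "(4 * n + 1) mod 4 \<noteq> 3" by presburger
        then show ?thesis by (simp add: spread_def)
      qed
      then have "(\<lambda>n. spread x (unshift n)) \<in> ?K"
        using null_in_evens_unshift_iff[OF b] spread_unshift_tendsto[OF that] by blast
      then have "A (\<pi> (spread x)) = 0" using A0[OF b] A\<pi>[OF b] by simp
      then show ?thesis using \<pi>(1)[OF b] by (simp add: null_space_def)
    qed
    show "(\<lambda>k. s (4 * k + 3)) \<longlonglongrightarrow> 0" if "s \<in> null_space X A" for s
    proof -
      have "unshift (2 * (2 * k + 1)) = 4 * k + 3" for k using unshift_simps(2)[of k] by simp
      then show ?thesis
        using sub[OF kerD(2)[OF that], of "\<lambda>k. 2 * k + 1"] by (simp only:) (simp add: strict_mono_def)
    qed
  qed (auto simp: sX)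
  then show ?thesis
    using onto sep by (intro that[OF X.banach_sp_axioms bA, of 2]) auto
qed



theorem mainTheorem5:
  shows
   "(\<exists>(X :: (nat \<Rightarrow> complex) cnspace) A.
       cbanach X \<and> bounded_op X A \<and>
       bounded_below X A \<and> \<not> complemented X (range_space X A) \<and>
       upper_gD_invertible Riesz X A \<and> upper_gD_invertible meromorphic_op X A \<and>
       \<not> generalized_Saphar_decomposition Riesz X A \<and>
       \<not> generalized_Saphar_decomposition meromorphic_op X A \<and>
       \<not> left_gD_invertible Riesz X A \<and> \<not> left_gD_invertible meromorphic_op X A) \<and>
    (\<exists>(X :: (nat \<Rightarrow> complex) cnspace) A.
       cbanach X \<and> bounded_op X A \<and>
       surjective X A \<and> \<not> complemented X (null_space X A) \<and>
       lower_gD_invertible Riesz X A \<and> lower_gD_invertible meromorphic_op X A \<and>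
       \<not> generalized_Saphar_decomposition Riesz X A \<and>
       \<not> generalized_Saphar_decomposition meromorphic_op X A \<and>
       \<not> right_gD_invertible Riesz X A \<and> \<not> right_gD_invertible meromorphic_op X A)"
proof (rule conjI, goal_cases)
  case 1
  obtain X :: "(nat \<Rightarrow> complex) cnspace" and A where X: "cbanach X" "bounded_op X A"
    "bounded_below X A" "\<not> complemented X (range_space X A)"
    using example_bounded_below by blast
  interpret banach_sp X using X(1) by (simp add: cbanach_iff)
  show ?case
    by (intro exI[of _ X] exI[of _ A] conjI X upper_gD_invertibleI[OF X(2,3)]
        bounded_below_obstruction[OF X(2-4)]) simp_all
next
  case 2
  obtain X :: "(nat \<Rightarrow> complex) cnspace" and A K where X: "banach_sp X" "bounded_op X A" "K > 0"
    "\<forall>y\<in>vecs X. \<exists>x\<in>vecs X. A x = y \<and> nrm X x \<le> K * nrm X y"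
    "\<forall>x\<in>null_space X A - {0}. \<exists>\<phi>. normed_sp.bounded_functional X \<phi> \<and> \<phi> x \<noteq> 0"
    "\<not> complemented X (null_space X A)"
    by (rule example_surjective)
  interpret banach_sp X by (rule X(1))
  have surj: "surjective X A"
    unfolding surjective_def range_space_def
  proof (intro equalityI subsetI)
    fix y assume "y \<in> vecs X"
    then obtain x where "x \<in> vecs X" "A x = y" using X(4) by blast
    then show "y \<in> A ` vecs X" by blast
  qed (use bounded_op_vecs[OF X(2)] in blast)
  have "cbanach X" using X(1) by (simp add: cbanach_iff)
  note no = surjective_obstruction[OF X(2,3) bspec[OF X(4)] _ X(6)]
  have no: "\<not> generalized_Saphar_decomposition \<P> X A \<and> \<not> right_gD_invertible \<P> X A"
    if "\<P> = Riesz \<or> \<P> = meromorphic_op" for \<P>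
    using that X(5) by (intro conjI no) auto
  show ?case
    using no[of Riesz] no[of meromorphic_op]
    by (intro exI[of _ X] exI[of _ A] conjI \<open>cbanach X\<close> X(2,6) surj
        lower_gD_invertibleI[OF X(2) surj]) simp_all
qed

end
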